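(* Let $T$ be a $(d_0,d_1)$-biregular tree with $d_0,d_1\ge 3$. Let $G$ be a non-compact, closed, topologically simple subgroup of $\operatorname{Aut}(T)$ acting transitively on $\partial T$ and satisfying Tits' independence property. Let $\xi\in\partial T$ and let $G^0_\xi\le G$ be the horospherical stabilizer of $\xi$. Let $\Gamma$ be a uniform (cocompact) lattice in $G$ and $X=G/\Gamma$. Then the $G^0_\xi$-action on $X$ by left translation is uniquely ergodic, i.e. there is exactly one $G^0_\xi$-invariant Borel probability measure on $X$.
   Context: $\operatorname{Aut}(T)$ denotes the group of automorphisms of $T$ acting without edge inversion; when $d_0=d_1$ this means the group of type-preserving automorphisms (those preserving the bipartition of the vertices). It carries the topology of pointwise convergence on vertices. For a subgraph $D$ of $T$, $G_D$ is the pointwise stabilizer of $D$ in $G$. For an oriented edge $[x,y]$, $T_{[x,y]}$ is the unique maximal subtree of $T$ that contains the edge $[x,y]$ but contains no neighbor of $x$ other than $y$. $G$ has Tits' independence property if $G_{[x,y]}=G_{T_{[x,y]}}G_{T_{[y,x]}}$ for every edge $[x,y]$ of $T$. The horospherical stabilizer of $\xi$ is $G^0_\xi=\{g\in G: g\xi=\xi,\ g\text{ elliptic}\}$, where elliptic means fixing a vertex of $T$. *)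

theory Defs
  imports
    "HOL-Algebra.Left_Coset"
    "HOL-Algebra.Bij"
    "HOL-Probability.Probability_Measure"
begin

section \<open>Trees\<close>

text \<open>A graph is given by a vertex set \<open>V\<close> and a symmetric irreflexive edge relation \<open>E\<close>;
  a pair \<open>(x, y) \<in> E\<close> is an oriented edge.\<close>

definition simple_graph :: "'v set \<Rightarrow> 'v rel \<Rightarrow> bool" where
  "simple_graph V E \<longleftrightarrow> E \<subseteq> V \<times> V \<and> sym E \<and> irrefl E"

definition graph_cycle :: "'v rel \<Rightarrow> 'v list \<Rightarrow> bool" where
  "graph_cycle E p \<longleftrightarrow> 3 \<le> length p \<and> distinct p \<and>
     (\<forall>i. Suc i < length p \<longrightarrow> (p ! i, p ! Suc i) \<in> E) \<and> (last p, hd p) \<in> E"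

definition tree :: "'v set \<Rightarrow> 'v rel \<Rightarrow> bool" where
  "tree V E \<longleftrightarrow> simple_graph V E \<and> V \<noteq> {} \<and> (\<forall>x\<in>V. \<forall>y\<in>V. (x, y) \<in> E\<^sup>*) \<and> (\<nexists>p. graph_cycle E p)"

definition bipartition :: "'v set \<Rightarrow> 'v rel \<Rightarrow> 'v set \<Rightarrow> 'v set \<Rightarrow> bool" where
  "bipartition V E A B \<longleftrightarrow> A \<union> B = V \<and> A \<inter> B = {} \<and> E \<subseteq> A \<times> B \<union> B \<times> A"

definition biregular_tree :: "nat \<Rightarrow> nat \<Rightarrow> 'v set \<Rightarrow> 'v rel \<Rightarrow> bool" where
  "biregular_tree d0 d1 V E \<longleftrightarrow> tree V E \<and>
     (\<exists>A B. bipartition V E A B \<and> (\<forall>v\<in>A. card (E `` {v}) = d0) \<and> (\<forall>v\<in>B. card (E `` {v}) = d1))"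

text \<open>A connected subgraph of a tree is an induced subgraph, so a subtree is identified with its
  vertex set.\<close>

definition subtree :: "'v set \<Rightarrow> 'v rel \<Rightarrow> 'v set \<Rightarrow> bool" where
  "subtree V E S \<longleftrightarrow> S \<subseteq> V \<and> tree S (E \<inter> S \<times> S)"

definition half_tree_cand :: "'v set \<Rightarrow> 'v rel \<Rightarrow> 'v \<Rightarrow> 'v \<Rightarrow> 'v set \<Rightarrow> bool" where
  "half_tree_cand V E x y S \<longleftrightarrow> subtree V E S \<and> x \<in> S \<and> y \<in> S \<and> S \<inter> E `` {x} \<subseteq> {y}"

definition half_tree :: "'v set \<Rightarrow> 'v rel \<Rightarrow> 'v \<Rightarrow> 'v \<Rightarrow> 'v set" where
  "half_tree V E x y = (THE S. half_tree_cand V E x y S \<and>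
     (\<forall>S'. half_tree_cand V E x y S' \<and> S \<subseteq> S' \<longrightarrow> S' = S))"

lemma half_tree_cand_Union:
  assumes T: "tree V E" and xy: "(x, y) \<in> E"
  shows "half_tree_cand V E x y (\<Union>{S. half_tree_cand V E x y S})"
proof -
  let ?F = "{S. half_tree_cand V E x y S}"
  let ?U = "\<Union>?F"
  have sg: "E \<subseteq> V \<times> V" "sym E" "irrefl E" and nocyc: "\<nexists>p. graph_cycle E p"
    using T by (auto simp: tree_def simple_graph_def)
  have nocyc': "\<nexists>p. graph_cycle (E \<inter> S \<times> S) p" for S
    using nocyc unfolding graph_cycle_def by blast
  have sg': "simple_graph S (E \<inter> S \<times> S)" for S
    using sg by (auto simp: simple_graph_def sym_def irrefl_def)
  have xne: "x \<noteq> y" using sg(3) xy by (auto simp: irrefl_def)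
  have yx: "(y, x) \<in> E" using sg(2) xy by (auto simp: sym_def)
  have base: "half_tree_cand V E x y {x, y}"
    unfolding half_tree_cand_def subtree_def tree_def
  proof (intro conjI ballI)
    show "(a, b) \<in> (E \<inter> {x, y} \<times> {x, y})\<^sup>*" if "a \<in> {x, y}" "b \<in> {x, y}" for a b
    proof -
      have "a = b \<or> (a, b) \<in> E \<inter> {x, y} \<times> {x, y}" using that xy yx by blast
      then show ?thesis by blast
    qed
    show "simple_graph {x, y} (E \<inter> {x, y} \<times> {x, y})" by (rule sg')
    show "\<nexists>p. graph_cycle (E \<inter> {x, y} \<times> {x, y}) p" by (rule nocyc')
    show "{x, y} \<subseteq> V" using sg(1) xy by blast
    show "{x, y} \<inter> E `` {x} \<subseteq> {y}" using sg(3) by (auto simp: irrefl_def)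
  qed simp_all
  have conn: "(a, x) \<in> (E \<inter> ?U \<times> ?U)\<^sup>* \<and> (x, a) \<in> (E \<inter> ?U \<times> ?U)\<^sup>*" if a: "a \<in> ?U" for a
  proof -
    obtain S where S: "half_tree_cand V E x y S" "a \<in> S" using a by blast
    have "(a, x) \<in> (E \<inter> S \<times> S)\<^sup>* \<and> (x, a) \<in> (E \<inter> S \<times> S)\<^sup>*"
      using S unfolding half_tree_cand_def subtree_def tree_def by blast
    moreover have "E \<inter> S \<times> S \<subseteq> E \<inter> ?U \<times> ?U" using S by blast
    ultimately show ?thesis using rtrancl_mono[of "E \<inter> S \<times> S" "E \<inter> ?U \<times> ?U"] by (meson subsetD)
  qed
  have "tree ?U (E \<inter> ?U \<times> ?U)"
    unfolding tree_def
  proof (intro conjI ballI)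
    show "?U \<noteq> {}" using base by blast
    show "(a, b) \<in> (E \<inter> ?U \<times> ?U)\<^sup>*" if "a \<in> ?U" "b \<in> ?U" for a b
      using conn[OF that(1), THEN conjunct1] conn[OF that(2), THEN conjunct2] by (rule rtrancl_trans)
    show "simple_graph ?U (E \<inter> ?U \<times> ?U)" by (rule sg')
    show "\<nexists>p. graph_cycle (E \<inter> ?U \<times> ?U) p" by (rule nocyc')
  qed
  moreover have "?U \<subseteq> V" unfolding half_tree_cand_def subtree_def by blast
  moreover have "x \<in> ?U" "y \<in> ?U" using base by blast+
  moreover have "?U \<inter> E `` {x} \<subseteq> {y}" unfolding half_tree_cand_def by blast
  ultimately show ?thesis unfolding half_tree_cand_def[of V E x y ?U] subtree_def by (intro conjI)
qed

lemma half_tree_eq_Union: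
  assumes "tree V E" "(x, y) \<in> E"
  shows "half_tree V E x y = \<Union>{S. half_tree_cand V E x y S}"
  unfolding half_tree_def
proof (rule the_equality)
  let ?U = "\<Union>{S. half_tree_cand V E x y S}"
  have cand: "half_tree_cand V E x y ?U" by (rule half_tree_cand_Union[OF assms])
  have ub: "S \<subseteq> ?U" if "half_tree_cand V E x y S" for S using that by (intro Union_upper CollectI)
  show "half_tree_cand V E x y ?U \<and> (\<forall>S'. half_tree_cand V E x y S' \<and> ?U \<subseteq> S' \<longrightarrow> S' = ?U)"
    using cand ub by (metis subset_antisym)
  show "S = ?U" if "half_tree_cand V E x y S \<and> (\<forall>S'. half_tree_cand V E x y S' \<and> S \<subseteq> S' \<longrightarrow> S' = S)" for S
    using cand ub that by metis
qed


section \<open>Automorphisms\<close>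

text \<open>Vertex maps are extensional on \<open>V\<close>, as in \<^const>\<open>BijGroup\<close>.\<close>

definition graph_auts :: "'v set \<Rightarrow> 'v rel \<Rightarrow> ('v \<Rightarrow> 'v) set" where
  "graph_auts V E = {g \<in> Bij V. \<forall>x\<in>V. \<forall>y\<in>V. (g x, g y) \<in> E \<longleftrightarrow> (x, y) \<in> E}"

text \<open>The type-preserving automorphisms. They invert no edge, and for \<open>d0 \<noteq> d1\<close> every graph
  automorphism of the biregular tree is type-preserving; see the lemmas below.\<close>

definition tree_auts :: "'v set \<Rightarrow> 'v rel \<Rightarrow> ('v \<Rightarrow> 'v) set" where
  "tree_auts V E = {g \<in> graph_auts V E. \<forall>A B. bipartition V E A B \<longrightarrow> g ` A = A \<and> g ` B = B}"

definition tree_aut_group :: "'v set \<Rightarrow> 'v rel \<Rightarrow> ('v \<Rightarrow> 'v) monoid" where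
  "tree_aut_group V E = BijGroup V \<lparr>carrier := tree_auts V E\<rparr>"

text \<open>Pointwise convergence on vertices.\<close>

definition tree_aut_topology :: "'v set \<Rightarrow> 'v rel \<Rightarrow> ('v \<Rightarrow> 'v) topology" where
  "tree_aut_topology V E =
     subtopology (product_topology (\<lambda>_. discrete_topology V) V) (tree_auts V E)"

lemma topspace_tree_aut_topology: "topspace (tree_aut_topology V E) = tree_auts V E"
  by (auto simp: tree_aut_topology_def tree_auts_def graph_auts_def Bij_def PiE_def
      dest: bij_betw_apply)

lemma tree_auts_no_inversion:
  assumes "biregular_tree d0 d1 V E" "g \<in> tree_auts V E" "(x, y) \<in> E"
  shows "\<not> (g x = y \<and> g y = x)"
proof
  assume *: "g x = y \<and> g y = x"
  obtain A B where AB: "bipartition V E A B"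
    using assms(1) by (auto simp: biregular_tree_def)
  then have "g ` A = A" "g ` B = B" using assms(2) by (auto simp: tree_auts_def)
  then show False using AB assms(3) * unfolding bipartition_def by blast
qed

lemma bipartition_unique:
  assumes T: "tree V E" and AB: "bipartition V E A B" and CD: "bipartition V E C D"
  shows "(A = C \<and> B = D) \<or> (A = D \<and> B = C)"
proof -
  obtain v where v: "v \<in> V" using T by (auto simp: tree_def)
  have same: "((w \<in> A \<longleftrightarrow> w \<in> C) \<longleftrightarrow> (v \<in> A \<longleftrightarrow> v \<in> C)) \<and> w \<in> V" if "(v, w) \<in> E\<^sup>*" for w
    using that
  proof induction
    case (step y z)
    have "(y, z) \<in> A \<times> B \<union> B \<times> A" "(y, z) \<in> C \<times> D \<union> D \<times> C"
      using step.hyps AB CD by (auto simp: bipartition_def)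
    then show ?case using step.IH AB CD unfolding bipartition_def by blast
  qed (use v in auto)
  have "\<forall>w\<in>V. (w \<in> A \<longleftrightarrow> w \<in> C) \<longleftrightarrow> (v \<in> A \<longleftrightarrow> v \<in> C)"
  proof
    fix w assume "w \<in> V"
    then have "(v, w) \<in> E\<^sup>*" using T v by (simp add: tree_def)
    then show "(w \<in> A \<longleftrightarrow> w \<in> C) \<longleftrightarrow> (v \<in> A \<longleftrightarrow> v \<in> C)" using same by blast
  qed
  moreover have "A \<subseteq> V" "C \<subseteq> V" "B = V - A" "D = V - C"
    using AB CD unfolding bipartition_def by blast+
  ultimately show ?thesis by (cases "v \<in> A \<longleftrightarrow> v \<in> C") blast+
qed

lemma graph_auts_eq_tree_auts:
  assumes T: "biregular_tree d0 d1 V E" and ne: "d0 \<noteq> d1"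
  shows "tree_auts V E = graph_auts V E"
proof -
  have tr: "tree V E" and EV: "E \<subseteq> V \<times> V"
    using T by (auto simp: biregular_tree_def tree_def simple_graph_def)
  obtain A B where AB: "bipartition V E A B"
    and dA: "\<forall>v\<in>A. card (E `` {v}) = d0" and dB: "\<forall>v\<in>B. card (E `` {v}) = d1"
    using T by (auto simp: biregular_tree_def)
  have Aeq: "A = {v \<in> V. card (E `` {v}) = d0}" and Beq: "B = {v \<in> V. card (E `` {v}) = d1}"
    using AB dA dB ne unfolding bipartition_def by auto
  have "g ` A = A \<and> g ` B = B" if g: "g \<in> graph_auts V E" for g
  proof -
    have b: "bij_betw g V V" using g by (auto simp: graph_auts_def Bij_def)
    have adj: "(g x, g y) \<in> E \<longleftrightarrow> (x, y) \<in> E" if "x \<in> V" "y \<in> V" for x y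
      using g that by (auto simp: graph_auts_def)
    have deg: "card (E `` {g v}) = card (E `` {v})" if v: "v \<in> V" for v
    proof -
      have "E `` {g v} = g ` (E `` {v})"
      proof (intro equalityI subsetI)
        fix w assume w: "w \<in> E `` {g v}"
        then have "w \<in> V" using EV by auto
        then obtain u where "u \<in> V" "w = g u" using b by (auto simp: bij_betw_def)
        then show "w \<in> g ` (E `` {v})" using w adj[OF v] by auto
      qed (use EV adj v in auto)
      moreover have "inj_on g (E `` {v})"
        by (rule inj_on_subset[of _ V]) (use b EV in \<open>auto simp: bij_betw_def\<close>)
      ultimately show ?thesis by (simp add: card_image)
    qed
    have img: "g ` {v \<in> V. card (E `` {v}) = d} = {v \<in> V. card (E `` {v}) = d}" for d
    proof (intro equalityI subsetI)
      fix w assume w: "w \<in> {v \<in> V. card (E `` {v}) = d}"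
      then obtain u where "u \<in> V" "w = g u" using b by (auto simp: bij_betw_def)
      then show "w \<in> g ` {v \<in> V. card (E `` {v}) = d}" using w deg by auto
    qed (use deg b in \<open>auto simp: bij_betw_def\<close>)
    show ?thesis unfolding Aeq Beq using img by blast
  qed
  then show ?thesis using bipartition_unique[OF tr AB] by (fastforce simp: tree_auts_def)
qed

definition fixator :: "('v \<Rightarrow> 'v) set \<Rightarrow> 'v set \<Rightarrow> ('v \<Rightarrow> 'v) set" where
  "fixator G D = {g \<in> G. \<forall>v\<in>D. g v = v}"

definition tits_independence :: "'v set \<Rightarrow> 'v rel \<Rightarrow> ('v \<Rightarrow> 'v) set \<Rightarrow> bool" where
  "tits_independence V E G \<longleftrightarrow> (\<forall>(x, y)\<in>E.
     fixator G {x, y} =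
       fixator G (half_tree V E x y) <#>\<^bsub>tree_aut_group V E\<^esub> fixator G (half_tree V E y x))"


section \<open>The boundary\<close>

definition ray :: "'v rel \<Rightarrow> (nat \<Rightarrow> 'v) \<Rightarrow> bool" where
  "ray E r \<longleftrightarrow> inj r \<and> (\<forall>n. (r n, r (Suc n)) \<in> E)"

definition cofinal_rays :: "'v rel \<Rightarrow> (nat \<Rightarrow> 'v) rel" where
  "cofinal_rays E = {(r, s). ray E r \<and> ray E s \<and> (\<exists>m n. \<forall>k. r (m + k) = s (n + k))}"

definition boundary :: "'v rel \<Rightarrow> (nat \<Rightarrow> 'v) set set" where
  "boundary E = {r. ray E r} // cofinal_rays E"

definition boundary_act :: "('v \<Rightarrow> 'v) \<Rightarrow> (nat \<Rightarrow> 'v) set \<Rightarrow> (nat \<Rightarrow> 'v) set" where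
  "boundary_act g \<xi> = (\<lambda>r. g \<circ> r) ` \<xi>"

lemma equiv_cofinal_rays: "equiv {r. ray E r} (cofinal_rays E)"
proof (rule equivI)
  show "cofinal_rays E \<subseteq> {r. ray E r} \<times> {r. ray E r}"
    by (auto simp: cofinal_rays_def)
  show "refl_on {r. ray E r} (cofinal_rays E)"
    by (auto simp: refl_on_def cofinal_rays_def)
  show "sym (cofinal_rays E)"
  proof (rule symI)
    fix r s assume "(r, s) \<in> cofinal_rays E"
    then obtain m n where *: "ray E r" "ray E s" "\<forall>k. r (m + k) = s (n + k)"
      unfolding cofinal_rays_def by blast
    then have "\<forall>k. s (n + k) = r (m + k)" by metis
    then show "(s, r) \<in> cofinal_rays E" using * unfolding cofinal_rays_def by blast
  qed
  show "trans (cofinal_rays E)"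
  proof (rule transI)
    fix r s t assume "(r, s) \<in> cofinal_rays E" "(s, t) \<in> cofinal_rays E"
    then obtain m n m' n' where *: "ray E r" "ray E t"
      and rs: "\<And>k. r (m + k) = s (n + k)" and st: "\<And>k. s (m' + k) = t (n' + k)"
      unfolding cofinal_rays_def by blast
    have "r (m + m' + k) = t (n' + n + k)" for k
    proof -
      have "r (m + m' + k) = s (n + (m' + k))" unfolding rs[symmetric] by (simp only: add.assoc)
      also have "\<dots> = s (m' + (n + k))" by (simp only: add.left_commute)
      also have "\<dots> = t (n' + n + k)" unfolding st by (simp only: add.assoc)
      finally show ?thesis .
    qed
    then show "(r, t) \<in> cofinal_rays E" using * unfolding cofinal_rays_def by blast
  qed
qed

definition transitive_on_boundary :: "'v rel \<Rightarrow> ('v \<Rightarrow> 'v) set \<Rightarrow> bool" where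
  "transitive_on_boundary E G \<longleftrightarrow>
     (\<forall>\<xi>\<in>boundary E. \<forall>\<eta>\<in>boundary E. \<exists>g\<in>G. boundary_act g \<xi> = \<eta>)"

definition elliptic :: "'v set \<Rightarrow> ('v \<Rightarrow> 'v) \<Rightarrow> bool" where
  "elliptic V g \<longleftrightarrow> (\<exists>v\<in>V. g v = v)"

definition horospherical_stabilizer ::
    "'v set \<Rightarrow> ('v \<Rightarrow> 'v) set \<Rightarrow> (nat \<Rightarrow> 'v) set \<Rightarrow> ('v \<Rightarrow> 'v) set" where
  "horospherical_stabilizer V G \<xi> = {g \<in> G. boundary_act g \<xi> = \<xi> \<and> elliptic V g}"


section \<open>Coset spaces, lattices and invariant measures\<close>

definition topologically_simple :: "('a, 'm) monoid_scheme \<Rightarrow> 'a topology \<Rightarrow> bool" where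
  "topologically_simple G \<tau> \<longleftrightarrow> carrier G \<noteq> {\<one>\<^bsub>G\<^esub>} \<and>
     (\<forall>N. N \<lhd> G \<and> closedin \<tau> N \<longrightarrow> N = {\<one>\<^bsub>G\<^esub>} \<or> N = carrier G)"

definition quotient_topology :: "'a topology \<Rightarrow> ('a \<Rightarrow> 'b) \<Rightarrow> 'b topology" where
  "quotient_topology \<tau> f =
     topology (\<lambda>U. U \<subseteq> f ` topspace \<tau> \<and> openin \<tau> {x \<in> topspace \<tau>. f x \<in> U})"

lemma openin_quotient_topology:
  "openin (quotient_topology \<tau> f) U \<longleftrightarrow>
     U \<subseteq> f ` topspace \<tau> \<and> openin \<tau> {x \<in> topspace \<tau>. f x \<in> U}"
proof -
  have "istopology (\<lambda>U. U \<subseteq> f ` topspace \<tau> \<and> openin \<tau> {x \<in> topspace \<tau>. f x \<in> U})"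
    unfolding istopology_def
  proof (intro conjI allI impI)
    fix S T
    assume "S \<subseteq> f ` topspace \<tau> \<and> openin \<tau> {x \<in> topspace \<tau>. f x \<in> S}"
      and "T \<subseteq> f ` topspace \<tau> \<and> openin \<tau> {x \<in> topspace \<tau>. f x \<in> T}"
    moreover have "{x \<in> topspace \<tau>. f x \<in> S \<inter> T} =
        {x \<in> topspace \<tau>. f x \<in> S} \<inter> {x \<in> topspace \<tau>. f x \<in> T}" by blast
    ultimately show "openin \<tau> {x \<in> topspace \<tau>. f x \<in> S \<inter> T}" by auto
  next
    fix \<K>
    assume K: "\<forall>K\<in>\<K>. K \<subseteq> f ` topspace \<tau> \<and> openin \<tau> {x \<in> topspace \<tau>. f x \<in> K}"
    have "{x \<in> topspace \<tau>. f x \<in> \<Union>\<K>} = (\<Union>K\<in>\<K>. {x \<in> topspace \<tau>. f x \<in> K})" by blast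
    then show "openin \<tau> {x \<in> topspace \<tau>. f x \<in> \<Union>\<K>}" using K by auto
  qed blast+
  then show ?thesis unfolding quotient_topology_def by simp
qed

lemma quotient_map_quotient_topology: "quotient_map \<tau> (quotient_topology \<tau> f) f"
proof -
  have "openin (quotient_topology \<tau> f) (f ` topspace \<tau>)"
  proof -
    have "{x \<in> topspace \<tau>. f x \<in> f ` topspace \<tau>} = topspace \<tau>" by blast
    then show ?thesis by (simp add: openin_quotient_topology)
  qed
  then have "topspace (quotient_topology \<tau> f) = f ` topspace \<tau>"
    using openin_quotient_topology[of \<tau> f "topspace (quotient_topology \<tau> f)"]
    by (auto dest: openin_subset)
  then show ?thesis by (auto simp: quotient_map_def openin_quotient_topology)
qed

definition coset_topology :: "('a, 'm) monoid_scheme \<Rightarrow> 'a topology \<Rightarrow> 'a set \<Rightarrow> 'a set topology"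
  where "coset_topology G \<tau> \<Gamma> = quotient_topology \<tau> (\<lambda>g. g <#\<^bsub>G\<^esub> \<Gamma>)"

lemma topspace_coset_topology:
  "topspace \<tau> = carrier G \<Longrightarrow> topspace (coset_topology G \<tau> \<Gamma>) = lcosets\<^bsub>G\<^esub> \<Gamma>"
  using quotient_imp_surjective_map[OF quotient_map_quotient_topology[of \<tau> "\<lambda>g. g <#\<^bsub>G\<^esub> \<Gamma>"]]
  unfolding coset_topology_def LCOSETS_def by (simp add: UNION_singleton_eq_range)

definition borel_sigma :: "'a topology \<Rightarrow> 'a measure" where
  "borel_sigma X = sigma (topspace X) {U. openin X U}"

definition invariant_borel_prob ::
    "('a, 'm) monoid_scheme \<Rightarrow> 'a topology \<Rightarrow> 'a set \<Rightarrow> 'a set \<Rightarrow> 'a set measure \<Rightarrow> bool" where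
  "invariant_borel_prob G \<tau> \<Gamma> H \<mu> \<longleftrightarrow>
     prob_space \<mu> \<and> sets \<mu> = sets (borel_sigma (coset_topology G \<tau> \<Gamma>)) \<and>
     (\<forall>h\<in>H. distr \<mu> \<mu> (\<lambda>C. h <#\<^bsub>G\<^esub> C) = \<mu>)"

text \<open>The invariant finite measure on \<open>G/\<Gamma>\<close> is normalised to total mass one.\<close>

definition lattice_in :: "('a, 'm) monoid_scheme \<Rightarrow> 'a topology \<Rightarrow> 'a set \<Rightarrow> bool" where
  "lattice_in G \<tau> \<Gamma> \<longleftrightarrow> subgroup \<Gamma> G \<and> subtopology \<tau> \<Gamma> = discrete_topology \<Gamma> \<and>
     (\<exists>\<mu>. invariant_borel_prob G \<tau> \<Gamma> (carrier G) \<mu>)"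

definition uniform_lattice_in :: "('a, 'm) monoid_scheme \<Rightarrow> 'a topology \<Rightarrow> 'a set \<Rightarrow> bool" where
  "uniform_lattice_in G \<tau> \<Gamma> \<longleftrightarrow> lattice_in G \<tau> \<Gamma> \<and> compact_space (coset_topology G \<tau> \<Gamma>)"

definition uniquely_ergodic ::
    "('a, 'm) monoid_scheme \<Rightarrow> 'a topology \<Rightarrow> 'a set \<Rightarrow> 'a set \<Rightarrow> bool" where
  "uniquely_ergodic G \<tau> \<Gamma> H \<longleftrightarrow> (\<exists>!\<mu>. invariant_borel_prob G \<tau> \<Gamma> H \<mu>)"

end

theory Submission
  imports Defs
begin

text \<open>Let \<open>r\<close> be a ray towards \<open>\<xi>\<close> and \<open>a \<in> G\<close> with \<open>a (r n) = r (n + 2)\<close>. By Tits' independence property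
  the stabilizer \<open>K\<close> of the edge \<open>r 0, r 1\<close> is \<open>U W\<close>, where \<open>U\<close> and \<open>W\<close> fix the half-trees away from
  and towards \<open>\<xi>\<close>; conjugation by powers of \<open>a\<close> contracts \<open>U\<close>, and all \<open>a^k W a^-k\<close> lie in the
  horospherical stabilizer. Let \<open>A\<close> be a subset of \<open>G/\<Gamma>\<close> invariant under the pointwise stabilizer of a
  finite set of vertices. For large \<open>k\<close> the set \<open>a^-k A\<close> is \<open>U\<close>-invariant, so for every \<open>W\<close>-invariant
  probability it occupies the same proportion of each \<open>K\<close>-orbit as for the \<open>G\<close>-invariant one. By
  cocompactness there are finitely many \<open>K\<close>-orbits; on them \<open>a\<close> induces a Markov chain, which is
  primitive because \<open>G\<close> is the normal closure of \<open>K\<close> and is generated by \<open>K\<close> and \<open>a\<close>. Hence the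
  proportions become independent of the orbit as \<open>k\<close> grows, and a horospherically invariant measure
  takes the same value on \<open>A\<close> as the \<open>G\<close>-invariant one.

  That the stabilizer of two distinct vertices \<open>x\<close>, \<open>v\<close> acts transitively on the neighbours of \<open>v\<close> pointing
  away from \<open>x\<close> follows from a Baire category argument on the boundary, together with the fact that
  an infinite orbit accumulates at every end.\<close>

section \<open>Paths in trees\<close>

text \<open>The measure \<open>\<nu>\<close> in question is not assumed invariant under
  \<open>a\<close>, so it cannot be compared directly along the powers of \<open>a\<close>. What
  survives is that \<open>\<nu>\<close> composed with \<open>a^k\<close> is still
  \<open>W\<close>-invariant. Hence \<open>\<nu> A\<close> is an average of the proportions of
  \<open>a^-k A\<close> in the \<open>K\<close>-orbits, with unknown weights. The proportions
  themselves are computed from the \<open>G\<close>-invariant measure alone; once they are nearly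
  constant, the weights no longer matter. The recursion for the proportions needs independence not
  only on whole orbits \<open>S'\<close> but on the pieces of \<open>S'\<close> inside
  \<open>a^r S\<close>. It is available there because \<open>a^r S\<close> is
  \<open>W\<close>-invariant, the conjugates \<open>a^-r W a^r\<close> staying inside
  \<open>K\<close>. Only sets invariant under the fixator of a finite vertex set are measured, so
  finite additivity suffices until the end, where these sets generate the Borel sets. Cocompactness
  enters twice: it makes the number of \<open>K\<close>-orbits finite, and it gives every nonempty
  set of this kind positive measure, so that the transition probabilities of the chain can be
  bounded from below.\<close>

definition gpath :: "'v rel \<Rightarrow> 'v list \<Rightarrow> bool" where
  "gpath E p \<longleftrightarrow> p \<noteq> [] \<and> successively (\<lambda>x y. (x, y) \<in> E) p \<and> distinct p"

text \<open>The endpoint is the head of the list: paths are extended by \<open>Cons\<close>.\<close>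

definition geo :: "'v rel \<Rightarrow> 'v \<Rightarrow> 'v \<Rightarrow> 'v list" where
  "geo E x y = (THE p. gpath E p \<and> last p = x \<and> hd p = y)"

locale tree_graph =
  fixes V :: "'v set" and E :: "'v rel"
  assumes tree: "tree V E"
begin

abbreviation seg where "seg x y \<equiv> set (geo E x y)"

lemma edge_V: "(x, y) \<in> E \<Longrightarrow> x \<in> V \<and> y \<in> V"
  using tree by (auto simp: tree_def simple_graph_def)

lemma edge_sym: "(x, y) \<in> E \<Longrightarrow> (y, x) \<in> E"
  using tree by (auto simp: tree_def simple_graph_def sym_def)

lemma edge_neq: "(x, y) \<in> E \<Longrightarrow> x \<noteq> y"
  using tree by (auto simp: tree_def simple_graph_def irrefl_def)

lemma connected: "x \<in> V \<Longrightarrow> y \<in> V \<Longrightarrow> (x, y) \<in> E\<^sup>*"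
  using tree by (auto simp: tree_def)

text \<open>If \<open>y\<close> already occurred, the part of the list up to it would be closed by
  the new edge to a cycle. Excluding a step back to \<open>hd p\<close> gives that cycle at least
  three vertices.\<close>

lemma gpath_extend:
  assumes p: "gpath E (x # p)" and e: "(y, x) \<in> E" and ne: "p = [] \<or> hd p \<noteq> y"
  shows "gpath E (y # x # p)"
proof -
  have "y \<notin> set (x # p)"
  proof
    assume "y \<in> set (x # p)"
    then obtain q r where qr: "x # p = q @ y # r" by (meson split_list)
    let ?c = "q @ [y]"
    have d: "distinct ?c" "successively (\<lambda>x y. (x, y) \<in> E) ?c"
      using p unfolding qr gpath_def by (auto simp: successively_append_iff)
    have xy: "x \<noteq> y" using edge_neq[OF e] by simp
    have q: "q \<noteq> []" using qr xy by auto
    have hq: "hd ?c = x" using q qr by (cases q) auto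
    have "length q \<noteq> 1"
    proof
      assume "length q = 1"
      then obtain b where "q = [b]" by (cases q) auto
      then have "p = y # r" using qr by simp
      then show False using ne by simp
    qed
    then have "3 \<le> length ?c" using q by (cases q rule: list.exhaust; simp) (cases "tl q"; simp)
    then have "graph_cycle E ?c"
      using d e hq unfolding graph_cycle_def successively_conv_nth by auto
    then show False using tree by (auto simp: tree_def)
  qed
  then show ?thesis using p e by (auto simp: gpath_def)
qed

lemma gpath_appendD: "gpath E (p @ q) \<Longrightarrow> q \<noteq> [] \<Longrightarrow> gpath E q"
  by (auto simp: gpath_def successively_append_iff)

lemma gpath_appendD1: "gpath E (p @ q) \<Longrightarrow> p \<noteq> [] \<Longrightarrow> gpath E p"
  by (auto simp: gpath_def successively_append_iff)

lemma gpath_rev: "gpath E p \<Longrightarrow> gpath E (rev p)"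
  unfolding gpath_def by (auto elim!: successively_mono edge_sym)

text \<open>In a tree it is enough not to backtrack at the joint: the vertices of \<open>p\<close>
  are pushed onto the second path one at a time, each by \<open>gpath_extend\<close>.\<close>

lemma gpath_join:
  assumes "gpath E (p @ [c])" "gpath E (c # q)" "p = [] \<or> q = [] \<or> last p \<noteq> hd q"
  shows "gpath E (p @ c # q)"
  using assms
proof (induction p arbitrary: c q rule: rev_induct)
  case (snoc b p)
  have bc: "(b, c) \<in> E" and bp: "gpath E (p @ [b])"
    using snoc.prems(1) by (auto simp: gpath_def successively_append_iff)
  have "gpath E (b # c # q)"
    by (rule gpath_extend) (use snoc.prems bc in auto)
  moreover have "p = [] \<or> last p \<noteq> c"
    using snoc.prems(1) by (auto simp: gpath_def dest: last_in_set)
  ultimately show ?case using snoc.IH[OF bp, of "c # q"] by auto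
qed simp

text \<open>The lists are compared from their common far end. Where they branch, one of them
  followed by the reverse of the other is again a path by \<open>gpath_join\<close>, yet it contains
  the common head twice.\<close>

lemma gpath_unique:
  assumes "gpath E p" "gpath E q" "hd p = hd q" "last p = last q"
  shows "p = q"
  using assms
proof (induction p arbitrary: q rule: rev_induct)
  case Nil then show ?case by (simp add: gpath_def)
next
  case (snoc x p)
  obtain q' where q: "q = q' @ [x]"
    using snoc.prems by (metis append_butlast_last_id gpath_def last_snoc)
  have d: "distinct (p @ [x])" "distinct (q' @ [x])" using snoc.prems q by (auto simp: gpath_def)
  show ?case
  proof (cases "p = [] \<or> q' = []")
    case True
    then have "p = [] \<and> q' = []" using snoc.prems(3) d q by (cases p; cases q') auto
    then show ?thesis using q by simp
  next
    case False
    have p: "gpath E p" "gpath E q'"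
      using gpath_appendD1[of p "[x]"] gpath_appendD1[of q' "[x]"] snoc.prems q False by auto
    have h: "hd p = hd q'" using snoc.prems(3) q False by simp
    show ?thesis
    proof (cases "last p = last q'")
      case True
      then show ?thesis using snoc.IH[OF p h] q by simp
    next
      case F: False
      have "gpath E (x # rev q')" using gpath_rev[OF snoc.prems(2)] q by simp
      then have "gpath E (p @ x # rev q')"
        using gpath_join[OF snoc.prems(1)] F False by (simp add: hd_rev)
      moreover have "hd p \<in> set p" "hd p \<in> set q'" using False h hd_in_set by metis+
      ultimately show ?thesis by (auto simp: gpath_def)
    qed
  qed
qed

lemma gpath_exists:
  assumes "(x, y) \<in> E\<^sup>*"
  shows "\<exists>p. gpath E p \<and> last p = x \<and> hd p = y"
  using assms
proof induction
  case base
  show ?case by (rule exI[of _ "[x]"]) (simp add: gpath_def)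
next
  case (step y z)
  then obtain p where p: "gpath E p" "last p = x" "hd p = y" by blast
  then obtain p' where p': "p = y # p'" by (cases p) (auto simp: gpath_def)
  show ?case
  proof (cases "p' \<noteq> [] \<and> hd p' = z")
    case True
    then have "gpath E p'" using p p' gpath_appendD[of "[y]" p'] by simp
    then show ?thesis using True p p' by auto
  next
    case False
    have "gpath E (z # y # p')"
      by (rule gpath_extend) (use p p' edge_sym[OF step.hyps(2)] False in auto)
    then show ?thesis using p p' by (intro exI[of _ "z # p"]) auto
  qed
qed

section \<open>Geodesics and their subdivision\<close>

lemma geo_eqI: "gpath E p \<Longrightarrow> last p = x \<Longrightarrow> hd p = y \<Longrightarrow> geo E x y = p"
  unfolding geo_def by (rule the_equality) (auto intro: gpath_unique)

lemma geo:
  assumes "x \<in> V" "y \<in> V"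
  shows "gpath E (geo E x y)" "last (geo E x y) = x" "hd (geo E x y) = y"
    "geo E x y \<noteq> []" "y \<in> seg x y" "x \<in> seg x y"
proof -
  obtain p where "gpath E p" "last p = x" "hd p = y"
    using gpath_exists[OF connected[OF assms]] by blast
  then show *: "gpath E (geo E x y)" "last (geo E x y) = x" "hd (geo E x y) = y"
    using geo_eqI by auto
  then show **: "geo E x y \<noteq> []" by (auto simp: gpath_def)
  show "y \<in> seg x y" using * ** hd_in_set by metis
  show "x \<in> seg x y" using * ** last_in_set by metis
qed

lemma geo_self [simp]: "geo E x x = [x]"
  by (rule geo_eqI) (simp_all add: gpath_def)

lemma geo_sym: "x \<in> V \<Longrightarrow> y \<in> V \<Longrightarrow> geo E y x = rev (geo E x y)"
  using geo[of x y] by (intro geo_eqI gpath_rev) (auto simp: hd_rev last_rev)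

lemma set_geo_sym: "x \<in> V \<Longrightarrow> y \<in> V \<Longrightarrow> seg y x = seg x y"
  by (metis geo_sym set_rev)

lemma gpath_subset_V: "gpath E p \<Longrightarrow> last p \<in> V \<Longrightarrow> set p \<subseteq> V"
proof (induction p)
  case (Cons x p)
  show ?case
  proof (cases p)
    case (Cons y q)
    then have "gpath E p" "(x, y) \<in> E" using Cons.prems by (auto simp: gpath_def)
    then show ?thesis using Cons.IH Cons.prems Cons edge_V by auto
  qed (use Cons.prems in auto)
qed simp

lemma geo_subset_V: "x \<in> V \<Longrightarrow> y \<in> V \<Longrightarrow> seg x y \<subseteq> V"
  using geo[of x y] by (intro gpath_subset_V) auto

lemma geo_split:
  assumes "x \<in> V" "y \<in> V" "z \<in> seg x y"
  shows "geo E x y = butlast (geo E z y) @ geo E x z"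
proof -
  obtain q r where qr: "geo E x y = q @ z # r" using assms(3) by (meson split_list)
  have p: "gpath E (q @ z # r)" using geo(1)[OF assms(1,2)] qr by simp
  have "gpath E (z # r)" using gpath_appendD[OF p] by simp
  then have 1: "geo E x z = z # r"
    using geo(2)[OF assms(1,2)] qr by (intro geo_eqI) auto
  have "gpath E (q @ [z])" using gpath_appendD1[of "q @ [z]" r] p by simp
  then have "geo E z y = q @ [z]"
    using geo(3)[OF assms(1,2)] qr by (intro geo_eqI) (auto simp: hd_append)
  then show ?thesis using 1 qr by simp
qed

lemma geo_trans:
  assumes "x \<in> V" "w \<in> V" "y \<in> seg x w" "z \<in> seg x y"
  shows "z \<in> seg x w"
  using geo_split[OF assms(1-3)] assms(4) by simp

lemma geo_trans':
  assumes "x \<in> V" "w \<in> V" "y \<in> seg x w" "z \<in> seg x y"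
  shows "y \<in> seg z w"
proof -
  have V: "y \<in> V" "z \<in> V" using geo_subset_V assms(1,2,3,4) by blast+
  have 1: "y \<in> seg w x" using assms(1-3) set_geo_sym by simp
  have z: "z \<in> seg w x" using geo_trans[OF assms] assms(1,2) set_geo_sym by simp
  have d: "distinct (geo E x w)" using geo(1)[OF assms(1,2)] by (simp add: gpath_def)
  show ?thesis
  proof (cases "y = z")
    case True then show ?thesis using geo(6)[of z w] V assms(2) by simp
  next
    case False
    have s1: "geo E x w = butlast (geo E z w) @ geo E x z"
      using geo_split[OF assms(1,2) geo_trans[OF assms]] .
    have "y \<notin> seg x z"
    proof
      assume y: "y \<in> seg x z"
      have "geo E x z = butlast (geo E y z) @ geo E x y" "geo E x y = butlast (geo E z y) @ geo E x z"
        using geo_split[OF assms(1) V(2) y] geo_split[OF assms(1) V(1) assms(4)] .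
      then have "geo E x z = geo E x y"
        by (metis append_assoc append_self_conv2 append_is_Nil_conv)
      then show False using geo(3) assms(1) V False by metis
    qed
    then show ?thesis using s1 assms(3) by (auto dest: in_set_butlastD)
  qed
qed

lemma geo_step:
  assumes "x \<in> V" "(v, z) \<in> E" "z \<notin> seg x v"
  shows "geo E x z = z # geo E x v"
proof -
  have V: "v \<in> V" "z \<in> V" using edge_V assms(2) by auto
  note g = geo[OF assms(1) V(1)]
  obtain p where p: "geo E x v = v # p" using g by (cases "geo E x v") auto
  show ?thesis
    by (rule geo_eqI) (use g p assms edge_sym in \<open>auto simp: gpath_def\<close>)
qed

lemma geo_back:
  assumes "x \<in> V" "(v, z) \<in> E" "z \<in> seg x v"
  shows "geo E x v = v # geo E x z"
proof -
  have V: "v \<in> V" "z \<in> V" using edge_V assms(2) by auto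
  have "geo E z v = [v, z]"
    by (rule geo_eqI) (use assms edge_neq in \<open>auto simp: gpath_def\<close>)
  then show ?thesis using geo_split[OF assms(1) V(1) assms(3)] by simp
qed

lemma geo_edge: "(v, z) \<in> E \<Longrightarrow> geo E v z = [z, v]"
  using geo_step[of v v z] edge_V edge_neq by fastforce

text \<open>The neighbours of \<open>v\<close> that point away from \<open>x\<close>: all of them if
  \<open>v = x\<close>, and otherwise all except the vertex just before \<open>v\<close> on the
  geodesic.\<close>

definition child :: "'v \<Rightarrow> 'v \<Rightarrow> 'v \<Rightarrow> bool" where
  "child x v z \<longleftrightarrow> (v, z) \<in> E \<and> z \<notin> seg x v"

lemma child_edge: "child x v z \<Longrightarrow> (v, z) \<in> E" by (simp add: child_def)

lemma child_geo: "x \<in> V \<Longrightarrow> child x v z \<Longrightarrow> geo E x z = z # geo E x v"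
  using geo_step by (simp add: child_def)

lemma child_self: "child x x z \<longleftrightarrow> (x, z) \<in> E"
  using edge_neq by (auto simp: child_def)

lemma nbr_unique_back:
  assumes "x \<in> V" "(v, z) \<in> E" "\<not> child x v z" "(v, z') \<in> E" "\<not> child x v z'"
  shows "z = z'"
proof -
  have "geo E x v = v # geo E x z" "geo E x v = v # geo E x z'"
    using assms geo_back by (auto simp: child_def)
  then have "geo E x z = geo E x z'" by simp
  then show ?thesis using geo(3) assms edge_V by metis
qed

lemma geo_last_step:
  assumes "x \<in> V" "y \<in> V" "x \<noteq> y"
  obtains z where "(z, y) \<in> E" "child x z y" "geo E x y = y # geo E x z"
proof -
  note g = geo[OF assms(1,2)]
  obtain p where p: "geo E x y = y # p" using g by (cases "geo E x y") auto
  have "p \<noteq> []" using p g(2) assms(3) by auto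
  then obtain z r where r: "p = z # r" by (cases p) auto
  have e: "(z, y) \<in> E" using g(1) edge_sym unfolding p r by (auto simp: gpath_def)
  have "z \<in> seg x y" using p r by simp
  then have b: "geo E x y = y # geo E x z" using geo_back[OF assms(1) edge_sym[OF e]] by blast
  then have "child x z y" using e g(1) by (auto simp: child_def gpath_def)
  with e b show ?thesis using that by blast
qed

text \<open>What lies behind \<open>w\<close> seen from a base point depends only on the edge
  through which the geodesic enters \<open>w\<close>. The geodesics from \<open>y\<close> to
  \<open>w\<close> and from \<open>w\<close> to \<open>v\<close> join without backtracking, since
  the piece beyond \<open>w\<close> avoids \<open>u\<close>.\<close>

lemma geo_base_change:
  assumes "x \<in> V" "y \<in> V" "v \<in> V" "(u, w) \<in> E"
    and "u \<in> seg x w" "u \<in> seg y w" "w \<in> seg x v"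
  shows "w \<in> seg y v" "geo E y v = butlast (geo E w v) @ geo E y w"
proof -
  have V: "u \<in> V" "w \<in> V" using edge_V assms by auto
  have gx: "geo E x w = w # geo E x u" and gy: "geo E y w = w # geo E y u"
    using geo_back edge_sym assms by auto
  have s: "geo E x v = butlast (geo E w v) @ geo E x w" using geo_split assms by blast
  have d: "distinct (geo E x v)" using geo(1) assms by (auto simp: gpath_def)
  note gw = geo[OF V(2) assms(3)]
  obtain p where p: "geo E w v = p @ [w]" using gw by (metis append_butlast_last_id)
  have "u \<notin> set p" using s d p gx geo(5)[OF assms(1) V(1)] by auto
  moreover have "hd (geo E y u) = u" "geo E y u \<noteq> []" using geo assms V by auto
  ultimately have "gpath E (p @ w # geo E y u)"
    using gpath_join[of p w "geo E y u"] gw(1) p geo(1)[OF assms(2) V(2)] gy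
    by (metis last_in_set)
  then have "geo E y v = p @ w # geo E y u"
    using geo(2)[OF assms(2) V(1)] gw(3) p \<open>geo E y u \<noteq> []\<close>
    by (intro geo_eqI) (auto simp: hd_append)
  then show "geo E y v = butlast (geo E w v) @ geo E y w" using p gy by simp
  then show "w \<in> seg y v" using gy by simp
qed

lemma beyond_child_cases:
  assumes "x \<in> V" "y \<in> V" "v \<in> seg x y" "v \<noteq> y"
  obtains z where "child x v z" "z \<in> seg x y"
proof -
  have vV: "v \<in> V" using assms geo_subset_V by blast
  have s: "geo E x y = butlast (geo E v y) @ geo E x v" using geo_split assms by blast
  obtain p where p: "geo E v y = p @ [v]" using geo[OF vV assms(2)] by (metis append_butlast_last_id)
  have "p \<noteq> []" using p geo(3)[OF vV assms(2)] assms(4) by auto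
  then obtain q z where q: "p = q @ [z]" by (metis append_butlast_last_id)
  have e: "(z, v) \<in> E" using geo(1)[OF vV assms(2)] p q by (auto simp: gpath_def successively_append_iff)
  have "z \<notin> seg x v"
    using geo(1)[OF assms(1,2)] unfolding s p q by (auto simp: gpath_def butlast_append)
  then have "child x v z" using e edge_sym by (auto simp: child_def)
  moreover have "z \<in> seg x y" unfolding s p q by (simp add: butlast_append)
  ultimately show ?thesis using that by blast
qed

section \<open>Rays\<close>

lemma ray_child:
  assumes "ray E r" shows "child (r 0) (r n) (r (Suc n))" "geo E (r 0) (r n) = rev (map r [0..<Suc n])"
proof -
  have e: "(r n, r (Suc n)) \<in> E" and i: "inj r" for n using assms by (auto simp: ray_def)
  have V: "r n \<in> V" for n using edge_V e by blast
  have g: "geo E (r 0) (r n) = rev (map r [0..<Suc n])" for n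
  proof (induction n)
    case (Suc n)
    have "r (Suc n) \<notin> seg (r 0) (r n)" using Suc i by (auto dest: injD)
    then show ?case using geo_step[OF V e] Suc by simp
  qed simp
  show "geo E (r 0) (r n) = rev (map r [0..<Suc n])" by (rule g)
  have "r (Suc n) \<noteq> r m" if "m < Suc n" for m using that inj_eq[OF i] by simp
  then have "r (Suc n) \<notin> seg (r 0) (r n)" unfolding g set_rev set_map image_iff by (metis atLeastLessThan_iff set_upt)
  then show "child (r 0) (r n) (r (Suc n))" using e by (simp add: child_def)
qed

lemma ray_V: "ray E r \<Longrightarrow> r n \<in> V"
  using edge_V by (auto simp: ray_def)

lemma rayI:
  assumes c: "\<And>n. child x (r n) (r (Suc n))" and x: "r 0 = x"
  shows "ray E r"
proof -
  have e: "(r n, r (Suc n)) \<in> E" for n using c child_edge by blast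
  have V: "r n \<in> V" for n using edge_V e by blast
  have g: "geo E x (r n) = rev (map r [0..<Suc n])" for n
  proof (induction n)
    case (Suc n)
    then show ?case using child_geo[OF _ c] V x by auto
  qed (simp add: x)
  have d: "distinct (map r [0..<Suc n])" for n
  proof -
    have "gpath E (geo E x (r n))" using geo(1) V x by blast
    then have "distinct (rev (map r [0..<Suc n]))" unfolding g gpath_def by blast
    then show ?thesis by (simp only: distinct_rev)
  qed
  have "inj r"
  proof (rule injI)
    fix m n assume eq: "r m = r n"
    have "inj_on r (set [0..<Suc (max m n)])" using d[of "max m n"] unfolding distinct_map by (rule conjunct2)
    moreover have "m \<in> set [0..<Suc (max m n)]" "n \<in> set [0..<Suc (max m n)]" by auto
    ultimately show "m = n" using eq by (meson inj_onD)
  qed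
  then show ?thesis using e by (simp add: ray_def)
qed

text \<open>The reversed geodesics from \<open>x\<close> to the \<open>w i\<close> prolong one
  another, and the \<open>n\<close>-th of them has more than \<open>n\<close> entries; the ray is
  their diagonal.\<close>

lemma chain_ray:
  assumes x: "x \<in> V" and V: "\<And>i. w i \<in> V" and w0: "w 0 = x"
    and c: "\<And>i. w i \<in> seg x (w (Suc i))" and ne: "\<And>i. w i \<noteq> w (Suc i)"
  obtains s where "ray E s" "s 0 = x" "\<And>i. \<exists>n. s n = w i"
proof -
  let ?L = "\<lambda>i. rev (geo E x (w i))"
  have split: "geo E x (w (Suc i)) = butlast (geo E (w i) (w (Suc i))) @ geo E x (w i)" for i
    using geo_split x V c by blast
  have long: "\<exists>q. ?L (i + k) = ?L i @ q" for i k
  proof (induction k)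
    case (Suc k)
    have "?L (i + Suc k) = ?L (i + k) @ rev (butlast (geo E (w (i+k)) (w (Suc (i+k)))))"
      using split[of "i+k"] by simp
    then show ?case using Suc by auto
  qed simp
  have len: "i < length (?L i)" for i
  proof (induction i)
    case 0 then show ?case using geo(4)[OF x V] by simp
  next
    case (Suc i)
    have "butlast (geo E (w i) (w (Suc i))) \<noteq> []"
    proof
      assume "butlast (geo E (w i) (w (Suc i))) = []"
      then have "geo E x (w (Suc i)) = geo E x (w i)" using split by simp
      then show False using geo(3)[OF x V] ne by metis
    qed
    then have "length (geo E x (w (Suc i))) > length (geo E x (w i))"
      by (subst split) (simp del: length_butlast)
    then show ?case using Suc by simp
  qed
  define s where "s n = ?L n ! n" for n
  have sL: "s n = ?L i ! n" if "n < length (?L i)" for n i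
  proof (cases "n \<le> i")
    case True
    then obtain q where "?L i = ?L n @ q" using long[of n "i - n"] by auto
    then show ?thesis using len[of n] by (simp add: s_def nth_append)
  next
    case False
    then obtain q where "?L n = ?L i @ q" using long[of i "n - i"] by auto
    then show ?thesis using that by (simp add: s_def nth_append)
  qed
  have dist: "distinct (?L i)" for i using geo(1)[OF x V] by (simp add: gpath_def)
  have succ: "successively (\<lambda>x y. (x, y) \<in> E) (?L i)" for i
    using gpath_rev[OF geo(1)[OF x V]] by (simp add: gpath_def)
  have inj: "inj s"
  proof (rule injI)
    fix m n assume eq: "s m = s n"
    let ?k = "max m n"
    have "m < length (?L ?k)" "n < length (?L ?k)" using len[of ?k] by auto
    moreover from this have "?L ?k ! m = ?L ?k ! n" using sL[of m ?k] sL[of n ?k] eq by simp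
    ultimately show "m = n" using nth_eq_iff_index_eq[OF dist[of ?k]] by blast
  qed
  have e: "(s n, s (Suc n)) \<in> E" for n
  proof -
    have l: "Suc n < length (?L (Suc n))" by (rule len)
    then have "(?L (Suc n) ! n, ?L (Suc n) ! Suc n) \<in> E"
      using succ[of "Suc n"] by (simp only: successively_conv_nth)
    then show ?thesis using sL[of n "Suc n"] sL[of "Suc n" "Suc n"] l by simp
  qed
  have s0: "s 0 = x" using w0 by (simp add: s_def)
  have "\<exists>n. s n = w i" for i
  proof -
    have "geo E x (w i) \<noteq> []" "hd (geo E x (w i)) = w i" using geo[OF x V] by blast+
    then have "w i \<in> set (?L i)" by (metis hd_in_set set_rev)
    then obtain n where "n < length (?L i)" "?L i ! n = w i" by (metis in_set_conv_nth)
    then show ?thesis using sL by metis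
  qed
  then show ?thesis using that inj e s0 by (auto simp: ray_def)
qed

end

section \<open>Groups of tree automorphisms\<close>

lemma group_tree_aut_group: "group (tree_aut_group V E)"
proof -
  interpret B: group "BijGroup V" by (rule group_BijGroup)
  have "subgroup (tree_auts V E) (BijGroup V)"
  proof (rule B.subgroupI)
    show "tree_auts V E \<subseteq> carrier (BijGroup V)"
      by (auto simp: tree_auts_def graph_auts_def BijGroup_def)
    have "(\<lambda>x\<in>V. x) ` A = A" if "A \<subseteq> V" for A using that by (auto simp: image_iff)
    then have "(\<lambda>x\<in>V. x) \<in> tree_auts V E"
      by (auto simp: tree_auts_def graph_auts_def id_Bij bipartition_def)
    then show "tree_auts V E \<noteq> {}" by blast
  next
    fix g assume g: "g \<in> tree_auts V E"
    then have gB: "g \<in> Bij V" and adj: "\<And>x y. x \<in> V \<Longrightarrow> y \<in> V \<Longrightarrow> (g x, g y) \<in> E \<longleftrightarrow> (x, y) \<in> E"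
      by (auto simp: tree_auts_def graph_auts_def)
    then have b: "bij_betw g V V" by (simp add: Bij_def)
    have inv: "inv\<^bsub>BijGroup V\<^esub> g = (\<lambda>x\<in>V. inv_into V g x)" using gB by (rule inv_BijGroup)
    have m: "inv_into V g x \<in> V" "g (inv_into V g x) = x" if "x \<in> V" for x
      using that b by (auto simp: bij_betw_def inv_into_into f_inv_into_f)
    have "(\<lambda>x\<in>V. inv_into V g x) ` A = A" if A: "g ` A = A" "A \<subseteq> V" for A
    proof -
      have "inv_into V g ` g ` A = A"
        using A b inv_into_image_cancel[of g V A] by (simp add: bij_betw_def)
      moreover have "(\<lambda>x\<in>V. inv_into V g x) ` A = inv_into V g ` A" using A(2) by (intro image_cong) auto
      ultimately show ?thesis using A(1) by metis
    qed
    moreover have "g ` A = A" "A \<subseteq> V" "g ` B = B" "B \<subseteq> V" if "bipartition V E A B" for A B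
      using that g by (auto simp: tree_auts_def bipartition_def)
    ultimately have im: "(\<lambda>x\<in>V. inv_into V g x) ` A = A \<and> (\<lambda>x\<in>V. inv_into V g x) ` B = B"
      if "bipartition V E A B" for A B using that by metis
    have "(inv_into V g x, inv_into V g y) \<in> E \<longleftrightarrow> (x, y) \<in> E" if "x \<in> V" "y \<in> V" for x y
      using adj[OF m(1)[OF that(1)] m(1)[OF that(2)]] m(2) that by simp
    then have "(\<lambda>x\<in>V. inv_into V g x) \<in> graph_auts V E"
      using gB by (simp add: graph_auts_def restrict_inv_into_Bij)
    then have "(\<lambda>x\<in>V. inv_into V g x) \<in> tree_auts V E"
      using im unfolding tree_auts_def by blast
    then show "inv\<^bsub>BijGroup V\<^esub> g \<in> tree_auts V E" by (simp add: inv)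
  next
    fix g h assume gh: "g \<in> tree_auts V E" "h \<in> tree_auts V E"
    then have B: "g \<in> Bij V" "h \<in> Bij V" by (auto simp: tree_auts_def graph_auts_def)
    have im: "compose V g h ` A = g ` h ` A" if "A \<subseteq> V" for A
      using that by (auto simp: compose_def image_iff)
    have im': "compose V g h ` A = A \<and> compose V g h ` B = B" if "bipartition V E A B" for A B
    proof -
      have "A \<subseteq> V" "B \<subseteq> V" "h ` A = A" "h ` B = B" "g ` A = A" "g ` B = B"
        using that gh unfolding tree_auts_def by (auto simp: bipartition_def)
      then show ?thesis by (simp only: im)
    qed
    have hV: "h x \<in> V" if "x \<in> V" for x using B that by (auto simp: Bij_def bij_betw_def)
    have adj: "(g x, g y) \<in> E \<longleftrightarrow> (x, y) \<in> E" "(h x, h y) \<in> E \<longleftrightarrow> (x, y) \<in> E"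
      if "x \<in> V" "y \<in> V" for x y using gh that by (auto simp: tree_auts_def graph_auts_def)
    have "(compose V g h x, compose V g h y) \<in> E \<longleftrightarrow> (x, y) \<in> E" if "x \<in> V" "y \<in> V" for x y
      using adj(1)[OF hV[OF that(1)] hV[OF that(2)]] adj(2)[OF that] that by (simp add: compose_def)
    then have "compose V g h \<in> graph_auts V E"
      using B by (simp add: graph_auts_def compose_Bij)
    then have "compose V g h \<in> tree_auts V E"
      using im' unfolding tree_auts_def by blast
    then show "g \<otimes>\<^bsub>BijGroup V\<^esub> h \<in> tree_auts V E" using B by (simp add: BijGroup_def)
  qed
  then show ?thesis unfolding tree_aut_group_def by (rule B.subgroup_imp_group)
qed

locale tree_action = tree_graph V E for V :: "'v set" and E :: "'v rel" +
  fixes A B :: "'v set" and G :: "('v \<Rightarrow> 'v) set"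
  assumes bip: "bipartition V E A B"
    and deg: "v \<in> V \<Longrightarrow> 3 \<le> card (E `` {v})"
    and sub: "subgroup G (tree_aut_group V E)"
begin

definition GG :: "('v \<Rightarrow> 'v) monoid" where
  "GG = tree_aut_group V E \<lparr>carrier := G\<rparr>"

lemma carrier_GG [simp]: "carrier GG = G"
  by (simp add: GG_def)

sublocale group GG
  unfolding GG_def using sub group_tree_aut_group by (rule subgroup.subgroup_is_group)

abbreviation gmult (infixl "\<cdot>" 70) where "g \<cdot> h \<equiv> g \<otimes>\<^bsub>GG\<^esub> h"
abbreviation inv\<^sub>G where "inv\<^sub>G g \<equiv> inv\<^bsub>GG\<^esub> g"
abbreviation coset_act (infixr "\<star>" 70) where "g \<star> C \<equiv> g <#\<^bsub>GG\<^esub> C"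
abbreviation GT where "GT \<equiv> subtopology (tree_aut_topology V E) G"
abbreviation gpow (infixr "\<up>" 75) where "g \<up> k \<equiv> g [^]\<^bsub>GG\<^esub> (k::nat)"

section \<open>Vertexwise form of the group operations\<close>

lemma G_tree_auts: "G \<subseteq> tree_auts V E"
  using subgroup.subset[OF sub] by (simp add: tree_aut_group_def)

lemma G_Bij: "g \<in> G \<Longrightarrow> g \<in> Bij V"
  using G_tree_auts by (auto simp: tree_auts_def graph_auts_def)

lemma G_V: "g \<in> G \<Longrightarrow> v \<in> V \<Longrightarrow> g v \<in> V"
  using G_Bij by (auto simp: Bij_def bij_betw_def)

lemma G_edge: "g \<in> G \<Longrightarrow> x \<in> V \<Longrightarrow> y \<in> V \<Longrightarrow> (g x, g y) \<in> E \<longleftrightarrow> (x, y) \<in> E"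
  using G_tree_auts by (auto simp: tree_auts_def graph_auts_def)

lemma G_edgeI: "g \<in> G \<Longrightarrow> (x, y) \<in> E \<Longrightarrow> (g x, g y) \<in> E"
  using G_edge edge_V by blast

lemma G_inj: "g \<in> G \<Longrightarrow> x \<in> V \<Longrightarrow> y \<in> V \<Longrightarrow> g x = g y \<longleftrightarrow> x = y"
  using G_Bij by (auto simp: Bij_def bij_betw_def inj_on_def)

lemma G_A: "g \<in> G \<Longrightarrow> v \<in> A \<Longrightarrow> g v \<in> A"
  using G_tree_auts bip unfolding tree_auts_def by blast

lemma G_mult: "g \<in> G \<Longrightarrow> h \<in> G \<Longrightarrow> g \<cdot> h \<in> G"
  using m_closed by simp

lemma mult_apply: "g \<in> G \<Longrightarrow> h \<in> G \<Longrightarrow> v \<in> V \<Longrightarrow> (g \<cdot> h) v = g (h v)"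
  using G_Bij by (simp add: GG_def tree_aut_group_def BijGroup_def compose_def)

lemma G_one: "\<one>\<^bsub>GG\<^esub> \<in> G"
  using one_closed by simp

lemma one_apply: "v \<in> V \<Longrightarrow> \<one>\<^bsub>GG\<^esub> v = v"
  by (simp add: GG_def tree_aut_group_def BijGroup_def)

lemma G_inv: "g \<in> G \<Longrightarrow> inv\<^sub>G g \<in> G"
  using inv_closed by simp

lemma inv_apply: "g \<in> G \<Longrightarrow> v \<in> V \<Longrightarrow> (inv\<^sub>G g) (g v) = v"
  using mult_apply[of "inv\<^sub>G g" g v] G_inv l_inv[of g] one_apply by simp

lemma apply_inv: "g \<in> G \<Longrightarrow> v \<in> V \<Longrightarrow> g ((inv\<^sub>G g) v) = v"
  using mult_apply[of g "inv\<^sub>G g" v] G_inv r_inv[of g] one_apply by simp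

lemma inv_apply_eq: "g \<in> G \<Longrightarrow> v \<in> V \<Longrightarrow> g v = w \<Longrightarrow> (inv\<^sub>G g) w = v"
  using inv_apply by auto

lemma G_ext: "g \<in> G \<Longrightarrow> h \<in> G \<Longrightarrow> (\<And>v. v \<in> V \<Longrightarrow> g v = h v) \<Longrightarrow> g = h"
  using G_Bij Bij_imp_extensional by (metis extensionalityI)

lemma bip_V: "A \<subseteq> V" "B \<subseteq> V" "A \<union> B = V" "A \<inter> B = {}"
  using bip by (auto simp: bipartition_def)

lemma bip_edge: "(u, v) \<in> E \<Longrightarrow> u \<in> A \<longleftrightarrow> v \<in> B" "(u, v) \<in> E \<Longrightarrow> u \<in> B \<longleftrightarrow> v \<in> A"
  using bip by (auto simp: bipartition_def)

lemma finite_nbrs: "v \<in> V \<Longrightarrow> finite (E `` {v})"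
  using deg[of v] by (metis card.infinite not_numeral_le_zero)

lemma nbr_avoid: "v \<in> V \<Longrightarrow> \<exists>z. (v, z) \<in> E \<and> z \<noteq> a \<and> z \<noteq> b"
proof (rule ccontr)
  assume v: "v \<in> V" and "\<nexists>z. (v, z) \<in> E \<and> z \<noteq> a \<and> z \<noteq> b"
  then have "E `` {v} \<subseteq> {a, b}" by auto
  then have "card (E `` {v}) \<le> card {a, b}" by (intro card_mono) auto
  also have "\<dots> \<le> 2" by (cases "a = b") auto
  finally show False using deg[OF v] by simp
qed

text \<open>At most one neighbour of \<open>w\<close> leads back to \<open>x\<close> and at most one
  back to \<open>y\<close>; degree three leaves another.\<close>

lemma common_child:
  assumes "x \<in> V" "y \<in> V" "w \<in> V" shows "\<exists>z. child x w z \<and> child y w z"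
proof -
  obtain p where p: "\<And>z. (w, z) \<in> E \<Longrightarrow> z \<noteq> p \<Longrightarrow> child x w z"
    using nbr_unique_back[OF assms(1)] by metis
  obtain q where q: "\<And>z. (w, z) \<in> E \<Longrightarrow> z \<noteq> q \<Longrightarrow> child y w z"
    using nbr_unique_back[OF assms(2)] by metis
  show ?thesis using nbr_avoid[OF assms(3), of p q] p q by blast
qed

lemma ex_child: "x \<in> V \<Longrightarrow> w \<in> V \<Longrightarrow> \<exists>z. child x w z"
  using common_child by blast

text \<open>\<open>length (geo E x v)\<close> counts vertices and exceeds the distance by one, so
  the bound \<open>0\<close> describes the empty set.\<close>

lemma finite_ball: "x \<in> V \<Longrightarrow> finite {v \<in> V. length (geo E x v) \<le> n}"
proof (induction n)
  case 0
  have "{v \<in> V. length (geo E x v) \<le> 0} = {}" using geo(4)[OF 0] by auto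
  then show ?case by (metis finite.emptyI)
next
  case (Suc n)
  let ?S = "{v \<in> V. length (geo E x v) \<le> n}"
  have "{v \<in> V. length (geo E x v) \<le> Suc n} \<subseteq> insert x (\<Union>u\<in>?S. E `` {u})"
  proof
    fix v assume v: "v \<in> {v \<in> V. length (geo E x v) \<le> Suc n}"
    show "v \<in> insert x (\<Union>u\<in>?S. E `` {u})"
    proof (cases "v = x")
      case False
      then obtain z where "(z, v) \<in> E" "geo E x v = v # geo E x z"
        using geo_last_step[of x v] v Suc.prems by auto
      then show ?thesis using v edge_V by auto
    qed simp
  qed
  moreover have "finite (insert x (\<Union>u\<in>?S. E `` {u}))"
    using Suc finite_nbrs by auto
  ultimately show ?case by (rule finite_subset)
qed

lemma countable_V: "countable V"
proof (cases "V = {}")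
  case False
  then obtain x where x: "x \<in> V" by blast
  have "V = (\<Union>n. {v \<in> V. length (geo E x v) \<le> n})" by auto
  moreover have "countable \<dots>" using finite_ball[OF x] by (intro countable_UN) (auto intro: countable_finite)
  ultimately show ?thesis by simp
qed simp

section \<open>Equivariance of geodesics and children\<close>

lemma geo_map: "g \<in> G \<Longrightarrow> x \<in> V \<Longrightarrow> y \<in> V \<Longrightarrow> geo E (g x) (g y) = map g (geo E x y)"
proof (rule geo_eqI)
  assume *: "g \<in> G" "x \<in> V" "y \<in> V"
  note p = geo[OF *(2,3)] and sV = geo_subset_V[OF *(2,3)]
  have "inj_on g (seg x y)" using sV G_inj[OF *(1)] by (meson inj_onI subsetD)
  moreover have "successively (\<lambda>a b. (g a, g b) \<in> E) (geo E x y)"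
    using p(1) G_edgeI[OF *(1)] unfolding gpath_def by (auto elim: successively_mono)
  ultimately show "gpath E (map g (geo E x y))"
    using p by (auto simp: gpath_def distinct_map successively_map)
  show "last (map g (geo E x y)) = g x" "hd (map g (geo E x y)) = g y"
    using p by (auto simp: last_map hd_map)
qed

lemma geo_mem_map:
  "g \<in> G \<Longrightarrow> x \<in> V \<Longrightarrow> y \<in> V \<Longrightarrow> z \<in> V \<Longrightarrow> g z \<in> seg (g x) (g y) \<longleftrightarrow> z \<in> seg x y"
  using geo_subset_V[of x y] by (auto simp: geo_map image_iff) (metis G_inj subsetD)

lemma child_map: "g \<in> G \<Longrightarrow> x \<in> V \<Longrightarrow> v \<in> V \<Longrightarrow> z \<in> V \<Longrightarrow> child (g x) (g v) (g z) \<longleftrightarrow> child x v z"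
  using geo_mem_map G_edge by (simp add: child_def)

lemma child_mapI: "g \<in> G \<Longrightarrow> x \<in> V \<Longrightarrow> child x v z \<Longrightarrow> child (g x) (g v) (g z)"
  using child_map child_edge edge_V by metis

lemma fix_geo:
  assumes "g \<in> G" "x \<in> V" "y \<in> V" "g x = x" "g y = y" "z \<in> seg x y"
  shows "g z = z"
proof -
  have "map g (geo E x y) = map id (geo E x y)" using geo_map[of g x y] assms by simp
  then show ?thesis using assms(6) by (simp only: map_eq_conv id_apply)
qed

definition loc_trans :: "'v \<Rightarrow> 'v \<Rightarrow> bool" where
  "loc_trans x v \<longleftrightarrow> (\<forall>z z'. child x v z \<longrightarrow> child x v z' \<longrightarrow> (\<exists>g\<in>G. g x = x \<and> g v = v \<and> g z = z'))"

lemma geo_seg_subset: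
  assumes "x \<in> V" "v \<in> V" "y \<in> seg x v"
  shows "seg y v \<subseteq> seg x v"
proof -
  have y: "y \<in> V" using assms geo_subset_V by blast
  have "geo E x v = butlast (geo E y v) @ geo E x y" using geo_split assms by blast
  moreover have "geo E y v = butlast (geo E y v) @ [y]" using geo[OF y assms(2)] by (metis append_butlast_last_id)
  ultimately show ?thesis using geo(5)[OF assms(1) y] by (metis Un_iff insert_subset list.set(2) set_append subsetI empty_iff insert_iff list.set(1))
qed

lemma child_seg:
  assumes "x \<in> V" "v \<in> V" "y \<in> seg x v" "y \<noteq> v"
  shows "child y v z \<longleftrightarrow> child x v z"
proof -
  have y: "y \<in> V" using assms geo_subset_V by blast
  note s = geo_seg_subset[OF assms(1-3)]
  obtain u where u: "(u, v) \<in> E" "geo E y v = v # geo E y u"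
    using geo_last_step[OF y assms(2,4)] by blast
  have uV: "u \<in> V" using u edge_V by blast
  have uy: "u \<in> seg y v" using u geo(5)[OF y uV] by simp
  then have ux: "u \<in> seg x v" using s by blast
  show ?thesis
    using s uy ux nbr_unique_back[OF assms(1), of v u z] edge_sym[OF u(1)] unfolding child_def by blast
qed

text \<open>Moving the base point from \<open>x\<close> towards \<open>v\<close> does not change the
  children of \<open>v\<close>, while the stabilizer can only grow: what fixes \<open>x\<close> and
  \<open>v\<close> fixes the geodesic between them.\<close>

lemma loc_trans_seg: "loc_trans x v \<Longrightarrow> x \<in> V \<Longrightarrow> v \<in> V \<Longrightarrow> y \<in> seg x v \<Longrightarrow> y \<noteq> v \<Longrightarrow> loc_trans y v"
  unfolding loc_trans_def using child_seg fix_geo by metis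

lemma loc_trans_map1:
  assumes "loc_trans x v" "x \<in> V" "v \<in> V" "g \<in> G"
  shows "loc_trans (g x) (g v)"
  unfolding loc_trans_def
proof (intro allI impI)
  fix z z' assume z: "child (g x) (g v) z" "child (g x) (g v) z'"
  then have zV: "z \<in> V" "z' \<in> V" using child_edge edge_V by blast+
  let ?i = "inv\<^sub>G g"
  note i = G_inv[OF assms(4)]
  have "child (?i (g x)) (?i (g v)) (?i z)" "child (?i (g x)) (?i (g v)) (?i z')"
    using child_mapI[OF i] z G_V assms by blast+
  then have "child x v (?i z)" "child x v (?i z')" using inv_apply assms by auto
  then obtain k where k: "k \<in> G" "k x = x" "k v = v" "k (?i z) = ?i z'" using assms(1) loc_trans_def by blast
  let ?h = "g \<cdot> (k \<cdot> ?i)"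
  have "?h w = g (k (?i w))" if "w \<in> V" for w
    using that k assms i by (simp add: mult_apply G_mult G_V)
  then have "?h (g x) = g x" "?h (g v) = g v" "?h z = z'"
    using k assms zV G_V inv_apply apply_inv by auto
  then show "\<exists>h\<in>G. h (g x) = g x \<and> h (g v) = g v \<and> h z = z'" using G_mult k i assms by blast
qed

lemma loc_trans_map: "x \<in> V \<Longrightarrow> v \<in> V \<Longrightarrow> g \<in> G \<Longrightarrow> loc_trans (g x) (g v) \<longleftrightarrow> loc_trans x v"
  using loc_trans_map1[of x v g] loc_trans_map1[of "g x" "g v" "inv\<^sub>G g"] G_V G_inv inv_apply by auto

text \<open>Since a vertex has finitely many children, one of them keeps infinitely many points of
  \<open>Y\<close> behind it. The end of \<open>r\<close> is an accumulation point of
  \<open>Y\<close> in the boundary.\<close>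

lemma koenig:
  assumes x: "x \<in> V" and Y: "infinite Y" "Y \<subseteq> V"
  obtains r where "ray E r" "r 0 = x" "\<And>n. infinite {y \<in> Y. r n \<in> seg x y}"
proof -
  let ?P = "\<lambda>v. v \<in> V \<and> infinite {y \<in> Y. v \<in> seg x y}"
  have "\<exists>r. \<forall>n. (?P (r n) \<and> (n = 0 \<longrightarrow> r n = x)) \<and> child x (r n) (r (Suc n))"
  proof (rule dependent_nat_choice)
    have "{y \<in> Y. x \<in> seg x y} = Y" using Y x geo(6) by blast
    then show "\<exists>v. ?P v \<and> ((0::nat) = 0 \<longrightarrow> v = x)" using x Y by auto
  next
    fix v and n :: nat assume v: "?P v \<and> (n = 0 \<longrightarrow> v = x)"
    let ?C = "{z. child x v z}"
    have fin: "finite ?C"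
      by (rule finite_subset[of _ "E `` {v}"]) (use v finite_nbrs in \<open>auto simp: child_def\<close>)
    have "{y \<in> Y. v \<in> seg x y} \<subseteq> insert v (\<Union>z\<in>?C. {y \<in> Y. z \<in> seg x y})"
    proof
      fix y assume y: "y \<in> {y \<in> Y. v \<in> seg x y}"
      show "y \<in> insert v (\<Union>z\<in>?C. {y \<in> Y. z \<in> seg x y})"
        using beyond_child_cases[OF x, of y v] y Y by blast
    qed
    then have "infinite (insert v (\<Union>z\<in>?C. {y \<in> Y. z \<in> seg x y}))"
      using v finite_subset by blast
    then obtain z where "child x v z" "infinite {y \<in> Y. z \<in> seg x y}" using fin by auto
    then show "\<exists>z. (?P z \<and> (Suc n = 0 \<longrightarrow> z = x)) \<and> child x v z" using child_edge edge_V by blast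
  qed
  then obtain r where r: "\<And>n. ?P (r n)" "r 0 = x" "\<And>n. child x (r n) (r (Suc n))" by blast
  then show ?thesis using that[of r] rayI[OF r(3,2)] by blast
qed

lemma end_transitive:
  assumes "transitive_on_boundary E G" "ray E r" "ray E s"
  obtains g m n where "g \<in> G" "\<And>k. g (r (m + k)) = s (n + k)"
proof -
  let ?c = "\<lambda>r. cofinal_rays E `` {r}"
  have b: "?c r \<in> boundary E" "?c s \<in> boundary E"
    using assms by (auto simp: boundary_def intro: quotientI)
  then obtain g where g: "g \<in> G" "boundary_act g (?c r) = ?c s"
    using assms(1) unfolding transitive_on_boundary_def by blast
  have "r \<in> ?c r" using assms equiv_class_self[OF equiv_cofinal_rays] by blast
  then have "g \<circ> r \<in> ?c s" using g(2) unfolding boundary_act_def by blast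
  then obtain m n where "\<forall>k. s (n + k) = (g \<circ> r) (m + k)" by (auto simp: cofinal_rays_def)
  then show ?thesis using that[of g m n] g by auto
qed

end

section \<open>Local transitivity\<close>

lemma openin_agree:
  assumes "finite F" "F \<subseteq> V" "c \<in> V \<rightarrow>\<^sub>E V"
  shows "openin (product_topology (\<lambda>_. discrete_topology V) V) {h \<in> V \<rightarrow>\<^sub>E V. \<forall>v\<in>F. h v = c v}"
proof -
  let ?S = "\<lambda>v. if v \<in> F then {c v} else V"
  have "{h \<in> V \<rightarrow>\<^sub>E V. \<forall>v\<in>F. h v = c v} = PiE V ?S"
    using assms by (auto simp: PiE_def Pi_def split: if_splits)
  moreover have "openin (product_topology (\<lambda>_. discrete_topology V) V) (PiE V ?S)"
  proof -
    have "{i \<in> V. ?S i \<noteq> topspace (discrete_topology V)} \<subseteq> F" by auto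
    then have "finite {i \<in> V. ?S i \<noteq> topspace (discrete_topology V)}"
      using assms(1) finite_subset by blast
    then show ?thesis using assms by (auto simp: openin_PiE_gen)
  qed
  ultimately show ?thesis by simp
qed

context tree_action
begin

text \<open>If one vertex has a finite orbit, then all do, because distances are preserved and balls
  are finite; so \<open>G\<close> lies in the compact product of its vertex orbits. It remains to
  see that \<open>G\<close> is closed among all maps and not only among automorphisms, that is, that
  a pointwise limit of elements of \<open>G\<close> is again a type-preserving automorphism.\<close>

lemma infinite_orbit:
  assumes cl: "closedin (tree_aut_topology V E) G" and nc: "\<not> compactin (tree_aut_topology V E) G"
    and x: "x \<in> V"
  shows "infinite ((\<lambda>g. g x) ` G)"
proof
  assume fx: "finite ((\<lambda>g. g x) ` G)"
  let ?P = "product_topology (\<lambda>_. discrete_topology V) V"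
  define orb where "orb v = (\<lambda>g. g v) ` G" for v
  have OV: "orb v \<subseteq> V" if "v \<in> V" for v using that G_V by (auto simp: orb_def)
  have forb: "finite (orb v)" if v: "v \<in> V" for v
  proof (rule finite_subset)
    let ?n = "length (geo E x v)"
    show "orb v \<subseteq> (\<Union>y\<in>orb x. {w \<in> V. length (geo E y w) \<le> ?n})"
    proof
      fix w assume "w \<in> orb v"
      then obtain g where g: "g \<in> G" "w = g v" by (auto simp: orb_def)
      then have "g x \<in> orb x" "w \<in> {w \<in> V. length (geo E (g x) w) \<le> ?n}"
        using geo_map[OF g(1) x v] G_V v by (auto simp: orb_def)
      then show "w \<in> (\<Union>y\<in>orb x. {w \<in> V. length (geo E y w) \<le> ?n})" by blast
    qed
    show "finite (\<Union>y\<in>orb x. {w \<in> V. length (geo E y w) \<le> ?n})"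
      using fx finite_ball OV[OF x] unfolding orb_def[symmetric] by blast
  qed
  have "compactin ?P (PiE V orb)"
    unfolding compactin_PiE using forb OV finite_imp_compactin by (metis topspace_discrete_topology)
  moreover have GO: "G \<subseteq> PiE V orb"
    using G_Bij Bij_imp_extensional by (auto simp: orb_def PiE_def)
  moreover have "closedin ?P G"
  proof -
    have GP: "G \<subseteq> topspace ?P" using GO OV by fastforce
    have "?P closure_of G \<subseteq> G"
    proof
      fix f assume f: "f \<in> ?P closure_of G"
      then have fP: "f \<in> V \<rightarrow>\<^sub>E V" by (auto simp: in_closure_of)
      have app: "\<exists>g\<in>G. \<forall>v\<in>F. g v = f v" if F: "finite F" "F \<subseteq> V" for F
      proof -
        let ?T = "{h \<in> V \<rightarrow>\<^sub>E V. \<forall>v\<in>F. h v = f v}"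
        have "f \<in> ?T" using fP by simp
        then obtain g where "g \<in> G" "g \<in> ?T" using f openin_agree[OF F fP] unfolding in_closure_of by meson
        then show ?thesis by blast
      qed
      have ed: "(f u, f v) \<in> E \<longleftrightarrow> (u, v) \<in> E" "f u = f v \<longleftrightarrow> u = v" if uv: "u \<in> V" "v \<in> V" for u v
      proof -
        obtain g where "g \<in> G" "g u = f u" "g v = f v" using app[of "{u, v}"] uv by auto
        then show "(f u, f v) \<in> E \<longleftrightarrow> (u, v) \<in> E" "f u = f v \<longleftrightarrow> u = v"
          using G_edge[of g u v] G_inj[of g u v] uv by auto
      qed
      \<comment> \<open>Surjectivity does not pass to pointwise limits in general. Here some
        \<open>g\<close> agrees with \<open>f\<close> on the whole finite orbit of \<open>v\<close>,
        and that orbit contains the preimage of \<open>v\<close> under \<open>g\<close>.\<close>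
      have onto: "\<exists>w\<in>V. f w = v \<and> (\<exists>g\<in>G. g w = v)" if v: "v \<in> V" for v
      proof -
        obtain g where g: "g \<in> G" "\<And>w. w \<in> orb v \<Longrightarrow> g w = f w"
          using app[OF forb[OF v] OV[OF v]] by blast
        have "(inv\<^sub>G g) v \<in> orb v" using g G_inv by (auto simp: orb_def)
        then show ?thesis using g apply_inv[OF g(1) v] OV[OF v] by (metis subsetD)
      qed
      have "bij_betw f V V"
        unfolding bij_betw_def
      proof
        show "inj_on f V" using ed(2) by (simp add: inj_on_def)
        have "V \<subseteq> f ` V" using onto by (metis imageI subsetI)
        then show "f ` V = V" using fP by (auto simp: PiE_def)
      qed
      then have "f \<in> graph_auts V E"
        using fP ed by (auto simp: graph_auts_def Bij_def PiE_def)
      moreover have "f ` C = C \<and> f ` D = D" if CD: "bipartition V E C D" for C D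
      proof -
        have inv: "g ` C = C" "g ` D = D" if "g \<in> G" for g
          using that CD G_tree_auts unfolding tree_auts_def by blast+
        have im: "f ` S = S" if S: "S \<subseteq> V" "\<And>g. g \<in> G \<Longrightarrow> g ` S = S" for S
        proof (intro equalityI subsetI)
          fix v assume "v \<in> f ` S"
          then obtain w where w: "w \<in> S" "v = f w" by blast
          then obtain g where "g \<in> G" "g w = f w" using app[of "{w}"] S(1) by auto
          then have "v \<in> g ` S" using w by (metis imageI)
          then show "v \<in> S" using S(2)[OF \<open>g \<in> G\<close>] by simp
        next
          fix v assume v: "v \<in> S"
          obtain w g where w: "w \<in> V" "f w = v" "g \<in> G" "g w = v" using onto v S(1) by blast
          then obtain w' where "w' \<in> S" "g w' = v" using S(2)[OF w(3)] v by (metis imageE)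
          then show "v \<in> f ` S" using w G_inj[OF w(3) w(1), of w'] S(1) by (auto intro!: image_eqI[of _ f w])
        qed
        show ?thesis using im[of C] im[of D] inv CD unfolding bipartition_def by blast
      qed
      ultimately have fT: "f \<in> tree_auts V E" by (simp add: tree_auts_def)
      have "f \<in> tree_aut_topology V E closure_of G"
        using f fT G_tree_auts unfolding tree_aut_topology_def
        by (simp add: closure_of_subtopology Int_absorb1)
      then show "f \<in> G" using cl closure_of_closedin by metis
    qed
    then show ?thesis using GP closure_of_subset_eq by blast
  qed
  ultimately have "compactin ?P G" using closed_compactin by blast
  then show False using nc G_tree_auts by (simp add: tree_aut_topology_def compactin_subtopology)
qed

text \<open>Extension step of a Baire category argument: if infinitely many vertices of \<open>r\<close> fail to be
  transitive, then the ends \<open>g r\<close> with \<open>g (r 0) = y\<close> are nowhere dense.\<close>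

lemma avoid_step:
  assumes r: "ray E r" and bad: "\<And>n0. \<exists>n\<ge>n0. 0 < n \<and> \<not> loc_trans (r 0) (r n)"
    and x: "x \<in> V" and y: "y \<in> V" and w: "w \<in> V"
  shows "\<exists>w'\<in>V. w \<in> seg x w' \<and> w \<noteq> w' \<and>
    (\<exists>u. (u, w') \<in> E \<and> u \<in> seg x w' \<and> u \<in> seg y w') \<and>
    (\<forall>g\<in>G. \<forall>n. g (r 0) = y \<longrightarrow> g (r n) \<noteq> w')"
proof -
  obtain w1 where w1: "child x w w1" "child y w w1" using common_child[OF x y w] by blast
  then have w1V: "w1 \<in> V" and e1: "(w, w1) \<in> E" using child_edge edge_V by blast+
  have gx1: "geo E x w1 = w1 # geo E x w" and gy1: "geo E y w1 = w1 # geo E y w"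
    using child_geo x y w1 by blast+
  have wx1: "w \<in> seg x w1" and wy1: "w \<in> seg y w1"
    using gx1 gy1 geo(5) x y w by auto
  show ?thesis
  proof (cases "\<exists>g\<in>G. \<exists>n. g (r 0) = y \<and> g (r n) = w1")
    case False
    then show ?thesis using w1V e1 wx1 wy1 edge_neq by blast
  next
    case True
    then obtain g n where g: "g \<in> G" "g (r 0) = y" "g (r n) = w1" by blast
    \<comment> \<open>Beyond \<open>w1\<close> the translate of \<open>r\<close> reaches a vertex
      \<open>v\<close> at which the stabilizer of \<open>y\<close> and \<open>v\<close> has at least
      two orbits on the children of \<open>v\<close>.\<close>
    obtain m where m: "n \<le> m" "0 < m" "\<not> loc_trans (r 0) (r m)" using bad[of n] by blast
    have rV: "r k \<in> V" for k using ray_V r by blast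
    have rgeo: "geo E (h (r 0)) (h (r k)) = map h (rev (map r [0..<Suc k]))" if "h \<in> G" for h k
      using geo_map[OF that rV rV] ray_child(2)[OF r] by metis
    define v where "v = g (r m)"
    have vV: "v \<in> V" using rV g G_V by (simp add: v_def)
    have "\<not> loc_trans y v" using loc_trans_map[OF rV rV g(1), of 0 m] m(3) g(2) by (simp add: v_def)
    then obtain z z' where z: "child y v z" "child y v z'"
      and nz: "\<not> (\<exists>k\<in>G. k y = y \<and> k v = v \<and> k z = z')" unfolding loc_trans_def by blast
    define z0 where "z0 = g (r (Suc m))"
    have z0: "child y v z0"
      using child_mapI[OF g(1) rV ray_child(1)[OF r, of m]] g(2) by (simp add: v_def z0_def)
    have z0V: "z0 \<in> V" using z0 child_edge edge_V by blast
    \<comment> \<open>\<open>z\<close> and \<open>z'\<close> lie in different orbits, so at least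
      one of them is not in the orbit of \<open>z0\<close>, the child through which
      \<open>g r\<close> continues. The new vertex \<open>w'\<close> will be that child
      \<open>zs\<close>.\<close>
    have "\<exists>zs\<in>{z, z'}. \<not> (\<exists>k\<in>G. k y = y \<and> k v = v \<and> k z0 = zs)"
    proof (rule ccontr)
      assume "\<not> ?thesis"
      then obtain k k' where k: "k \<in> G" "k y = y" "k v = v" "k z0 = z"
        and k': "k' \<in> G" "k' y = y" "k' v = v" "k' z0 = z'" by blast
      let ?h = "k' \<cdot> inv\<^sub>G k"
      have "?h w = k' ((inv\<^sub>G k) w)" if "w \<in> V" for w using mult_apply k k' G_inv that by blast
      then have "?h y = y" "?h v = v" "?h z = z'"
        using k k' inv_apply_eq[of k] y vV z0V z child_edge edge_V by metis+
      then show False using nz G_mult k k' G_inv by blast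
    qed
    then obtain zs where zs: "child y v zs" "\<not> (\<exists>k\<in>G. k y = y \<and> k v = v \<and> k z0 = zs)"
      using z by blast
    have zsV: "zs \<in> V" and ezs: "(v, zs) \<in> E" using zs child_edge edge_V by blast+
    have gyz: "geo E y zs = zs # geo E y v" using child_geo y zs by blast
    have gyv: "geo E y v = map g (rev (map r [0..<Suc m]))" using rgeo[OF g(1), of m] g(2) by (simp add: v_def)
    have w1v: "w1 \<in> seg y v" 
  proof -
    have "n \<in> set [0..<Suc m]" using m(1) by auto
    then show ?thesis using g(3) unfolding gyv set_map set_rev by blast
  qed
    then have w1z: "w1 \<in> seg y zs" using gyz by simp
    have bc: "w1 \<in> seg x zs" "geo E x zs = butlast (geo E w1 zs) @ geo E x w1"
      using geo_base_change[OF y x zsV e1 wy1 wx1 w1z] by auto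
    have sy: "geo E y zs = butlast (geo E w1 zs) @ geo E y w1" using geo_split[OF y zsV w1z] .
    have vyz: "v \<in> seg y zs" using gyz geo(5)[OF y vV] by simp
    have vxz: "v \<in> seg x zs"
    proof (cases "v \<in> seg y w1")
      case False
      then show ?thesis using vyz sy bc(2) by auto
    next
      case True
      have "v = w1"
      proof (rule ccontr)
        assume "v \<noteq> w1"
        have "geo E y v = butlast (geo E w1 v) @ geo E y w1" using geo_split[OF y vV w1v] .
        moreover have "geo E y w1 = butlast (geo E v w1) @ geo E y v" using geo_split[OF y w1V True] .
        ultimately have "geo E y v = geo E y w1"
          by (metis append_assoc append_self_conv2 append_is_Nil_conv)
        then show False using geo(3) y vV w1V \<open>v \<noteq> w1\<close> by metis
      qed
      then show ?thesis using bc(1) by simp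
    qed
    have "w \<in> seg x zs" using geo_trans[OF x zsV bc(1) wx1] .
    moreover have "w \<noteq> zs"
    proof
      assume "w = zs"
      then have "geo E x w = butlast (geo E w1 w) @ w1 # geo E x w" using bc(2) gx1 by simp
      then have "length (geo E x w) = length (butlast (geo E w1 w) @ w1 # geo E x w)" by (rule arg_cong)
      then show False by simp
    qed
    \<comment> \<open>The distance from \<open>y\<close> forces \<open>n' = Suc m\<close>, and
      uniqueness of geodesics forces \<open>g' (r m) = v\<close>. Then \<open>g' g^-1\<close> would
      fix \<open>y\<close> and \<open>v\<close> and carry \<open>z0\<close> to
      \<open>zs\<close>.\<close>
    moreover have "g' (r n') \<noteq> zs" if g': "g' \<in> G" "g' (r 0) = y" for g' n'
    proof
      assume eq: "g' (r n') = zs"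
      have 1: "geo E y zs = map g' (rev (map r [0..<Suc n']))" using rgeo[OF g'(1), of n'] g'(2) eq by simp
      then have "length (map g' (rev (map r [0..<Suc n']))) = Suc (length (map g (rev (map r [0..<Suc m]))))"
        using gyz gyv by simp
      then have n': "n' = Suc m" by simp
      have "geo E y v = map g' (rev (map r [0..<Suc m]))" using 1 gyz n' by simp
      then have "hd (map g' (rev (map r [0..<Suc m]))) = v" using geo(3)[OF y vV] by simp
      then have gm: "g' (r m) = v" by simp
      let ?h = "g' \<cdot> inv\<^sub>G g"
      have "?h w = g' ((inv\<^sub>G g) w)" if "w \<in> V" for w using mult_apply g g' G_inv that by blast
      then have "?h y = y" "?h v = v" "?h z0 = zs"
        using g g' gm eq n' inv_apply_eq[OF g(1) rV] y vV z0V v_def z0_def by metis+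
      then show False using zs(2) G_mult g g' G_inv by blast
    qed
    ultimately show ?thesis using zsV ezs vxz vyz by blast
  qed
qed

text \<open>Baire category by hand. The countably many vertices \<open>?y i\<close> exhaust the
  possible images of \<open>r 0\<close>, and \<open>w (Suc i)\<close> is chosen off every translate
  of \<open>r\<close> that starts at \<open>?y i\<close>. By transitivity some translate is cofinal
  with the limiting ray \<open>s\<close>. It has to pass the vertex \<open>w (Suc i)\<close>
  belonging to its own starting point, because that vertex is entered through the same edge from
  \<open>x\<close> and from \<open>?y i\<close>.\<close>

lemma eventually_loc_trans:
  assumes tr: "transitive_on_boundary E G" and r: "ray E r"
  shows "\<exists>n0. \<forall>n\<ge>n0. 0 < n \<longrightarrow> loc_trans (r 0) (r n)"
proof (rule ccontr)
  assume neg: "\<not> ?thesis"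
  have bad: "\<exists>n\<ge>n0. 0 < n \<and> \<not> loc_trans (r 0) (r n)" for n0
  proof -
    have "\<not> (\<forall>n\<ge>n0. 0 < n \<longrightarrow> loc_trans (r 0) (r n))" using neg by blast
    then show ?thesis by blast
  qed
  define x where "x = r 0"
  have x: "x \<in> V" using ray_V r by (simp add: x_def)
  have ne: "V \<noteq> {}" using x by blast
  let ?y = "from_nat_into V"
  have yV: "?y i \<in> V" for i by (rule from_nat_into[OF ne])
  let ?Q = "\<lambda>i w w'. w \<in> seg x w' \<and> w \<noteq> w' \<and>
    (\<exists>u. (u, w') \<in> E \<and> u \<in> seg x w' \<and> u \<in> seg (?y i) w') \<and>
    (\<forall>g\<in>G. \<forall>n. g (r 0) = ?y i \<longrightarrow> g (r n) \<noteq> w')"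
  have "\<exists>w. \<forall>n. (w n \<in> V \<and> (n = 0 \<longrightarrow> w n = x)) \<and> ?Q n (w n) (w (Suc n))"
  proof (rule dependent_nat_choice)
    fix u and n :: nat assume "u \<in> V \<and> (n = 0 \<longrightarrow> u = x)"
    then show "\<exists>w'. (w' \<in> V \<and> (Suc n = 0 \<longrightarrow> w' = x)) \<and> ?Q n u w'"
      using avoid_step[OF r bad x yV[of n], of u] by (metis Suc_neq_Zero)
  qed (use x in auto)
  then obtain w where w: "\<forall>n. (w n \<in> V \<and> (n = 0 \<longrightarrow> w n = x)) \<and> ?Q n (w n) (w (Suc n))" ..
  then have wV: "w n \<in> V" and w0: "w 0 = x" and Q: "?Q n (w n) (w (Suc n))" for n by simp_all
  obtain s where s: "ray E s" "s 0 = x" "\<And>i. \<exists>n. s n = w i"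
    using chain_ray[of x w] x wV w0 Q by blast
  obtain g m n where g: "g \<in> G" "\<And>k. g (r (m + k)) = s (n + k)" using end_transitive[OF tr r s(1)] by blast
  have gxV: "g (r 0) \<in> V" using g G_V x x_def by auto
  obtain i where i: "?y i = g (r 0)" using from_nat_into_surj[OF countable_V gxV] by blast
  obtain N where N: "s N = w (Suc i)" using s(3) by blast
  obtain u where u: "(u, w (Suc i)) \<in> E" "u \<in> seg x (w (Suc i))" "u \<in> seg (?y i) (w (Suc i))"
    using Q[of i] by blast
  have sV: "s k \<in> V" for k using ray_V s(1) by blast
  have "w (Suc i) \<in> seg x (s (n + N))"
    using ray_child(2)[OF s(1), of "n + N"] s(2) N by (metis atLeastLessThan_iff imageI le_add2 less_Suc_eq_le set_map set_rev set_upt zero_le)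
  then have "w (Suc i) \<in> seg (?y i) (s (n + N))"
    using geo_base_change(1)[OF x yV sV u] by blast
  then have "w (Suc i) \<in> seg (g (r 0)) (g (r (m + N)))" using i g(2) by simp
  then have "w (Suc i) \<in> set (map g (rev (map r [0..<Suc (m + N)])))"
    using geo_map[OF g(1) ray_V[OF r] ray_V[OF r], of 0 "m + N"] ray_child(2)[OF r, of "m + N"] by simp
  then obtain j where "w (Suc i) = g (r j)" by auto
  then show False using Q[of i] g(1) i by metis
qed

text \<open>Infinitely many exceptions would accumulate along a ray \<open>r\<close>, whose own
  vertices are good from \<open>n0\<close> on. Goodness of these vertices lets the stabilizer of
  \<open>x\<close> push any vertex behind \<open>r n0\<close> step by step onto the ray, so an
  exception behind \<open>r n0\<close> would be a translate of a good vertex.\<close>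

lemma finite_not_loc_trans:
  assumes tr: "transitive_on_boundary E G" and x: "x \<in> V"
  shows "finite {v \<in> V. \<not> loc_trans x v}"
proof (rule ccontr)
  assume "infinite {v \<in> V. \<not> loc_trans x v}"
  then obtain r where r: "ray E r" "r 0 = x"
    and inf: "\<And>n. infinite {y \<in> {v \<in> V. \<not> loc_trans x v}. r n \<in> seg x y}"
    using koenig[OF x, of "{v \<in> V. \<not> loc_trans x v}"] by blast
  obtain n1 where n1: "\<And>n. n1 \<le> n \<Longrightarrow> 0 < n \<Longrightarrow> loc_trans (r 0) (r n)" using eventually_loc_trans[OF tr r(1)] by blast
  \<comment> \<open>The successor keeps the index positive, as \<open>n1\<close> requires.\<close>
  define n0 where "n0 = Suc n1"
  have n0: "loc_trans x (r n)" if "n0 \<le> n" for n using n1[of n] that r(2) by (simp add: n0_def)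
  have rV: "r n \<in> V" for n using ray_V r by blast
  have reach: "\<exists>g\<in>G. g x = x \<and> g v = r (n0 + k)"
    if "v \<in> V" "r n0 \<in> seg x v" "length (geo E x v) = Suc (n0 + k)" for k v
    using that
  proof (induction k arbitrary: v)
    case 0
    have "length (geo E x (r n0)) = Suc n0" using ray_child(2)[OF r(1), of n0] r(2) by simp
    moreover have s: "geo E x v = butlast (geo E (r n0) v) @ geo E x (r n0)" using geo_split x 0 by blast
    ultimately have "butlast (geo E (r n0) v) = []"
      using 0(3) by (metis add_cancel_left_left length_0_conv length_append add_0_right)
    then have "geo E x v = geo E x (r n0)" using s by simp
    then have "v = r n0" using geo(3) x rV 0 by metis
    then show ?case using G_one one_apply x rV by (intro bexI[of _ "\<one>\<^bsub>GG\<^esub>"]) auto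
  next
    case (Suc k)
    have "v \<noteq> x" using Suc.prems(3) by auto
    then obtain u where u: "(u, v) \<in> E" "child x u v" "geo E x v = v # geo E x u"
      using geo_last_step[OF x Suc.prems(1)] by metis
    have uV: "u \<in> V" using u edge_V by blast
    have "length (geo E x (r n0)) = Suc n0" using ray_child(2)[OF r(1), of n0] r(2) by simp
    then have "r n0 \<noteq> v" using Suc.prems(3) by auto
    then have "r n0 \<in> seg x u" using Suc.prems(2) u by simp
    then obtain g where g: "g \<in> G" "g x = x" "g u = r (n0 + k)"
      using Suc.IH[OF uV] Suc.prems(3) u by auto
    have "child x (r (n0 + k)) (g v)" using child_mapI[OF g(1) x u(2)] g by simp
    moreover have "child x (r (n0 + k)) (r (Suc (n0 + k)))" using ray_child(1)[OF r(1)] r(2) by simp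
    ultimately obtain k' where k': "k' \<in> G" "k' x = x" "k' (g v) = r (Suc (n0 + k))"
      using n0[of "n0 + k"] unfolding loc_trans_def by auto
    then show ?case using g G_mult mult_apply x Suc.prems(1) by (intro bexI[of _ "k' \<cdot> g"]) auto
  qed
  obtain v where v: "v \<in> V" "\<not> loc_trans x v" "r n0 \<in> seg x v"
    using infinite_imp_nonempty[OF inf[of n0]] by blast
  have "length (geo E x v) \<ge> Suc n0"
    using geo_split[OF x v(1,3)] ray_child(2)[OF r(1), of n0] r(2) by simp
  then obtain k where "length (geo E x v) = Suc n0 + k" unfolding le_iff_add by blast
  then have "length (geo E x v) = Suc (n0 + k)" by simp
  from reach[OF v(1,3) this] obtain g where g: "g \<in> G" "g x = x" "g v = r (n0 + k)" by blast
  have "loc_trans (g x) (g v)" unfolding g using n0[of "n0 + k"] by simp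
  then show False using loc_trans_map[OF x v(1) g(1)] v(2) by blast
qed

text \<open>Far from \<open>p\<close> every vertex is good by \<open>finite_not_loc_trans\<close>.
  If \<open>y = h p\<close> is far from \<open>v\<close> and \<open>p\<close> lies between
  \<open>v\<close> and \<open>y\<close>, then \<open>h\<close> carries a good pair to
  \<open>y\<close> and \<open>v\<close>, and the base point may be moved from \<open>y\<close> to
  \<open>p\<close>. To find such a \<open>y\<close>, the geodesic from \<open>v\<close> to
  \<open>p\<close> is prolonged to a ray \<open>s\<close> at whose end the orbit of \<open>p\<close>
  accumulates.\<close>

lemma loc_trans_all:
  assumes tr: "transitive_on_boundary E G"
    and cl: "closedin (tree_aut_topology V E) G" and nc: "\<not> compactin (tree_aut_topology V E) G"
    and p: "p \<in> V" and v: "v \<in> V" and ne: "p \<noteq> v"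
  shows "loc_trans p v"
proof -
  let ?Y = "(\<lambda>g. g p) ` G"
  have Y: "infinite ?Y" "?Y \<subseteq> V" using infinite_orbit[OF cl nc p] G_V p by auto
  obtain r where r: "ray E r" "r 0 = v" "\<And>n. infinite {y \<in> ?Y. r n \<in> seg v y}"
    using koenig[OF v Y] by blast
  have "\<exists>q. \<forall>n. (q n \<in> V \<and> (n = 0 \<longrightarrow> q n = p)) \<and> child v (q n) (q (Suc n))"
  proof (rule dependent_nat_choice)
    show "\<exists>y. (y \<in> V \<and> (Suc n = 0 \<longrightarrow> y = p)) \<and> child v u y" if "u \<in> V \<and> (n = 0 \<longrightarrow> u = p)" for u and n :: nat
      using ex_child[OF v] child_edge edge_V that by blast
  qed (use p in auto)
  then obtain q where q: "\<And>n. q n \<in> V" "q 0 = p" "\<And>n. child v (q n) (q (Suc n))" by blast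
  define w where "w n = (if n = 0 then v else q (n - 1))" for n
  have "w n \<in> V \<and> w n \<in> seg v (w (Suc n)) \<and> w n \<noteq> w (Suc n)" for n
  proof (cases n)
    case 0
    then show ?thesis using v p q ne geo(6) by (simp add: w_def)
  next
    case (Suc k)
    have "geo E v (q (Suc k)) = q (Suc k) # geo E v (q k)" using child_geo v q by blast
    then show ?thesis using Suc q geo(5)[OF v] child_edge edge_neq by (auto simp: w_def)
  qed
  then obtain s where s: "ray E s" "s 0 = v" "\<And>i. \<exists>n. s n = w i" using chain_ray[of v w] v w_def by auto
  obtain j where j: "s j = p" using s(3)[of 1] q by (auto simp: w_def)
  obtain g m n where g: "g \<in> G" "\<And>k. g (r (m + k)) = s (n + k)" using end_transitive[OF tr r(1) s(1)] by blast
  have sV: "s k \<in> V" and rV: "r k \<in> V" for k using ray_V s(1) r(1) by blast+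
  let ?u = "s (n + j)" and ?w = "s (Suc (n + j))"
  have e: "(?u, ?w) \<in> E" using s(1) by (simp add: ray_def)
  have uw: "?u \<in> seg v ?w" using ray_child(2)[OF s(1), of "Suc (n + j)"] s(2) by simp
  have gvV: "g v \<in> V" using g G_V v by blast
  have "r (m + j) \<in> seg v (r (m + Suc j))" using ray_child(2)[OF r(1), of "m + Suc j"] r(2) by simp
  then have uw': "?u \<in> seg (g v) ?w"
    using geo_mem_map[OF g(1) v rV rV, of "m + j" "m + Suc j"] g(2)[of j] g(2)[of "Suc j"] by simp
  \<comment> \<open>The orbit accumulates at the end of \<open>r\<close>, which \<open>g\<close>
    moves to the end of \<open>s\<close>. This places points of the orbit behind \<open>?w\<close>
    as seen from \<open>g v\<close>; since \<open>v\<close> and \<open>g v\<close> enter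
    \<open>?w\<close> through the same edge, they are also behind \<open>?w\<close>, and hence
    behind \<open>p\<close>, as seen from \<open>v\<close>. Taking \<open>F\<close> to be a ball
    makes them far away.\<close>
  have far: "\<exists>y\<in>?Y. y \<notin> F \<and> p \<in> seg v y" if "finite F" for F
  proof -
    let ?i = "inv\<^sub>G g"
    have "infinite ({y \<in> ?Y. r (m + Suc j) \<in> seg v y} - ?i ` F)" using r(3) that by (simp add: Diff_infinite_finite)
    then obtain y where y: "y \<in> ?Y" "r (m + Suc j) \<in> seg v y" "y \<notin> ?i ` F"
      by (metis (no_types, lifting) DiffE ex_in_conv infinite_imp_nonempty mem_Collect_eq)
    have yV: "y \<in> V" using y Y by blast
    have gy: "g y \<in> ?Y" using y(1) g(1) G_mult mult_apply[OF g(1) _ p] by (metis (no_types, lifting) imageE imageI)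
    moreover have "g y \<notin> F" using y(3) inv_apply[OF g(1) yV] by (metis imageI)
    moreover have "?w \<in> seg (g v) (g y)"
      using geo_mem_map[OF g(1) v yV rV, of "m + Suc j"] y(2) g(2)[of "Suc j"] by simp
    then have "?w \<in> seg v (g y)"
      using geo_base_change(1)[OF gvV v G_V[OF g(1) yV] e uw' uw] by blast
    moreover have "p \<in> seg v ?w"
    proof -
      have "j \<in> set [0..<Suc (Suc (n + j))]" by auto
      then show ?thesis using ray_child(2)[OF s(1), of "Suc (n + j)"] s(2) j by (metis image_eqI set_map set_rev)
    qed
    ultimately show ?thesis using geo_trans[OF v G_V[OF g(1) yV]] by blast
  qed
  define N where "N = Max ((\<lambda>b. length (geo E p b)) ` {b \<in> V. \<not> loc_trans p b})"
  obtain y where y: "y \<in> ?Y" "y \<notin> {y \<in> V. length (geo E v y) \<le> N}" "p \<in> seg v y"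
    using far[OF finite_ball[OF v, of N]] by blast
  obtain h where h: "h \<in> G" "y = h p" using y by blast
  have yV: "y \<in> V" using h G_V p by blast
  let ?b = "(inv\<^sub>G h) v"
  have b: "?b \<in> V" "h ?b = v" using h G_inv G_V v apply_inv by auto
  have "length (geo E p ?b) = length (geo E y v)" using geo_map[OF h(1) p b(1)] b h by simp
  also have "\<dots> = length (geo E v y)" using geo_sym[OF v yV] by simp
  finally have "length (geo E p ?b) > N" using y(2) yV by simp
  then have "loc_trans p ?b"
    using b finite_not_loc_trans[OF tr p] Max_ge[of "(\<lambda>b. length (geo E p b)) ` {b \<in> V. \<not> loc_trans p b}" "length (geo E p ?b)"]
    by (fastforce simp: N_def)
  then have "loc_trans y v" using loc_trans_map[OF p b(1) h(1)] b h by simp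
  moreover have "p \<in> seg y v" using y(3) set_geo_sym v yV by blast
  ultimately show ?thesis using loc_trans_seg[of y v p] yV v ne by blast
qed

end

section \<open>Translation along a ray\<close>

context tree_graph
begin

lemma child_step:
  assumes x: "x \<in> V" and c: "child x u w" and e: "(w, z) \<in> E" "z \<noteq> u"
  shows "child x w z"
proof (rule ccontr)
  assume n: "\<not> child x w z"
  have V: "u \<in> V" using c child_edge edge_V by blast
  have "geo E x w = w # geo E x u" using child_geo x c by blast
  then have "\<not> child x w u" using geo(5)[OF x V] by (auto simp: child_def)
  then show False using nbr_unique_back[OF x, of w u z] edge_sym child_edge[OF c] n e by blast
qed

lemma child_edge_base: "(x, y) \<in> E \<Longrightarrow> child x y z \<longleftrightarrow> (y, z) \<in> E \<and> z \<noteq> x"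
  using edge_neq by (auto simp: child_def geo_edge)

lemma nonbacktracking_ray:
  assumes "\<And>n. (r n, r (Suc n)) \<in> E" "\<And>n. r n \<noteq> r (Suc (Suc n))"
  shows "ray E r"
proof (rule rayI)
  show "child (r 0) (r n) (r (Suc n))" for n
  proof (induction n)
    case 0 show ?case using assms(1)[of 0] by (simp add: child_self)
  next
    case (Suc n)
    then show ?case using child_step[OF _ Suc assms(1)[of "Suc n"]] assms edge_V by metis
  qed
qed simp

lemma gpath_connected:
  "successively (\<lambda>x y. (x, y) \<in> E) p \<Longrightarrow> a \<in> set p \<Longrightarrow> (hd p, a) \<in> (E \<inter> set p \<times> set p)\<^sup>*"
proof (induction p)
  case (Cons x p)
  show ?case
  proof (cases "a = x")
    case False
    then have a: "a \<in> set p" "p \<noteq> []" using Cons.prems by auto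
    then have "(hd p, a) \<in> (E \<inter> set p \<times> set p)\<^sup>*" using Cons by (auto simp: successively_Cons)
    moreover have "E \<inter> set p \<times> set p \<subseteq> E \<inter> set (x # p) \<times> set (x # p)" by auto
    ultimately have "(hd p, a) \<in> (E \<inter> set (x # p) \<times> set (x # p))\<^sup>*" using rtrancl_mono by blast
    moreover have "(x, hd p) \<in> E \<inter> set (x # p) \<times> set (x # p)"
      using Cons.prems a by (auto simp: successively_Cons)
    ultimately show ?thesis by (simp add: converse_rtrancl_into_rtrancl)
  qed simp
qed simp

lemma subtree_geo:
  assumes "x \<in> V" "w \<in> V" shows "subtree V E (seg x w)"
proof -
  let ?S = "seg x w"
  note g = geo[OF assms]
  have "sym (E \<inter> ?S \<times> ?S)" using edge_sym by (auto simp: sym_def)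
  then have s: "sym ((E \<inter> ?S \<times> ?S)\<^sup>*)" by (rule sym_rtrancl)
  have h: "(hd (geo E x w), a) \<in> (E \<inter> ?S \<times> ?S)\<^sup>*" if "a \<in> ?S" for a
    using gpath_connected[OF _ that] g(1) unfolding gpath_def by blast
  have conn: "(a, b) \<in> (E \<inter> ?S \<times> ?S)\<^sup>*" if "a \<in> ?S" "b \<in> ?S" for a b
    using h[OF that(1)] h[OF that(2)] s by (meson rtrancl_trans symD)
  have "simple_graph ?S (E \<inter> ?S \<times> ?S)"
    using edge_sym edge_neq by (auto simp: simple_graph_def sym_def irrefl_def)
  moreover have "\<nexists>p. graph_cycle (E \<inter> ?S \<times> ?S) p"
  proof -
    have "\<nexists>p. graph_cycle E p" using tree by (simp add: tree_def)
    then show ?thesis unfolding graph_cycle_def by blast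
  qed
  ultimately show ?thesis
    using geo_subset_V[OF assms] g(4) conn unfolding subtree_def tree_def by auto
qed

text \<open>A geodesic computed inside a candidate subtree is, by uniqueness, the geodesic of the
  whole tree, so it leaves \<open>x\<close> through \<open>y\<close>. Conversely, each geodesic from
  \<open>x\<close> through \<open>y\<close> is itself a candidate.\<close>

lemma half_tree_eq:
  assumes e: "(x, y) \<in> E"
  shows "half_tree V E x y = insert x {w \<in> V. y \<in> seg x w}"
proof -
  have V: "x \<in> V" "y \<in> V" using e edge_V by auto
  have H: "half_tree V E x y = \<Union>{S. half_tree_cand V E x y S}" by (rule half_tree_eq_Union[OF tree e])
  have c: "half_tree_cand V E x y (seg x w)" if w: "w \<in> V" "y \<in> seg x w" for w
  proof -
    have "z = y" if "z \<in> seg x w" "(x, z) \<in> E" for z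
      using nbr_unique_back[OF w(1), of x z y] that w V e set_geo_sym by (auto simp: child_def)
    then show ?thesis
      using subtree_geo[OF V(1) w(1)] geo[OF V(1) w(1)] w by (auto simp: half_tree_cand_def)
  qed
  have "y = z" if z: "half_tree_cand V E x y S" "w \<in> S" "child x x z" "z \<in> seg x w" for S w z
  proof -
    have S: "tree S (E \<inter> S \<times> S)" "S \<subseteq> V" "x \<in> S" "S \<inter> E `` {x} \<subseteq> {y}"
      using z(1) by (auto simp: half_tree_cand_def subtree_def)
    interpret S: tree_graph S "E \<inter> S \<times> S" using S by unfold_locales
    let ?p = "geo (E \<inter> S \<times> S) x w"
    have "gpath E ?p"
      using S.geo(1)[OF S(3) z(2)] unfolding gpath_def by (auto elim: successively_mono)
    then have "geo E x w = ?p" using S.geo[OF S(3) z(2)] by (intro geo_eqI)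
    then have "z \<in> S" using z(4) S.geo_subset_V[OF S(3) z(2)] by auto
    then show ?thesis using S(4) z(3) by (auto simp: child_def)
  qed
  note sec = this
  have "w = x \<or> (w \<in> V \<and> y \<in> seg x w)" if w: "half_tree_cand V E x y S" "w \<in> S" for S w
  proof -
    have wV: "w \<in> V" using w by (auto simp: half_tree_cand_def subtree_def)
    show ?thesis
    proof (cases "w = x")
      case False
      then obtain z where "child x x z" "z \<in> seg x w"
        using beyond_child_cases[OF V(1) wV geo(6)[OF V(1) wV]] by metis
      then show ?thesis using sec[OF w] wV by metis
    qed simp
  qed
  moreover have "x \<in> \<Union>{S. half_tree_cand V E x y S}"
    using c[OF V(2) geo(5)[OF V]] geo(6)[OF V] by blast
  moreover have "w \<in> \<Union>{S. half_tree_cand V E x y S}" if "w \<in> V" "y \<in> seg x w" for w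
    using c[OF that] geo(5)[OF V(1) that(1)] by blast
  ultimately show ?thesis unfolding H by blast
qed

end

locale locally_transitive_action = tree_action +
  assumes loc_trans: "p \<in> V \<Longrightarrow> v \<in> V \<Longrightarrow> p \<noteq> v \<Longrightarrow> loc_trans p v"
begin

text \<open>The third neighbour \<open>z\<close> serves as base point: seen from it,
  \<open>v\<close> and \<open>q\<close> are both children of \<open>u\<close>. Degree three always
  supplies such a \<open>z\<close>.\<close>

lemma swap_nbrs:
  assumes "(u, z) \<in> E" "(u, v) \<in> E" "(u, q) \<in> E" "z \<noteq> v" "z \<noteq> q"
  shows "\<exists>k\<in>G. k z = z \<and> k u = u \<and> k v = q"
proof -
  have zu: "(z, u) \<in> E" using edge_sym assms by blast
  then have "loc_trans z u" using loc_trans edge_V edge_neq by blast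
  then show ?thesis using child_edge_base[OF zu] assms unfolding loc_trans_def by blast
qed

lemma move_two:
  assumes "(x, y) \<in> E" "(y, w) \<in> E" "w \<noteq> x" "(w, z) \<in> E" "z \<noteq> y"
    "(y, w') \<in> E" "w' \<noteq> x" "(w', z') \<in> E" "z' \<noteq> y"
  shows "\<exists>k\<in>G. k x = x \<and> k y = y \<and> k w = w' \<and> k z = z'"
proof -
  have V: "x \<in> V" "y \<in> V" "w \<in> V" "z \<in> V" "w' \<in> V" using assms edge_V by blast+
  have c: "child x y w" "child x y w'" using child_edge_base assms by blast+
  obtain k where k: "k \<in> G" "k x = x" "k y = y" "k w = w'"
    using loc_trans[OF V(1,2)] edge_neq[OF assms(1)] c unfolding loc_trans_def by blast
  have g': "geo E x w' = [w', y, x]" using child_geo[OF V(1) c(2)] geo_edge[OF assms(1)] by simp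
  have "child x w' z'" "child x w z" using child_step[OF V(1)] c assms by blast+
  then have "child x w' z'" "child x w' (k z)" using child_mapI[OF k(1) V(1), of w z] k by auto
  then obtain h where h: "h \<in> G" "h x = x" "h w' = w'" "h (k z) = z'"
    using loc_trans[OF V(1,5)] assms(7) unfolding loc_trans_def by blast
  have "h y = y" using fix_geo[OF h(1) V(1,5) h(2,3)] g' by simp
  then show ?thesis using h k G_mult mult_apply V by (intro bexI[of _ "h \<cdot> k"]) auto
qed

text \<open>Connectedness in the form needed for edge orbits. Along a path from \<open>x\<close> the
  two closure conditions are applied alternately, the first at vertices of \<open>A\<close> and the
  second at vertices of \<open>B\<close>.\<close>

lemma typed_edges:
  assumes F: "F \<subseteq> E" and x: "(x, y) \<in> F" "x \<in> A"
    and c: "\<And>u v q. (u, v) \<in> F \<Longrightarrow> u \<in> A \<Longrightarrow> (u, q) \<in> E \<Longrightarrow> (u, q) \<in> F"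
      "\<And>u v q. (u, v) \<in> F \<Longrightarrow> u \<in> A \<Longrightarrow> (q, v) \<in> E \<Longrightarrow> (q, v) \<in> F"
    and e: "(u, v) \<in> E" "u \<in> A"
  shows "(u, v) \<in> F"
proof -
  have "(w \<in> A \<longrightarrow> (\<forall>v. (w, v) \<in> E \<longrightarrow> (w, v) \<in> F)) \<and> (w \<in> B \<longrightarrow> (\<forall>u. (u, w) \<in> E \<longrightarrow> (u, w) \<in> F))"
    if "(x, w) \<in> E\<^sup>*" for w
    using that
  proof induction
    case base
    then show ?case using x c(1) bip_V by blast
  next
    case (step y z)
    show ?case
    proof (cases "y \<in> A")
      case True
      then have "z \<in> B" "z \<notin> A" "(y, z) \<in> F" using bip_edge bip_V step by blast+
      then show ?thesis using c(2) True by blast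
    next
      case False
      then have "y \<in> B" using bip_V edge_V step.hyps(2) by blast
      then have "z \<in> A" "z \<notin> B" "(z, y) \<in> F" using bip_edge bip_V step edge_sym by blast+
      then show ?thesis using c(1) by blast
    qed
  qed
  moreover have "(x, u) \<in> E\<^sup>*" using connected e edge_V F x by blast
  ultimately show ?thesis using e by blast
qed

lemma edge_transitive:
  assumes x: "(x, y) \<in> E" "x \<in> A" and e: "(u, v) \<in> E" "u \<in> A"
  shows "\<exists>g\<in>G. g x = u \<and> g y = v"
proof -
  let ?F = "{(g x, g y) | g. g \<in> G}"
  have V: "x \<in> V" "y \<in> V" using x edge_V by auto
  have m: "(k u, k v) \<in> ?F" if "k \<in> G" "(u, v) \<in> ?F" for k u v
    using that V G_mult mult_apply by (smt (verit) CollectD CollectI Pair_inject)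
  have "(u, v) \<in> ?F"
  proof (rule typed_edges[OF _ _ x(2) _ _ e])
    show "?F \<subseteq> E" using G_edgeI x by auto
    show "(x, y) \<in> ?F" using G_one one_apply V by (metis (mono_tags, lifting) CollectI)
  next
    fix u v q assume *: "(u, v) \<in> ?F" "(u, q) \<in> E"
    then have uv: "(u, v) \<in> E" using G_edgeI x by auto
    obtain z where z: "(u, z) \<in> E" "z \<noteq> v" "z \<noteq> q" using nbr_avoid edge_V uv by blast
    obtain k where "k \<in> G" "k u = u" "k v = q" using swap_nbrs[OF z(1) uv *(2) z(2,3)] by blast
    then show "(u, q) \<in> ?F" using m[of k u v] *(1) by simp
  next
    fix u v q assume *: "(u, v) \<in> ?F" "(q, v) \<in> E"
    then have uv: "(v, u) \<in> E" and vq: "(v, q) \<in> E" using G_edgeI x edge_sym by auto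
    obtain z where z: "(v, z) \<in> E" "z \<noteq> u" "z \<noteq> q" using nbr_avoid edge_V uv by blast
    obtain k where "k \<in> G" "k v = v" "k u = q" using swap_nbrs[OF z(1) uv vq z(2,3)] by blast
    then show "(q, v) \<in> ?F" using m[of k u v] *(1) by simp
  qed
  then show ?thesis by auto
qed

lemma ex_A_edge: "\<exists>x y. (x, y) \<in> E \<and> x \<in> A"
proof -
  obtain v where v: "v \<in> V" using tree by (auto simp: tree_def)
  obtain z where z: "(v, z) \<in> E" using nbr_avoid[OF v] by blast
  have "v \<in> A \<or> z \<in> A" using v bip_V(3) bip_edge(2)[OF z] by auto
  then show ?thesis using z edge_sym[OF z] by auto
qed

text \<open>Edges are conjugate when their types agree, so some \<open>a\<close> carries the first
  edge of a nonbacktracking path \<open>x0, x1, x2, x3\<close> to its last edge; type preservation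
  is the reason for translating by two. The end so obtained is moved to \<open>\<xi>\<close> by
  conjugation, as \<open>G\<close> is transitive on the boundary.\<close>

lemma ex_axis:
  assumes tr: "transitive_on_boundary E G" and xi: "\<xi> \<in> boundary E"
  obtains a and r :: "nat \<Rightarrow> 'a" where "a \<in> G" "ray E r" "\<xi> = cofinal_rays E `` {r}" "r 0 \<in> A"
    "\<And>n. a (r n) = r (Suc (Suc n))"
proof -
  obtain x0 x1 where x01: "(x0, x1) \<in> E" "x0 \<in> A" using ex_A_edge by blast
  then have V: "x0 \<in> V" "x1 \<in> V" using edge_V by auto
  obtain x2 where x2: "(x1, x2) \<in> E" "x2 \<noteq> x0" using nbr_avoid[OF V(2)] by blast
  obtain x3 where x3: "(x2, x3) \<in> E" "x3 \<noteq> x1" using nbr_avoid[of x2] x2 edge_V by blast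
  have "x2 \<in> A" using x01 x2 bip_edge by blast
  then obtain a where a: "a \<in> G" "a x0 = x2" "a x1 = x3" using edge_transitive[OF x01 x3(1)] by blast
  \<comment> \<open>The two orbits of \<open>x0\<close> and \<open>x1\<close> under the powers of
    \<open>a\<close> are interleaved. Adjacency and absence of backtracking need checking only at
    the first two indices; \<open>a\<close> transports them to the others.\<close>
  define r where "r n = (a \<up> (n div 2)) (if even n then x0 else x1)" for n :: nat
  have pG: "a \<up> k \<in> G" for k using a nat_pow_closed[of a k] by simp
  have sh: "a (r n) = r (Suc (Suc n))" for n
  proof -
    have "a \<up> Suc k = a \<cdot> a \<up> k" for k :: nat using nat_pow_Suc2 a by simp
    then show ?thesis using mult_apply[OF a(1) pG] V by (simp add: r_def)
  qed
  have r01: "r 0 = x0" "r 1 = x1" using one_apply V by (simp_all add: r_def)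
  have r2: "r (Suc (Suc 0)) = x2" "r (Suc (Suc 1)) = x3" using sh[of 0] sh[of 1] r01 a by simp_all
  have rV: "r n \<in> V" for n using pG G_V V by (simp add: r_def)
  have "(r n, r (Suc n)) \<in> E \<and> r n \<noteq> r (Suc (Suc n))" for n
  proof (induction n rule: nat_less_induct)
    case (1 n)
    show ?case
    proof (cases "n < 2")
      case True
      then have "n = 0 \<or> n = 1" by auto
      then show ?thesis using r01 r2 x01 x2 x3 by auto
    next
      case False
      then obtain m where m: "n = Suc (Suc m)" by (metis One_nat_def Suc_1 lessI not0_implies_Suc less_Suc_eq_0_disj)
      have ih: "(r m, r (Suc m)) \<in> E" "r m \<noteq> r (Suc (Suc m))" using 1 m by auto
      have "(a (r m), a (r (Suc m))) \<in> E" using G_edgeI[OF a(1) ih(1)] .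
      moreover have "a (r m) \<noteq> a (r (Suc (Suc m)))" using G_inj[OF a(1) rV rV] ih(2) by blast
      ultimately show ?thesis unfolding m sh .. 
    qed
  qed
  then have ray: "ray E r" using nonbacktracking_ray by blast
  obtain s where s: "ray E s" "\<xi> = cofinal_rays E `` {s}" using xi by (auto simp: boundary_def elim: quotientE)
  obtain g m n where g: "g \<in> G" "\<And>k. g (r (m + k)) = s (n + k)" using end_transitive[OF tr ray s(1)] by blast
  let ?r = "g \<circ> r" and ?a = "g \<cdot> (a \<cdot> inv\<^sub>G g)"
  have ray': "ray E ?r" using ray rV G_edgeI[OF g(1)] G_inj[OF g(1)]
    by (auto simp: ray_def inj_def)
  have "(?r, s) \<in> cofinal_rays E" using ray' s g(2) unfolding cofinal_rays_def by auto
  then have xi': "\<xi> = cofinal_rays E `` {?r}"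
    using s(2) equiv_class_eq[OF equiv_cofinal_rays] by metis
  have "?a (?r n) = ?r (Suc (Suc n))" for n
    using g a rV G_V G_inv G_mult sh[of n] by (simp add: mult_apply inv_apply)
  moreover have "?a \<in> G" using g a G_mult G_inv by blast
  moreover have "?r 0 \<in> A" using G_A g r01 x01 by simp
  ultimately show ?thesis using that ray' xi' by blast
qed

end

locale axis_action = locally_transitive_action +
  fixes r :: "nat \<Rightarrow> 'a" and a :: "'a \<Rightarrow> 'a"
  assumes a: "a \<in> G" and ray: "ray E r" and r0A: "r 0 \<in> A"
    and shift: "a (r n) = r (Suc (Suc n))"
    and tits: "tits_independence V E G"
begin

abbreviation pconj where "pconj k g \<equiv> a \<up> k \<cdot> g \<cdot> inv\<^sub>G (a \<up> k)"

definition K :: "('a \<Rightarrow> 'a) set" where "K = fixator G {r 0, r 1}"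
text \<open>\<open>half_tree V E x y\<close> lies on the side of \<open>y\<close>. Thus
  \<open>U\<close> can move vertices only on the side of the edge that contains the rest of the ray,
  and \<open>W\<close> only on the opposite side.\<close>

definition U :: "('a \<Rightarrow> 'a) set" where "U = fixator G (half_tree V E (r 1) (r 0))"
definition W :: "('a \<Rightarrow> 'a) set" where "W = fixator G (half_tree V E (r 0) (r 1))"

lemma fixator_subgroup: "D \<subseteq> V \<Longrightarrow> subgroup (fixator G D) GG"
proof (rule subgroupI)
  assume D: "D \<subseteq> V"
  show "fixator G D \<subseteq> carrier GG" by (auto simp: fixator_def)
  have "\<one>\<^bsub>GG\<^esub> \<in> fixator G D" using G_one one_apply D by (auto simp: fixator_def)
  then show "fixator G D \<noteq> {}" by blast
  show "inv\<^sub>G g \<in> fixator G D" if "g \<in> fixator G D" for g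
    using that D G_inv inv_apply_eq by (auto simp: fixator_def)
  show "g \<cdot> h \<in> fixator G D" if "g \<in> fixator G D" "h \<in> fixator G D" for g h
    using that D G_mult mult_apply by (auto simp: fixator_def subset_iff)
qed

lemma rV: "r n \<in> V" using ray ray_V by blast

lemma r_edge: "(r n, r (Suc n)) \<in> E" using ray by (simp add: ray_def)

lemma r_edge0: "(r 0, r 1) \<in> E" "(r 1, r 0) \<in> E" using r_edge[of 0] edge_sym by auto

lemma r_inj: "r m = r n \<longleftrightarrow> m = n" using ray by (auto simp: ray_def inj_eq)

lemma K_iff: "k \<in> K \<longleftrightarrow> k \<in> G \<and> k (r 0) = r 0 \<and> k (r 1) = r 1"
  by (auto simp: K_def fixator_def)

lemma half_V: "(x, y) \<in> E \<Longrightarrow> half_tree V E x y \<subseteq> V"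
  using half_tree_eq edge_V by auto

lemma KUW_subgroup: "subgroup K GG" "subgroup U GG" "subgroup W GG"
  unfolding K_def U_def W_def using rV half_V r_edge0 by (auto intro!: fixator_subgroup)

lemma UW_K: "U \<subseteq> K" "W \<subseteq> K"
proof -
  have "{r 0, r 1} \<subseteq> half_tree V E (r 1) (r 0)" "{r 0, r 1} \<subseteq> half_tree V E (r 0) (r 1)"
    using half_tree_eq r_edge0 rV geo(5) by auto
  then show "U \<subseteq> K" "W \<subseteq> K" by (auto simp: U_def W_def K_def fixator_def)
qed

lemma K_eq_UW: "k \<in> K \<Longrightarrow> \<exists>u\<in>U. \<exists>w\<in>W. k = u \<cdot> w"
proof -
  assume k: "k \<in> K"
  have "fixator G {r 1, r 0} =
       fixator G (half_tree V E (r 1) (r 0)) <#>\<^bsub>tree_aut_group V E\<^esub> fixator G (half_tree V E (r 0) (r 1))"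
    using tits r_edge0(2) unfolding tits_independence_def by blast
  moreover have "k \<in> fixator G {r 1, r 0}" using k by (simp add: K_def insert_commute)
  ultimately show ?thesis unfolding U_def W_def set_mult_def GG_def by auto
qed

lemma r_geo: "m \<le> n \<Longrightarrow> n \<le> l \<Longrightarrow> r n \<in> seg (r m) (r l)"
proof -
  assume *: "m \<le> n" "n \<le> l"
  have m: "r k \<in> seg (r 0) (r l)" if "k \<le> l" for k
  proof -
    have "k \<in> set [0..<Suc l]" using that by auto
    then show ?thesis using ray_child(2)[OF ray, of l] by (metis image_eqI set_map set_rev)
  qed
  have "m \<in> set [0..<Suc n]" using * by auto
  then have "r m \<in> seg (r 0) (r n)" using ray_child(2)[OF ray, of n] by (metis image_eqI set_map set_rev)
  then show ?thesis using geo_trans'[OF rV rV m[OF *(2)]] by blast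
qed

lemma r_geo': "m \<le> n \<Longrightarrow> n \<le> l \<Longrightarrow> r n \<in> seg (r l) (r m)"
  using r_geo set_geo_sym rV by blast

lemma r_half: "r n \<in> half_tree V E (r 0) (r 1)"
  using half_tree_eq[OF r_edge0(1)] rV r_geo[of 0 1 n] by (cases n) auto

lemma W_ray: "w \<in> W \<Longrightarrow> w (r n) = r n"
  using r_half by (auto simp: W_def fixator_def)

lemma pow_G: "a \<up> k \<in> G" using a nat_pow_closed[of a k] by simp

lemma pow_shift: "(a \<up> k) (r n) = r (n + 2 * k)"
proof (induction k arbitrary: n)
  case 0 then show ?case using one_apply rV by simp
next
  case (Suc k)
  have "a \<up> Suc k = a \<up> k \<cdot> a" by simp
  then show ?case using mult_apply[OF pow_G a rV] shift Suc by simp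
qed

lemma W_conj_K: "w \<in> W \<Longrightarrow> inv\<^sub>G (a \<up> k) \<cdot> w \<cdot> a \<up> k \<in> K"
proof -
  assume w: "w \<in> W"
  then have wG: "w \<in> G" by (simp add: W_def fixator_def)
  have "(inv\<^sub>G (a \<up> k) \<cdot> w \<cdot> a \<up> k) (r n) = r n" for n
  proof -
    have "(inv\<^sub>G (a \<up> k) \<cdot> w \<cdot> a \<up> k) (r n)
        = (inv\<^sub>G (a \<up> k)) (w ((a \<up> k) (r n)))"
      using wG pow_G G_inv G_mult rV G_V by (simp add: mult_apply)
    also have "\<dots> = r n" using W_ray[OF w] pow_shift inv_apply_eq[OF pow_G rV] by simp
    finally show ?thesis .
  qed
  then show ?thesis using wG pow_G G_inv G_mult by (simp add: K_iff)
qed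

text \<open>\<open>a U a^-1\<close> fixes the half-tree cut off by the edge \<open>r 2, r 3\<close>
  on the side away from the end, and this contains \<open>r 0\<close> and
  \<open>r 1\<close>.\<close>

lemma U_conj_K: "u \<in> U \<Longrightarrow> a \<cdot> u \<cdot> inv\<^sub>G a \<in> K"
proof -
  assume u: "u \<in> U"
  then have uG: "u \<in> G" by (simp add: U_def fixator_def)
  have "(a \<cdot> u \<cdot> inv\<^sub>G a) (r n) = r n" if n: "n < 2" for n
  proof -
    let ?v = "(inv\<^sub>G a) (r n)"
    have vV: "?v \<in> V" using a G_inv G_V rV by blast
    have "a (r 0) \<in> seg (a (r 1)) (a ?v)"
      using r_geo'[of n 2 3] n apply_inv[OF a rV] shift by (simp add: numeral_2_eq_2 numeral_3_eq_3)
    then have "r 0 \<in> seg (r 1) ?v" using geo_mem_map[OF a rV vV rV] by blast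
    then have "u ?v = ?v" using u vV half_tree_eq[OF r_edge0(2)] by (auto simp: U_def fixator_def)
    then show ?thesis using uG a G_inv G_mult rV G_V by (simp add: mult_apply apply_inv)
  qed
  then show ?thesis using uG a G_inv G_mult by (simp add: K_iff)
qed

lemma U_normal: "u \<in> U \<Longrightarrow> k \<in> K \<Longrightarrow> inv\<^sub>G k \<cdot> u \<cdot> k \<in> U"
proof -
  assume u: "u \<in> U" and k: "k \<in> K"
  have uG: "u \<in> G" and kG: "k \<in> G" and kr: "k (r 0) = r 0" "k (r 1) = r 1"
    using u k by (auto simp: U_def fixator_def K_iff)
  let ?H = "half_tree V E (r 1) (r 0)"
  have "(inv\<^sub>G k \<cdot> u \<cdot> k) v = v" if v: "v \<in> ?H" for v
  proof -
    have vV: "v \<in> V" using v half_V r_edge0 by blast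
    have "k v \<in> ?H"
    proof (cases "v = r 1")
      case False
      then have "r 0 \<in> seg (r 1) v" using v half_tree_eq[OF r_edge0(2)] by simp
      then have "r 0 \<in> seg (r 1) (k v)" using geo_mem_map[OF kG rV vV rV, of 0 1] kr by simp
      then show ?thesis using half_tree_eq[OF r_edge0(2)] G_V[OF kG vV] by simp
    qed (use v kr in simp)
    then have "u (k v) = k v" using u by (simp add: U_def fixator_def)
    then show ?thesis using uG kG G_inv G_mult vV G_V inv_apply by (simp add: mult_apply)
  qed
  then show ?thesis using uG kG G_inv G_mult by (simp add: U_def fixator_def)
qed

text \<open>The distance from \<open>v\<close> cannot decrease along the ray forever. After the
  first step leading away from \<open>v\<close>, absence of backtracking keeps the ray moving
  away.\<close>

lemma eventually_child: "v \<in> V \<Longrightarrow> \<exists>N. \<forall>n\<ge>N. child v (r n) (r (Suc n))"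
proof -
  assume v: "v \<in> V"
  have "\<exists>N. child v (r N) (r (Suc N))"
  proof (rule ccontr)
    assume n: "\<nexists>N. child v (r N) (r (Suc N))"
    have l: "length (geo E v (r n)) = Suc (length (geo E v (r (Suc n))))" for n
    proof -
      have "r (Suc n) \<in> seg v (r n)" using n r_edge[of n] unfolding child_def by blast
      from geo_back[OF v r_edge this] show ?thesis by (rule ssubst) simp
    qed
    have "length (geo E v (r 0)) = n + length (geo E v (r n))" for n
    proof (induction n)
      case (Suc n)
      then show ?case using l[of n] by linarith
    qed simp
    from this[of "Suc (length (geo E v (r 0)))"] show False by simp
  qed
  then obtain N where N: "child v (r N) (r (Suc N))" by blast
  have "child v (r n) (r (Suc n))" if "N \<le> n" for n
    using that
  proof (induction n rule: dec_induct)
    case (step n)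
    show ?case by (rule child_step[OF v step.IH r_edge]) (simp add: r_inj)
  qed (rule N)
  then show ?thesis by blast
qed

text \<open>For large \<open>k\<close> the edge from \<open>r (2 * k)\<close> to
  \<open>r (Suc (2 * k))\<close> points away from \<open>v\<close>, so \<open>v\<close> lies in the
  half-tree fixed by \<open>a^k U a^-k\<close>.\<close>

lemma U_contract:
  assumes F: "finite F" "F \<subseteq> V"
  shows "\<exists>k0. \<forall>k\<ge>k0. \<forall>u\<in>U. pconj k u \<in> fixator G F"
proof -
  have one: "\<exists>k0. \<forall>k\<ge>k0. \<forall>u\<in>U. pconj k u v = v" if v: "v \<in> V" for v
  proof -
    obtain N where N: "\<And>n. N \<le> n \<Longrightarrow> child v (r n) (r (Suc n))" using eventually_child[OF v] by blast
    have "pconj k u v = v" if k: "N \<le> k" and u: "u \<in> U" for k u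
    proof -
      have uG: "u \<in> G" using u by (simp add: U_def fixator_def)
      let ?g = "a \<up> k"
      let ?v = "(inv\<^sub>G ?g) v"
      have vV: "?v \<in> V" using pow_G G_inv G_V v by blast
      have "geo E v (r (Suc (2 * k))) = r (Suc (2 * k)) # geo E v (r (2 * k))"
        using child_geo[OF v N[of "2 * k"]] k by simp
      then have "r (2 * k) \<in> seg (r (Suc (2 * k))) v"
        using geo(5)[OF v rV] set_geo_sym[OF v rV] by simp
      then have "?g (r 0) \<in> seg (?g (r 1)) (?g ?v)"
        using pow_shift[of k 0] pow_shift[of k 1] apply_inv[OF pow_G v] by simp
      then have "r 0 \<in> seg (r 1) ?v" using geo_mem_map[OF pow_G rV vV rV] by blast
      then have "u ?v = ?v" using u vV half_tree_eq[OF r_edge0(2)] by (auto simp: U_def fixator_def)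
      then show ?thesis using uG pow_G G_inv G_mult v G_V by (simp add: mult_apply apply_inv)
    qed
    then show ?thesis by blast
  qed
  have "\<exists>k0. \<forall>k\<ge>k0. \<forall>u\<in>U. \<forall>v\<in>F. pconj k u v = v"
    using F
  proof (induction F)
    case (insert v F)
    then obtain k1 where k1: "\<forall>k\<ge>k1. \<forall>u\<in>U. \<forall>v\<in>F. pconj k u v = v" by auto
    obtain k2 where k2: "\<forall>k\<ge>k2. \<forall>u\<in>U. pconj k u v = v"
      using one[of v] insert.prems by auto
    show ?case by (rule exI[of _ "max k1 k2"]) (use k1 k2 in auto)
  qed simp
  then obtain k0 where k0: "\<forall>k\<ge>k0. \<forall>u\<in>U. \<forall>v\<in>F. pconj k u v = v" ..
  have uG: "u \<in> G" if "u \<in> U" for u using that by (simp add: U_def fixator_def)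
  have cG: "pconj k u \<in> G" if "u \<in> U" for u k
    by (intro G_mult pow_G G_inv) (rule uG[OF that])
  show ?thesis
  proof (intro exI allI impI ballI)
    fix k u assume "k0 \<le> k" "u \<in> U"
    then show "pconj k u \<in> fixator G F"
      using cG k0 unfolding fixator_def by blast
  qed
qed

lemma fix_end:
  assumes g: "g \<in> G" and fx: "\<And>n. N \<le> n \<Longrightarrow> g (r n) = r n"
  shows "g \<in> horospherical_stabilizer V G (cofinal_rays E `` {r})"
proof -
  have sub: "h \<circ> s \<in> cofinal_rays E `` {r}"
    if h: "h \<in> G" "\<And>n. N \<le> n \<Longrightarrow> h (r n) = r n" and s: "s \<in> cofinal_rays E `` {r}" for h s
  proof -
    obtain m n where mn: "\<And>k. r (m + k) = s (n + k)" and s': "ray E s" using s by (auto simp: cofinal_rays_def)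
    have "r ((m + N) + k) = (h \<circ> s) ((n + N) + k)" for k
      using mn[of "N + k"] h(2)[of "m + (N + k)"] by (simp add: add.assoc)
    moreover have "ray E (h \<circ> s)" using s' ray_V[OF s'] G_edgeI[OF h(1)] G_inj[OF h(1)]
      by (auto simp: ray_def inj_def)
    ultimately show ?thesis using ray unfolding cofinal_rays_def by blast
  qed
  let ?i = "inv\<^sub>G g"
  have i: "?i \<in> G" "?i (r n) = r n" if "N \<le> n" for n
    using G_inv g inv_apply_eq[OF g rV fx[OF that]] by auto
  have "s \<in> (\<lambda>s. g \<circ> s) ` (cofinal_rays E `` {r})" if s: "s \<in> cofinal_rays E `` {r}" for s
  proof
    have "ray E s" using s by (auto simp: cofinal_rays_def)
    then show "s = g \<circ> (?i \<circ> s)" using apply_inv[OF g] ray_V by (auto simp: fun_eq_iff)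
    show "?i \<circ> s \<in> cofinal_rays E `` {r}" using sub[OF _ _ s] i by blast
  qed
  then have "boundary_act g (cofinal_rays E `` {r}) = cofinal_rays E `` {r}"
    using sub[OF g fx] unfolding boundary_act_def by blast
  moreover have "elliptic V g" using fx[of N] rV by (auto simp: elliptic_def)
  ultimately show ?thesis using g by (simp add: horospherical_stabilizer_def)
qed

lemma W_conj_horospherical:
  assumes w: "w \<in> W"
  shows "pconj k w
    \<in> horospherical_stabilizer V G (cofinal_rays E `` {r})"
proof (rule fix_end)
  have wG: "w \<in> G" using w by (simp add: W_def fixator_def)
  show "pconj k w \<in> G"
    by (intro G_mult pow_G G_inv wG)
  fix n assume "2 * k \<le> n"
  then obtain m where m: "n = m + 2 * k" by (metis add.commute le_iff_add)
  have "(inv\<^sub>G (a \<up> k)) (r n) = r m" using inv_apply_eq[OF pow_G rV pow_shift] m by simp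
  then show "pconj k w (r n) = r n"
    using wG pow_G G_inv G_mult rV G_V W_ray[OF w] pow_shift m by (simp add: mult_apply)
qed

section \<open>Subgroups containing the edge stabilizer\<close>

lemma mult_inv_cancel: "m \<in> G \<Longrightarrow> g \<in> G \<Longrightarrow> m \<cdot> (inv\<^sub>G m \<cdot> g) = g"
  using m_assoc[of m "inv\<^sub>G m" g] G_inv by simp

text \<open>Since \<open>K\<close> is the full stabilizer of the oriented edge
  \<open>r 0, r 1\<close>, a subgroup containing it is all of \<open>G\<close> once it carries this
  edge to every edge of the same type. By \<open>typed_edges\<close> it suffices to change one
  endpoint at a time.\<close>

lemma edge_orbit_closed:
  assumes M: "subgroup M GG" and KM: "K \<subseteq> M" and F: "F = {(m (r 0), m (r 1)) | m. m \<in> M}"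
    and F1: "\<And>u v q. (u, v) \<in> F \<Longrightarrow> u \<in> A \<Longrightarrow> (u, q) \<in> E \<Longrightarrow> (u, q) \<in> F"
    and F2: "\<And>u v q. (u, v) \<in> F \<Longrightarrow> u \<in> A \<Longrightarrow> (q, v) \<in> E \<Longrightarrow> (q, v) \<in> F"
  shows "M = G"
proof -
  have MG: "M \<subseteq> G" using subgroup.subset[OF M] by simp
  have FE: "F \<subseteq> E" using MG G_edgeI r_edge0 by (auto simp: F)
  have r01F: "(r 0, r 1) \<in> F"
    using subgroup.one_closed[OF M] one_apply rV unfolding F by (metis (mono_tags, lifting) CollectI)
  have "g \<in> M" if g: "g \<in> G" for g
  proof -
    have "(g (r 0), g (r 1)) \<in> F"
      by (rule typed_edges[OF FE r01F r0A]) (use F1 F2 G_edgeI[OF g r_edge0(1)] G_A[OF g r0A] in blast)+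
    then obtain m where m: "m \<in> M" "g (r 0) = m (r 0)" "g (r 1) = m (r 1)" by (auto simp: F)
    have mG: "m \<in> G" using m MG by blast
    have "inv\<^sub>G m \<cdot> g \<in> K"
      using mG g G_inv G_mult rV m(2,3) inv_apply by (simp add: K_iff mult_apply)
    then have "m \<cdot> (inv\<^sub>G m \<cdot> g) \<in> M" using subgroup.m_closed[OF M] KM m by blast
    then show ?thesis using mult_inv_cancel[OF mG g] by simp
  qed
  then show ?thesis using MG by blast
qed

text \<open>The edge orbit \<open>F\<close> is closed under moving two steps ahead
  (\<open>fw\<close>) or back (\<open>bw\<close>) along any nonbacktracking path: \<open>a\<close>
  and its inverse do this along the axis, and \<open>K\<close> exchanges the possible continuations
  by \<open>move_two\<close>. Zigzags of such moves change a single endpoint.\<close>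

lemma generate:
  assumes M: "subgroup M GG" and KM: "K \<subseteq> M" and aM: "a \<in> M"
  shows "M = G"
proof -
  have MG: "M \<subseteq> G" using subgroup.subset[OF M] by simp
  have Mm: "g \<cdot> h \<in> M" if "g \<in> M" "h \<in> M" for g h using that subgroup.m_closed[OF M] by blast
  have Mi: "inv\<^sub>G g \<in> M" if "g \<in> M" for g using that subgroup.m_inv_closed[OF M] by blast
  define F where "F = {(m (r 0), m (r 1)) | m. m \<in> M}"
  have FE: "F \<subseteq> E" using MG G_edgeI r_edge0 by (auto simp: F_def)
  \<comment> \<open>The translate of the base edge by the inverse of \<open>a\<close> prolongs the
    ray backwards: \<open>r 1, r 0, q0, p0\<close> is a nonbacktracking path.\<close>
  define p0 q0 where "p0 = (inv\<^sub>G a) (r 0)" and "q0 = (inv\<^sub>G a) (r 1)"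
  have pq: "p0 \<in> V" "q0 \<in> V" "a p0 = r 0" "a q0 = r 1"
    using a G_inv G_V rV apply_inv by (auto simp: p0_def q0_def)
  have ar: "a (r 0) = r 2" "a (r 1) = r 3" using shift by (simp_all add: numeral_2_eq_2 numeral_3_eq_3)
  have ed: "(r 0, q0) \<in> E" "(q0, p0) \<in> E" "q0 \<noteq> r 1" "p0 \<noteq> r 0" "(p0, q0) \<in> E"
  proof -
    have "(a (r 0), a q0) \<in> E" using edge_sym[OF r_edge[of 1]] ar pq by (simp add: numeral_2_eq_2)
    then show "(r 0, q0) \<in> E" using G_edge[OF a rV pq(2)] by blast
    show "(q0, p0) \<in> E" using G_edge[OF a pq(2,1)] pq r_edge0 by simp
    show "(p0, q0) \<in> E" using G_edge[OF a pq(1,2)] pq r_edge0 by simp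
    show "q0 \<noteq> r 1" "p0 \<noteq> r 0" using pq ar r_inj by (metis One_nat_def numeral_eq_one_iff numeral_3_eq_3 n_not_Suc_n Suc_inject zero_neq_numeral nat.distinct(1))+
  qed
  have fw: "(w, z) \<in> F" if h: "(u, v) \<in> F" "(v, w) \<in> E" "w \<noteq> u" "(w, z) \<in> E" "z \<noteq> v" for u v w z
  proof -
    obtain m where m: "m \<in> M" "u = m (r 0)" "v = m (r 1)" using h(1) by (auto simp: F_def)
    have mG: "m \<in> G" using m MG by blast
    let ?i = "inv\<^sub>G m"
    have V: "w \<in> V" "z \<in> V" using h edge_V by blast+
    have iG: "?i \<in> G" using G_inv mG by blast
    have iuv: "?i u = r 0" "?i v = r 1" using inv_apply[OF mG rV] m by auto
    have "(?i v, ?i w) \<in> E" "(?i w, ?i z) \<in> E" using G_edgeI[OF iG] h by blast+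
    moreover have "?i w \<noteq> ?i u" "?i z \<noteq> ?i v" using G_inj[OF iG] h edge_V FE by blast+
    ultimately obtain k where k: "k \<in> G" "k (r 0) = r 0" "k (r 1) = r 1" "k (r 2) = ?i w" "k (r 3) = ?i z"
      using move_two[of "r 0" "r 1" "r 2" "r 3" "?i w" "?i z"] r_edge[of 0] r_edge[of 1] r_edge[of 2] iuv r_inj
      by (auto simp: numeral_2_eq_2 numeral_3_eq_3)
    have kM: "k \<in> M" using KM k K_iff by blast
    let ?g = "m \<cdot> (k \<cdot> a)"
    have "?g (r 0) = w" "?g (r 1) = z"
      using mG k a G_mult rV ar V apply_inv by (simp_all add: mult_apply)
    moreover have "?g \<in> M" using Mm m kM aM by blast
    ultimately show ?thesis unfolding F_def by blast
  qed
  have bw: "(p, q) \<in> F" if h: "(u, v) \<in> F" "(u, q) \<in> E" "q \<noteq> v" "(q, p) \<in> E" "p \<noteq> u" for u v p q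
  proof -
    obtain m where m: "m \<in> M" "u = m (r 0)" "v = m (r 1)" using h(1) by (auto simp: F_def)
    have mG: "m \<in> G" using m MG by blast
    let ?i = "inv\<^sub>G m"
    have V: "p \<in> V" "q \<in> V" using h edge_V by blast+
    have iG: "?i \<in> G" using G_inv mG by blast
    have iuv: "?i u = r 0" "?i v = r 1" using inv_apply[OF mG rV] m by auto
    have "(?i u, ?i q) \<in> E" "(?i q, ?i p) \<in> E" using G_edgeI[OF iG] h by blast+
    moreover have "?i q \<noteq> ?i v" "?i p \<noteq> ?i u" using G_inj[OF iG] h edge_V FE by blast+
    ultimately obtain k where k: "k \<in> G" "k (r 0) = r 0" "k (r 1) = r 1" "k q0 = ?i q" "k p0 = ?i p"
      using move_two[of "r 1" "r 0" q0 p0 "?i q" "?i p"] r_edge0 ed iuv by auto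
    have kM: "k \<in> M" using KM k K_iff by blast
    let ?g = "m \<cdot> (k \<cdot> inv\<^sub>G a)"
    have "?g (r 0) = p" "?g (r 1) = q"
      using mG k a G_mult G_inv G_V rV V apply_inv p0_def q0_def by (simp_all add: mult_apply)
    moreover have "?g \<in> M" using Mm Mi m kM aM by blast
    ultimately show ?thesis unfolding F_def by blast
  qed
  \<comment> \<open>Back, ahead, back, always turning at \<open>q\<close>: from
    \<open>(u, v)\<close> to \<open>(p, q)\<close>, then to \<open>(z0, z1)\<close>, then to
    \<open>(u, q)\<close>. For \<open>F2\<close> the moves are ahead, back, ahead.\<close>
  have F1: "(u, q) \<in> F" if h: "(u, v) \<in> F" "(u, q) \<in> E" for u v q
  proof (cases "q = v")
    case False
    have qu: "(q, u) \<in> E" using edge_sym h by blast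
    then have qV: "q \<in> V" using edge_V by blast
    obtain p where p: "(q, p) \<in> E" "p \<noteq> u" using nbr_avoid[OF qV] by blast
    have pqF: "(p, q) \<in> F" using bw[OF h False p] .
    obtain z0 where z0: "(q, z0) \<in> E" "z0 \<noteq> p" "z0 \<noteq> u" using nbr_avoid[OF qV, of p u] by blast
    obtain z1 where z1: "(z0, z1) \<in> E" "z1 \<noteq> q" using nbr_avoid[of z0] z0 edge_V by blast
    have zF: "(z0, z1) \<in> F" using fw[OF pqF z0(1,2) z1] .
    show ?thesis using bw[OF zF edge_sym[OF z0(1)] _ qu] z1(2) z0(3) by blast
  qed (use h in simp)
  have F2: "(q, v) \<in> F" if h: "(u, v) \<in> F" "(q, v) \<in> E" for u v q
  proof (cases "q = u")
    case False
    have vq: "(v, q) \<in> E" using edge_sym h by blast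
    then have qV: "q \<in> V" using edge_V by blast
    obtain z where z: "(q, z) \<in> E" "z \<noteq> v" using nbr_avoid[OF qV] by blast
    have qzF: "(q, z) \<in> F" using fw[OF h(1) vq False z] .
    obtain t where t: "(q, t) \<in> E" "t \<noteq> z" "t \<noteq> v" using nbr_avoid[OF qV, of z v] by blast
    obtain s where s: "(t, s) \<in> E" "s \<noteq> q" using nbr_avoid[of t] t edge_V by blast
    have "(s, t) \<in> F" using bw[OF qzF t(1,2) s] .
    then show ?thesis using fw[OF _ edge_sym[OF t(1)] _ h(2)] s(2) t(3) by blast
  qed (use h in simp)
  show ?thesis by (rule edge_orbit_closed[OF M KM F_def]) (use F1 F2 in blast)+
qed

text \<open>The conjugates of \<open>K\<close> are the stabilizers of all edges of one type. The
  elements from \<open>swap_nbrs\<close> that exchange two neighbours of a vertex fix a further edge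
  at that vertex, so they belong to \<open>S\<close>.\<close>

lemma normal_closure:
  assumes S: "subgroup S GG" and KS: "K \<subseteq> S"
    and conj: "\<And>g s. g \<in> G \<Longrightarrow> s \<in> S \<Longrightarrow> g \<cdot> s \<cdot> inv\<^sub>G g \<in> S"
  shows "S = G"
proof -
  have SG: "S \<subseteq> G" using subgroup.subset[OF S] by simp
  have Sm: "g \<cdot> h \<in> S" if "g \<in> S" "h \<in> S" for g h using that subgroup.m_closed[OF S] by blast
  define F where "F = {(m (r 0), m (r 1)) | m. m \<in> S}"
  have FE: "F \<subseteq> E" using SG G_edgeI r_edge0 by (auto simp: F_def)
  have ef: "t \<in> S" if t: "t \<in> G" "t x = x" "t y = y" and xy: "(x, y) \<in> E" "x \<in> A" for t x y
  proof -
    obtain g where g: "g \<in> G" "g (r 0) = x" "g (r 1) = y"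
      using edge_transitive[OF r_edge0(1) r0A xy] by blast
    have "inv\<^sub>G g \<cdot> t \<cdot> g \<in> K"
      using g t G_inv G_mult rV G_V edge_V[OF xy(1)] inv_apply_eq[OF g(1) rV g(2)] inv_apply_eq[OF g(1) rV g(3)]
      by (simp add: K_iff mult_apply)
    then have "g \<cdot> (inv\<^sub>G g \<cdot> t \<cdot> g) \<cdot> inv\<^sub>G g \<in> S" using conj g KS by blast
    moreover have "g \<cdot> (inv\<^sub>G g \<cdot> t \<cdot> g) \<cdot> inv\<^sub>G g = t"
      using g t G_inv G_mult by (intro G_ext) (auto simp: mult_apply apply_inv G_V)
    ultimately show ?thesis by simp
  qed
  have mF: "(t u, t v) \<in> F" if "t \<in> S" "(u, v) \<in> F" for t u v
  proof -
    obtain m where "m \<in> S" "u = m (r 0)" "v = m (r 1)" using \<open>(u, v) \<in> F\<close> by (auto simp: F_def)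
    then have "t \<cdot> m \<in> S" "(t \<cdot> m) (r 0) = t u" "(t \<cdot> m) (r 1) = t v"
      using that Sm mult_apply[of t m] SG rV by (auto simp: subset_iff)
    then show ?thesis unfolding F_def by (metis (mono_tags, lifting) CollectI)
  qed
  have F1: "(u, q) \<in> F" if h: "(u, v) \<in> F" "u \<in> A" "(u, q) \<in> E" for u v q
  proof -
    have uv: "(u, v) \<in> E" using h FE by blast
    obtain z where z: "(u, z) \<in> E" "z \<noteq> v" "z \<noteq> q" using nbr_avoid edge_V uv by blast
    obtain k where k: "k \<in> G" "k z = z" "k u = u" "k v = q" using swap_nbrs[OF z(1) uv h(3) z(2,3)] by blast
    have "k \<in> S" using ef[OF k(1,3,2) z(1) h(2)] .
    then show ?thesis using mF[of k u v] h(1) k by simp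
  qed
  have F2: "(q, v) \<in> F" if h: "(u, v) \<in> F" "u \<in> A" "(q, v) \<in> E" for u v q
  proof -
    have uv: "(v, u) \<in> E" and vq: "(v, q) \<in> E" using h FE edge_sym by blast+
    obtain z where z: "(v, z) \<in> E" "z \<noteq> u" "z \<noteq> q" using nbr_avoid edge_V uv by blast
    obtain k where k: "k \<in> G" "k z = z" "k v = v" "k u = q" using swap_nbrs[OF z(1) uv vq z(2,3)] by blast
    have "z \<in> A" using h(2) uv z(1) bip_edge by blast
    then have "k \<in> S" using ef[OF k(1,2,3) edge_sym[OF z(1)]] by blast
    then show ?thesis using mF[of k u v] h(1) k by simp
  qed
  show ?thesis by (rule edge_orbit_closed[OF S KS F_def]) (use F1 F2 in blast)+
qed

text \<open>\<open>W\<close> fixes \<open>r 0\<close>, so each vertex moves only inside a finite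
  ball around it. Consequently a set invariant under the fixator of \<open>F\<close> has only
  finitely many \<open>W\<close>-translates.\<close>

lemma W_finite_images:
  assumes F: "finite F" "F \<subseteq> V"
  shows "\<exists>W0\<subseteq>W. finite W0 \<and> (\<forall>w\<in>W. \<exists>w'\<in>W0. \<forall>v\<in>F. w v = w' v)"
proof -
  let ?P = "(\<lambda>w. restrict w F) ` W"
  have fin: "finite ?P"
  proof (rule finite_subset)
    let ?B = "\<lambda>v. {y \<in> V. length (geo E (r 0) y) \<le> length (geo E (r 0) v)}"
    show "?P \<subseteq> PiE F ?B"
    proof
      fix p assume "p \<in> ?P"
      then obtain w where w: "w \<in> W" "p = restrict w F" by blast
      have wG: "w \<in> G" using w by (simp add: W_def fixator_def)
      have "length (geo E (r 0) (w v)) = length (geo E (r 0) v)" if "v \<in> V" for v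
        using geo_map[OF wG rV that, of 0] W_ray[OF w(1)] by simp
      then show "p \<in> PiE F ?B" using w F G_V[OF wG] by (auto simp: subset_iff)
    qed
    show "finite (PiE F ?B)" using F finite_ball[OF rV] by (intro finite_PiE) auto
  qed
  define c where "c p = (SOME w. w \<in> W \<and> restrict w F = p)" for p
  have c: "c p \<in> W \<and> restrict (c p) F = p" if "p \<in> ?P" for p
  proof -
    obtain w where "w \<in> W" "restrict w F = p" using \<open>p \<in> ?P\<close> by blast
    then show ?thesis unfolding c_def by (metis (mono_tags, lifting) someI)
  qed
  show ?thesis
  proof (intro exI[of _ "c ` ?P"] conjI ballI)
    show "c ` ?P \<subseteq> W" using c by blast
    show "finite (c ` ?P)" using fin by blast
    show "\<exists>w'\<in>c ` ?P. \<forall>v\<in>F. w v = w' v" if "w \<in> W" for w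
    proof
      show "c (restrict w F) \<in> c ` ?P" using that by blast
      have "restrict (c (restrict w F)) F = restrict w F" using c that by blast
      then show "\<forall>v\<in>F. w v = c (restrict w F) v" by (metis restrict_apply')
    qed
  qed
qed

end

section \<open>Contracting actions with finitely many orbits\<close>

text \<open>The dynamical argument separated from the tree. \<open>\<L>\<close> stands for the
  fixators of finite vertex sets, a neighbourhood base of the identity: \<open>L_index\<close>
  expresses that \<open>W\<close> meets only finitely many cosets of each of them, and
  \<open>L_contract\<close> that conjugation by powers of \<open>a\<close> shrinks \<open>U\<close>
  into each of them.\<close>

locale contraction_action = group GR for GR :: "('g, 'm) monoid_scheme" (structure) +
  fixes X :: "'x set" and act :: "'g \<Rightarrow> 'x \<Rightarrow> 'x"
    and \<L> :: "'g set set" and K U W :: "'g set" and a :: 'g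
  assumes act_X: "g \<in> carrier GR \<Longrightarrow> x \<in> X \<Longrightarrow> act g x \<in> X"
    and act_one: "x \<in> X \<Longrightarrow> act \<one> x = x"
    and act_mult: "g \<in> carrier GR \<Longrightarrow> h \<in> carrier GR \<Longrightarrow> x \<in> X \<Longrightarrow> act (g \<otimes> h) x = act g (act h x)"
    and act_transitive: "x \<in> X \<Longrightarrow> y \<in> X \<Longrightarrow> \<exists>g\<in>carrier GR. act g x = y"
    and K: "subgroup K GR" and U: "subgroup U GR" and W: "subgroup W GR"
    and UK: "U \<subseteq> K" and WK: "W \<subseteq> K"
    and K_UW: "k \<in> K \<Longrightarrow> \<exists>u\<in>U. \<exists>w\<in>W. k = u \<otimes> w"
    and U_norm: "u \<in> U \<Longrightarrow> k \<in> K \<Longrightarrow> inv k \<otimes> u \<otimes> k \<in> U"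
    and aG: "a \<in> carrier GR"
    and W_conj: "w \<in> W \<Longrightarrow> inv (a [^] (n::nat)) \<otimes> w \<otimes> a [^] n \<in> K"
    and U_conj: "u \<in> U \<Longrightarrow> a \<otimes> u \<otimes> inv a \<in> K"
    and L_sub: "L \<in> \<L> \<Longrightarrow> subgroup L GR"
    and L_K: "K \<in> \<L>"
    and L_Int: "L \<in> \<L> \<Longrightarrow> L' \<in> \<L> \<Longrightarrow> L \<inter> L' \<in> \<L>"
    and L_conj: "L \<in> \<L> \<Longrightarrow> g \<in> carrier GR \<Longrightarrow> \<exists>L'\<in>\<L>. \<forall>l\<in>L'. inv g \<otimes> l \<otimes> g \<in> L"
    and L_index: "L \<in> \<L> \<Longrightarrow> \<exists>W0\<subseteq>W. finite W0 \<and> (\<forall>w\<in>W. \<exists>w'\<in>W0. inv w' \<otimes> w \<in> L)"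
    and L_contract: "L \<in> \<L> \<Longrightarrow> \<exists>k0. \<forall>k\<ge>k0. \<forall>u\<in>U. a [^] (k::nat) \<otimes> u \<otimes> inv (a [^] k) \<in> L"
    and generates: "subgroup M GR \<Longrightarrow> K \<subseteq> M \<Longrightarrow> a \<in> M \<Longrightarrow> M = carrier GR"
    and normally_generates: "subgroup S GR \<Longrightarrow> K \<subseteq> S \<Longrightarrow>
      (\<And>g s. g \<in> carrier GR \<Longrightarrow> s \<in> S \<Longrightarrow> g \<otimes> s \<otimes> inv g \<in> S) \<Longrightarrow> S = carrier GR"
    and finite_orbits: "finite ((\<lambda>x. (\<lambda>k. act k x) ` K) ` X)"
begin

abbreviation T :: "'g \<Rightarrow> 'x set \<Rightarrow> 'x set" where "T g B \<equiv> act g ` B"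

definition invariant :: "'g set \<Rightarrow> 'x set \<Rightarrow> bool" where
  "invariant S B \<longleftrightarrow> (\<forall>g\<in>S. T g B \<subseteq> B)"

text \<open>On the coset space these sets are clopen, since they and their complements are open.
  They form an algebra that is stable under the group and generates the Borel sets.\<close>

definition basic :: "'x set \<Rightarrow> bool" where
  "basic B \<longleftrightarrow> B \<subseteq> X \<and> (\<exists>L\<in>\<L>. invariant L B)"

definition orbits :: "'x set set" where
  "orbits = (\<lambda>x. (\<lambda>k. act k x) ` K) ` X"

definition content :: "('x set \<Rightarrow> real) \<Rightarrow> bool" where
  "content m \<longleftrightarrow> (\<forall>B. basic B \<longrightarrow> 0 \<le> m B) \<and>
     (\<forall>B C. basic B \<longrightarrow> basic C \<longrightarrow> B \<inter> C = {} \<longrightarrow> m (B \<union> C) = m B + m C)"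

abbreviation W_invariant :: "('x set \<Rightarrow> real) \<Rightarrow> bool" where
  "W_invariant m \<equiv> \<forall>w\<in>W. \<forall>D. basic D \<longrightarrow> m (T w D) = m D"

section \<open>The algebra of basic sets\<close>

lemma sub_carrier: "subgroup S GR \<Longrightarrow> g \<in> S \<Longrightarrow> g \<in> carrier GR"
  by (rule subgroup.mem_carrier)

lemma K_carrier: "g \<in> K \<Longrightarrow> g \<in> carrier GR" by (rule sub_carrier[OF K])
lemma U_carrier: "g \<in> U \<Longrightarrow> g \<in> carrier GR" by (rule sub_carrier[OF U])
lemma W_carrier: "g \<in> W \<Longrightarrow> g \<in> carrier GR" by (rule sub_carrier[OF W])

lemma inv_cancel: "g \<in> carrier GR \<Longrightarrow> h \<in> carrier GR \<Longrightarrow> inv g \<otimes> (g \<otimes> h) = h"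
  "g \<in> carrier GR \<Longrightarrow> h \<in> carrier GR \<Longrightarrow> g \<otimes> (inv g \<otimes> h) = h"
  using m_assoc[of "inv g" g h] m_assoc[of g "inv g" h] by simp_all

lemma T_X: "g \<in> carrier GR \<Longrightarrow> B \<subseteq> X \<Longrightarrow> T g B \<subseteq> X"
  using act_X by auto

lemma T_one: "B \<subseteq> X \<Longrightarrow> T \<one> B = B"
  using act_one by (force simp: image_iff)

lemma T_mult: "g \<in> carrier GR \<Longrightarrow> h \<in> carrier GR \<Longrightarrow> B \<subseteq> X \<Longrightarrow> T (g \<otimes> h) B = T g (T h B)"
  unfolding image_image using act_mult by (intro image_cong) auto

lemma act_inv: "g \<in> carrier GR \<Longrightarrow> x \<in> X \<Longrightarrow> act (inv g) (act g x) = x"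
  using act_mult[of "inv g" g x] act_one by simp

lemma T_inv: "g \<in> carrier GR \<Longrightarrow> B \<subseteq> X \<Longrightarrow> T (inv g) (T g B) = B"
  using T_mult[of "inv g" g B] T_one by simp

lemma T_inv': "g \<in> carrier GR \<Longrightarrow> B \<subseteq> X \<Longrightarrow> T g (T (inv g) B) = B"
  using T_mult[of g "inv g" B] T_one by simp

lemma T_inj: "g \<in> carrier GR \<Longrightarrow> inj_on (act g) X"
  using act_inv by (metis inj_onI)

lemma T_Int: "g \<in> carrier GR \<Longrightarrow> B \<subseteq> X \<Longrightarrow> C \<subseteq> X \<Longrightarrow> T g (B \<inter> C) = T g B \<inter> T g C"
  by (rule inj_on_image_Int[OF T_inj])

lemma invariantD: "subgroup S GR \<Longrightarrow> invariant S B \<Longrightarrow> B \<subseteq> X \<Longrightarrow> g \<in> S \<Longrightarrow> T g B = B"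
proof (rule equalityI)
  assume *: "subgroup S GR" "invariant S B" "B \<subseteq> X" "g \<in> S"
  then show "T g B \<subseteq> B" by (auto simp: invariant_def)
  have "inv g \<in> S" using * subgroup.m_inv_closed by metis
  then have "T (inv g) B \<subseteq> B" using * by (auto simp: invariant_def)
  then have "T g (T (inv g) B) \<subseteq> T g B" by blast
  then show "B \<subseteq> T g B" using T_inv' sub_carrier * by metis
qed

lemma basic_X: "basic B \<Longrightarrow> B \<subseteq> X" by (simp add: basic_def)

lemma basic_K: "B \<subseteq> X \<Longrightarrow> invariant K B \<Longrightarrow> basic B"
  using L_K by (auto simp: basic_def)

lemma basic_Int: "basic B \<Longrightarrow> basic C \<Longrightarrow> basic (B \<inter> C)"
proof -
  assume "basic B" "basic C"
  then obtain L L' where "L \<in> \<L>" "invariant L B" "L' \<in> \<L>" "invariant L' C" "B \<subseteq> X" "C \<subseteq> X"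
    by (auto simp: basic_def)
  moreover from this have "invariant (L \<inter> L') (B \<inter> C)" unfolding invariant_def by blast
  ultimately show ?thesis using L_Int unfolding basic_def by blast
qed

lemma basic_Un: "basic B \<Longrightarrow> basic C \<Longrightarrow> basic (B \<union> C)"
proof -
  assume "basic B" "basic C"
  then obtain L L' where "L \<in> \<L>" "invariant L B" "L' \<in> \<L>" "invariant L' C" "B \<subseteq> X" "C \<subseteq> X"
    by (auto simp: basic_def)
  moreover from this have "invariant (L \<inter> L') (B \<union> C)" unfolding invariant_def by blast
  ultimately show ?thesis using L_Int unfolding basic_def by blast
qed

lemma invariant_compl:
  assumes S: "subgroup S GR" and B: "B \<subseteq> X" "invariant S B"
  shows "invariant S (X - B)"
  unfolding invariant_def
proof (intro ballI subsetI)
  fix g y assume g: "g \<in> S" and y: "y \<in> T g (X - B)"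
  then obtain x where x: "x \<in> X" "x \<notin> B" "y = act g x" by blast
  have gG: "g \<in> carrier GR" using sub_carrier S g by blast
  have "act (inv g) y = x" using x act_inv gG by simp
  moreover have "T (inv g) B = B" using invariantD[OF S B(2,1)] subgroup.m_inv_closed[OF S g] by blast
  ultimately have "y \<notin> B" using x by blast
  then show "y \<in> X - B" using x act_X gG by blast
qed

lemma basic_Diff: "basic B \<Longrightarrow> basic C \<Longrightarrow> basic (B - C)"
proof -
  assume B: "basic B" and C: "basic C"
  then obtain L where "L \<in> \<L>" "invariant L C" by (auto simp: basic_def)
  then have "basic (X - C)" using invariant_compl[OF L_sub] basic_X[OF C] unfolding basic_def by blast
  then have "basic (B \<inter> (X - C))" using basic_Int B by blast
  then show ?thesis using basic_X[OF B] by (metis Diff_Int_distrib Int_Diff inf.absorb_iff1)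
qed

lemma basic_empty: "basic {}" using L_K by (auto simp: basic_def invariant_def)

lemma basic_space: "basic X"
  using basic_K act_X K_carrier by (auto simp: invariant_def)

lemma basic_T: "g \<in> carrier GR \<Longrightarrow> basic B \<Longrightarrow> basic (T g B)"
proof -
  assume g: "g \<in> carrier GR" and B: "basic B"
  then obtain L where L: "L \<in> \<L>" "invariant L B" by (auto simp: basic_def)
  obtain L' where L': "L' \<in> \<L>" "\<And>l. l \<in> L' \<Longrightarrow> inv g \<otimes> l \<otimes> g \<in> L" using L_conj[OF L(1) g] by blast
  have BX: "B \<subseteq> X" using B basic_X by blast
  have "T l (T g B) \<subseteq> T g B" if l: "l \<in> L'" for l
  proof -
    have lG: "l \<in> carrier GR" using L_sub[OF L'(1)] sub_carrier l by blast
    have "T (inv g \<otimes> l \<otimes> g) B \<subseteq> B" using L'(2)[OF l] L(2) by (auto simp: invariant_def)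
    then have "T g (T (inv g \<otimes> l \<otimes> g) B) \<subseteq> T g B" by blast
    also have "T g (T (inv g \<otimes> l \<otimes> g) B) = T (g \<otimes> (inv g \<otimes> l \<otimes> g)) B" using T_mult BX g lG by simp
    also have "g \<otimes> (inv g \<otimes> l \<otimes> g) = l \<otimes> g" using g lG by (metis inv_closed inv_solve_left' m_assoc m_closed)
    finally show ?thesis using T_mult BX g lG by simp
  qed
  then show ?thesis using T_X[OF g BX] L'(1) unfolding basic_def invariant_def by blast
qed

section \<open>Orbits of \<open>K\<close>\<close>

lemma orbits_invariant: "S \<in> orbits \<Longrightarrow> S \<subseteq> X \<and> S \<noteq> {} \<and> invariant K S"
proof -
  assume "S \<in> orbits"
  then obtain x where x: "x \<in> X" "S = (\<lambda>k. act k x) ` K" by (auto simp: orbits_def)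
  have "act g (act k x) \<in> S" if "g \<in> K" "k \<in> K" for g k
    using act_mult[of g k x] that K_carrier x subgroup.m_closed[OF K that] by (metis imageI)
  moreover have "S \<subseteq> X" using x act_X K_carrier by auto
  moreover have "S \<noteq> {}" using x subgroup.one_closed[OF K] by blast
  ultimately show ?thesis using x unfolding invariant_def by blast
qed

lemma orbit_transitive: "S \<in> orbits \<Longrightarrow> x \<in> S \<Longrightarrow> y \<in> S \<Longrightarrow> \<exists>k\<in>K. act k x = y"
proof -
  assume "S \<in> orbits" "x \<in> S" "y \<in> S"
  then obtain z k l where z: "z \<in> X" "k \<in> K" "l \<in> K" "x = act k z" "y = act l z" by (auto simp: orbits_def)
  have kl: "k \<in> carrier GR" "l \<in> carrier GR" using z K_carrier by blast+
  have "act (l \<otimes> inv k) x = y" using act_mult[of l "inv k" x] kl z act_inv act_X by simp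
  moreover have "l \<otimes> inv k \<in> K" using z K by (simp add: subgroup.m_closed subgroup.m_inv_closed)
  ultimately show ?thesis by blast
qed

lemma in_orbit: "x \<in> X \<Longrightarrow> \<exists>S\<in>orbits. x \<in> S"
proof -
  assume x: "x \<in> X"
  have "x \<in> (\<lambda>k. act k x) ` K" using act_one[OF x] subgroup.one_closed[OF K] by (metis imageI)
  then show ?thesis using x by (auto simp: orbits_def)
qed

lemma Union_orbits: "\<Union>orbits = X"
  using in_orbit orbits_invariant by blast

lemma orbits_disjoint: "S \<in> orbits \<Longrightarrow> S' \<in> orbits \<Longrightarrow> S \<noteq> S' \<Longrightarrow> S \<inter> S' = {}"
proof (rule ccontr)
  assume *: "S \<in> orbits" "S' \<in> orbits" "S \<noteq> S'" "S \<inter> S' \<noteq> {}"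
  then obtain x where x: "x \<in> S" "x \<in> S'" by blast
  have "S1 \<subseteq> S2" if "S1 \<in> orbits" "S2 \<in> orbits" "x \<in> S1" "x \<in> S2" for S1 S2
    using that orbit_transitive orbits_invariant unfolding invariant_def by blast
  then show False using * x by blast
qed

lemma basic_orbit: "S \<in> orbits \<Longrightarrow> basic S"
  using orbits_invariant basic_K by blast

lemma finite_orbits': "finite orbits" using finite_orbits by (simp add: orbits_def)

lemma finite_K_invariant: "finite {B. B \<subseteq> X \<and> invariant K B}"
proof (rule finite_subset)
  show "{B. B \<subseteq> X \<and> invariant K B} \<subseteq> Union ` Pow orbits"
  proof
    fix B assume B: "B \<in> {B. B \<subseteq> X \<and> invariant K B}"
    have "B = \<Union>{S \<in> orbits. S \<inter> B \<noteq> {}}"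
    proof (intro equalityI subsetI)
      fix x assume "x \<in> B"
      then show "x \<in> \<Union>{S \<in> orbits. S \<inter> B \<noteq> {}}" using in_orbit[of x] B by blast
    next
      fix x assume "x \<in> \<Union>{S \<in> orbits. S \<inter> B \<noteq> {}}"
      then obtain S y where S: "S \<in> orbits" "x \<in> S" "y \<in> S" "y \<in> B" by blast
      then obtain k where "k \<in> K" "act k y = x" using orbit_transitive by blast
      then show "x \<in> B" using S B unfolding invariant_def by blast
    qed
    then show "B \<in> Union ` Pow orbits" by blast
  qed
  show "finite (Union ` Pow orbits)" using finite_orbits' by simp
qed

section \<open>Finitely additive contents\<close>

lemma content_nonneg: "content m \<Longrightarrow> basic B \<Longrightarrow> 0 \<le> m B"
  by (simp add: content_def)

lemma content_add: "content m \<Longrightarrow> basic B \<Longrightarrow> basic C \<Longrightarrow> B \<inter> C = {} \<Longrightarrow> m (B \<union> C) = m B + m C"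
  by (simp add: content_def)

lemma content_empty: "content m \<Longrightarrow> m {} = 0"
proof -
  assume m: "content m"
  have "m ({} \<union> {}) = m {} + m {}" using m basic_empty unfolding content_def by blast
  then show ?thesis by simp
qed

lemma content_UN:
  assumes m: "content m" and I: "finite I" and b: "\<And>i. i \<in> I \<Longrightarrow> basic (D i)"
    and d: "\<And>i j. i \<in> I \<Longrightarrow> j \<in> I \<Longrightarrow> i \<noteq> j \<Longrightarrow> D i \<inter> D j = {}"
  shows "basic (\<Union>(D ` I)) \<and> m (\<Union>(D ` I)) = (\<Sum>i\<in>I. m (D i))"
  using I b d
proof (induction I)
  case empty
  then show ?case using content_empty[OF m] basic_empty by simp
next
  case (insert i I)
  have IH: "basic (\<Union>(D ` I))" "m (\<Union>(D ` I)) = (\<Sum>i\<in>I. m (D i))" using insert by auto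
  have bi: "basic (D i)" using insert by auto
  have "D i \<inter> \<Union>(D ` I) = {}" using insert by blast
  then have "m (D i \<union> \<Union>(D ` I)) = m (D i) + m (\<Union>(D ` I))"
    using m bi IH(1) unfolding content_def by blast
  then show ?case using IH insert basic_Un[OF bi IH(1)] by simp
qed

lemma content_orbits:
  assumes m: "content m" and B: "basic B"
  shows "m B = (\<Sum>S\<in>orbits. m (B \<inter> S))"
proof -
  have "m (\<Union>((\<lambda>S. B \<inter> S) ` orbits)) = (\<Sum>S\<in>orbits. m (B \<inter> S))"
    using content_UN[OF m finite_orbits', of "\<lambda>S. B \<inter> S"] basic_Int[OF B] basic_orbit orbits_disjoint by blast
  moreover have "\<Union>((\<lambda>S. B \<inter> S) ` orbits) = B" using Union_orbits basic_X[OF B] by blast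
  ultimately show ?thesis by simp
qed

lemma content_mono: "content m \<Longrightarrow> basic B \<Longrightarrow> basic C \<Longrightarrow> B \<subseteq> C \<Longrightarrow> m C = m B + m (C - B)"
proof -
  assume *: "content m" "basic B" "basic C" "B \<subseteq> C"
  then have "m (B \<union> (C - B)) = m B + m (C - B)" using basic_Diff unfolding content_def by blast
  then show ?thesis using * by (simp add: Un_absorb1)
qed

text \<open>This is the integral over \<open>D\<close> of the sum of the indicators of the members
  of \<open>\<Omega>\<close>. For a finitely additive \<open>m\<close> it is evaluated on the atoms
  \<open>At \<S>\<close>, the points of \<open>D\<close> lying in exactly the members of
  \<open>\<S>\<close>.\<close>

lemma content_double_count:
  assumes m: "content m" and D: "basic D" and \<Omega>: "finite \<Omega>" "\<And>B. B \<in> \<Omega> \<Longrightarrow> basic B"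
    and N: "\<And>x. x \<in> D \<Longrightarrow> card {B \<in> \<Omega>. x \<in> B} = N"
  shows "(\<Sum>B\<in>\<Omega>. m (D \<inter> B)) = real N * m D"
proof -
  define At where "At \<S> = {x \<in> D. {B \<in> \<Omega>. x \<in> B} = \<S>}" for \<S>
  \<comment> \<open>The induction adds one member of \<open>\<Omega>\<close> at a time, which cuts
    an atom by an intersection or a difference. This is why the claim is stated for all
    subfamilies.\<close>
  have bAt: "basic {x \<in> D. {B \<in> \<Omega>'. x \<in> B} = \<S>}" if "\<Omega>' \<subseteq> \<Omega>" "\<S> \<subseteq> \<Omega>'" for \<Omega>' \<S>
  proof -
    have "finite \<Omega>'" using that \<Omega> finite_subset by blast
    then show ?thesis using that
    proof (induction \<Omega>' arbitrary: \<S>)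
      case empty
      then show ?case using D by simp
    next
      case (insert B \<Omega>')
      show ?case
      proof (cases "B \<in> \<S>")
        case True
        have "{x \<in> D. {C \<in> insert B \<Omega>'. x \<in> C} = \<S>} = {x \<in> D. {C \<in> \<Omega>'. x \<in> C} = \<S> - {B}} \<inter> B"
          using insert True by auto
        moreover have "basic {x \<in> D. {C \<in> \<Omega>'. x \<in> C} = \<S> - {B}}"
          by (rule insert.IH) (use insert.prems in auto)
        moreover have "basic B" using insert \<Omega> by auto
        ultimately show ?thesis by (simp only: basic_Int)
      next
        case False
        have "{x \<in> D. {C \<in> insert B \<Omega>'. x \<in> C} = \<S>} = {x \<in> D. {C \<in> \<Omega>'. x \<in> C} = \<S>} - B"
          using insert False by auto
        moreover have "basic {x \<in> D. {C \<in> \<Omega>'. x \<in> C} = \<S>}" using insert False by auto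
        moreover have "basic B" using insert \<Omega> by auto
        ultimately show ?thesis by (simp only: basic_Diff)
      qed
    qed
  qed
  have fP: "finite (Pow \<Omega>)" using \<Omega> by simp
  have b: "basic (At \<S>)" if "\<S> \<in> Pow \<Omega>" for \<S> using bAt[of \<Omega> \<S>] that by (simp add: At_def)
  have disj: "At \<S> \<inter> At \<S>' = {}" if "\<S> \<noteq> \<S>'" for \<S> \<S>' using that by (auto simp: At_def)
  have dec: "m (D \<inter> C) = (\<Sum>\<S>\<in>Pow \<Omega>. m (At \<S> \<inter> C))" if C: "basic C" for C
  proof -
    have "m (\<Union>((\<lambda>\<S>. At \<S> \<inter> C) ` Pow \<Omega>)) = (\<Sum>\<S>\<in>Pow \<Omega>. m (At \<S> \<inter> C))"
    proof (rule content_UN[OF m fP, THEN conjunct2])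
      show "basic (At \<S> \<inter> C)" if "\<S> \<in> Pow \<Omega>" for \<S> by (rule basic_Int[OF b[OF that] C])
      show "(At \<S> \<inter> C) \<inter> (At \<S>' \<inter> C) = {}" if "\<S> \<noteq> \<S>'" for \<S> \<S>' using disj[OF that] by blast
    qed
    moreover have "\<Union>((\<lambda>\<S>. At \<S> \<inter> C) ` Pow \<Omega>) = D \<inter> C"
    proof (intro equalityI subsetI)
      fix x assume x: "x \<in> D \<inter> C"
      then have "x \<in> At {B \<in> \<Omega>. x \<in> B} \<inter> C" by (simp add: At_def)
      moreover have "{B \<in> \<Omega>. x \<in> B} \<in> Pow \<Omega>" by blast
      ultimately show "x \<in> \<Union>((\<lambda>\<S>. At \<S> \<inter> C) ` Pow \<Omega>)" by (rule UN_I[rotated])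
    next
      fix x assume "x \<in> \<Union>((\<lambda>\<S>. At \<S> \<inter> C) ` Pow \<Omega>)"
      then show "x \<in> D \<inter> C" unfolding At_def by blast
    qed
    ultimately show ?thesis by simp
  qed
  have AtB: "m (At \<S> \<inter> B) = (if B \<in> \<S> then m (At \<S>) else 0)" if "B \<in> \<Omega>" "\<S> \<in> Pow \<Omega>" for B \<S>
  proof (cases "B \<in> \<S>")
    case True
    then have "At \<S> \<inter> B = At \<S>" using that by (auto simp: At_def)
    then show ?thesis using True by simp
  next
    case False
    then have "At \<S> \<inter> B = {}" using that by (auto simp: At_def)
    then show ?thesis using False content_empty[OF m] by simp
  qed
  have "(\<Sum>B\<in>\<Omega>. m (D \<inter> B)) = (\<Sum>B\<in>\<Omega>. \<Sum>\<S>\<in>Pow \<Omega>. m (At \<S> \<inter> B))"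
    using dec \<Omega>(2) by simp
  also have "\<dots> = (\<Sum>\<S>\<in>Pow \<Omega>. \<Sum>B\<in>\<Omega>. m (At \<S> \<inter> B))" by (rule sum.swap)
  also have "\<dots> = (\<Sum>\<S>\<in>Pow \<Omega>. real N * m (At \<S>))"
  proof (rule sum.cong[OF refl])
    fix \<S> assume S: "\<S> \<in> Pow \<Omega>"
    have "(\<Sum>B\<in>\<Omega>. m (At \<S> \<inter> B)) = (\<Sum>B\<in>\<Omega>. if B \<in> \<S> then m (At \<S>) else 0)"
      using AtB S by (intro sum.cong) auto
    also have "\<dots> = (\<Sum>B\<in>\<S>. m (At \<S>))"
      using S \<Omega>(1) by (intro sum.mono_neutral_cong_right) auto
    also have "\<dots> = real (card \<S>) * m (At \<S>)" by simp
    also have "\<dots> = real N * m (At \<S>)"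
    proof (cases "At \<S> = {}")
      case True
      then show ?thesis using content_empty[OF m] by simp
    next
      case False
      then obtain x where "x \<in> At \<S>" by blast
      then have "card \<S> = N" using N[of x] by (simp add: At_def)
      then show ?thesis by simp
    qed
    finally show "(\<Sum>B\<in>\<Omega>. m (At \<S> \<inter> B)) = real N * m (At \<S>)" .
  qed
  also have "\<dots> = real N * (\<Sum>\<S>\<in>Pow \<Omega>. m (At \<S> \<inter> X))"
  proof -
    have "At \<S> \<inter> X = At \<S>" if "\<S> \<in> Pow \<Omega>" for \<S> using basic_X[OF b[OF that]] by blast
    then show ?thesis by (simp add: sum_distrib_left)
  qed
  also have "\<dots> = real N * m D" using dec[OF basic_space] basic_X[OF D] by (simp add: Int_absorb2)
  finally show ?thesis .
qed

text \<open>The \<open>W\<close>-translates of a \<open>U\<close>-invariant set \<open>B\<close> are permuted by \<open>K = U W\<close>, so each point of a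
  \<open>K\<close>-orbit lies in the same number of them.\<close>

lemma independence:
  assumes B: "basic B" "invariant U B" and S: "S \<in> orbits"
  shows "\<exists>c. \<forall>m C. content m \<longrightarrow> W_invariant m \<longrightarrow>
    basic C \<longrightarrow> invariant W C \<longrightarrow> m (C \<inter> S \<inter> B) = c * m (C \<inter> S)"
proof -
  have BX: "B \<subseteq> X" using B basic_X by blast
  obtain L where L: "L \<in> \<L>" "invariant L B" using B(1) by (auto simp: basic_def)
  define \<Omega> where "\<Omega> = (\<lambda>w. T w B) ` W"
  have fin: "finite \<Omega>"
  proof -
    obtain W0 where W0: "W0 \<subseteq> W" "finite W0" "\<And>w. w \<in> W \<Longrightarrow> \<exists>w'\<in>W0. inv w' \<otimes> w \<in> L"
      using L_index[OF L(1)] by blast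
    have "\<Omega> \<subseteq> (\<lambda>w. T w B) ` W0"
    proof
      fix D assume "D \<in> \<Omega>"
      then obtain w where w: "w \<in> W" "D = T w B" by (auto simp: \<Omega>_def)
      then obtain w' where w': "w' \<in> W0" "inv w' \<otimes> w \<in> L" using W0(3) by blast
      have c: "w \<in> carrier GR" "w' \<in> carrier GR" using w w' W0(1) W_carrier by blast+
      have "T (inv w' \<otimes> w) B = B" using invariantD[OF L_sub[OF L(1)] L(2) BX w'(2)] .
      then have "T w' B = T w' (T (inv w' \<otimes> w) B)" by simp
      also have "\<dots> = T (w' \<otimes> (inv w' \<otimes> w)) B" using T_mult BX c by simp
      also have "w' \<otimes> (inv w' \<otimes> w) = w" using c by (simp add: m_assoc[symmetric])
      finally show "D \<in> (\<lambda>w. T w B) ` W0" using w w' by blast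
    qed
    then show ?thesis using W0(2) finite_surj by blast
  qed
  have OX: "D \<subseteq> X" if "D \<in> \<Omega>" for D using that T_X BX W_carrier by (auto simp: \<Omega>_def)
  have bO: "basic D" if "D \<in> \<Omega>" for D using that basic_T B(1) W_carrier by (auto simp: \<Omega>_def)
  \<comment> \<open>With \<open>k = u w\<close>, the translate of \<open>w' B\<close> by
    \<open>k\<close> is \<open>u v B\<close> for \<open>v = w w'\<close>. As \<open>K\<close>
    normalizes \<open>U\<close>, the factor \<open>u\<close> moves past \<open>v\<close> into
    \<open>U\<close>, where it fixes \<open>B\<close>.\<close>
  have perm: "T k D \<in> \<Omega>" if k: "k \<in> K" and D: "D \<in> \<Omega>" for k D
  proof -
    obtain u w where uw: "u \<in> U" "w \<in> W" "k = u \<otimes> w" using K_UW k by blast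
    obtain w' where w': "w' \<in> W" "D = T w' B" using D by (auto simp: \<Omega>_def)
    let ?v = "w \<otimes> w'"
    have v: "?v \<in> W" using subgroup.m_closed[OF W] uw w' by blast
    have c: "u \<in> carrier GR" "w \<in> carrier GR" "w' \<in> carrier GR" "?v \<in> carrier GR"
      using U_carrier W_carrier uw w' by auto
    have "inv ?v \<otimes> u \<otimes> ?v \<in> U" using U_norm[OF uw(1)] v WK by blast
    then have "T (inv ?v \<otimes> u \<otimes> ?v) B = B" using invariantD[OF U B(2) BX] by blast
    then have "T ?v B = T ?v (T (inv ?v \<otimes> u \<otimes> ?v) B)" by simp
    also have "\<dots> = T (?v \<otimes> (inv ?v \<otimes> u \<otimes> ?v)) B" using T_mult BX c by simp
    also have "?v \<otimes> (inv ?v \<otimes> u \<otimes> ?v) = u \<otimes> ?v" using c(1,4) by (metis inv_closed inv_solve_left' m_assoc m_closed)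
    also have "T (u \<otimes> ?v) B = T k D" using T_mult BX c T_X uw w' by simp
    finally show ?thesis using v unfolding \<Omega>_def by (metis imageI)
  qed
  have le: "card {D \<in> \<Omega>. x \<in> D} \<le> card {D \<in> \<Omega>. act k x \<in> D}" if k: "k \<in> K" for x k
  proof (rule card_inj_on_le[where f = "T k"])
    show "inj_on (T k) {D \<in> \<Omega>. x \<in> D}"
    proof (rule inj_onI)
      fix D D' assume "D \<in> {D \<in> \<Omega>. x \<in> D}" "D' \<in> {D \<in> \<Omega>. x \<in> D}" "T k D = T k D'"
      then show "D = D'" using T_inv[OF K_carrier[OF k]] OX by (metis (lifting) mem_Collect_eq)
    qed
    show "T k ` {D \<in> \<Omega>. x \<in> D} \<subseteq> {D \<in> \<Omega>. act k x \<in> D}" using perm[OF k] by auto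
    show "finite {D \<in> \<Omega>. act k x \<in> D}" using fin by simp
  qed
  obtain x0 where x0: "x0 \<in> S" using orbits_invariant[OF S] by blast
  \<comment> \<open>The constant will be \<open>N\<close> divided by the number of translates. It
    comes from counting points and involves no content, so the same constant serves for every
    \<open>m\<close>.\<close>
  define N where "N = card {D \<in> \<Omega>. x0 \<in> D}"
  have N: "card {D \<in> \<Omega>. x \<in> D} = N" if x: "x \<in> S" for x
  proof -
    obtain k k' where "k \<in> K" "act k x0 = x" "k' \<in> K" "act k' x = x0"
      using orbit_transitive[OF S] x x0 by metis
    then show ?thesis using le[of k x0] le[of k' x] by (simp add: N_def)
  qed
  have ne: "\<Omega> \<noteq> {}" using subgroup.one_closed[OF W] by (auto simp: \<Omega>_def)
  have "m (C \<inter> S \<inter> B) = (real N / real (card \<Omega>)) * m (C \<inter> S)"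
    if m: "content m" and inv: "W_invariant m"
      and C: "basic C" "invariant W C" for m C
  proof -
    have bCS: "basic (C \<inter> S)" using basic_Int C basic_orbit[OF S] by blast
    have same: "m (C \<inter> S \<inter> D) = m (C \<inter> S \<inter> B)" if D: "D \<in> \<Omega>" for D
    proof -
      obtain w where w: "w \<in> W" "D = T w B" using D by (auto simp: \<Omega>_def)
      have wc: "w \<in> carrier GR" using w W_carrier by blast
      have SX: "S \<subseteq> X" and CX: "C \<subseteq> X" and CSX: "C \<inter> S \<subseteq> X"
        using orbits_invariant[OF S] basic_X C by auto
      have "T w C = C" using invariantD[OF W C(2) CX w(1)] .
      moreover have "T w S = S"
        using invariantD[OF K _ SX] orbits_invariant[OF S] w WK by blast
      ultimately have "T w (C \<inter> S \<inter> B) = C \<inter> S \<inter> D"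
        using T_Int[OF wc CSX BX] T_Int[OF wc CX SX] w(2) by simp
      then show ?thesis using inv w(1) basic_Int[OF bCS B(1)] by metis
    qed
    have "real (card \<Omega>) * m (C \<inter> S \<inter> B) = (\<Sum>D\<in>\<Omega>. m (C \<inter> S \<inter> D))" using same by simp
    also have "\<dots> = real N * m (C \<inter> S)" using content_double_count[OF m bCS fin bO] N by simp
    finally show ?thesis using ne fin by (simp add: field_simps)
  qed
  then show ?thesis by blast
qed

lemma pow_carrier: "a [^] (k::nat) \<in> carrier GR" using aG by simp

section \<open>Mixing of the chain of orbits\<close>

context
  fixes \<mu> :: "'x set \<Rightarrow> real"
  assumes mu: "content \<mu>" and mu_inv: "\<And>g B. g \<in> carrier GR \<Longrightarrow> basic B \<Longrightarrow> \<mu> (T g B) = \<mu> B"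
    and mu_pos: "\<And>B. basic B \<Longrightarrow> B \<noteq> {} \<Longrightarrow> 0 < \<mu> B"
begin

text \<open>\<open>R n\<close> is the set reached from the orbit \<open>S\<close> in \<open>n\<close> steps of the Markov chain on \<open>K\<close>-orbits.
  Its measure is nondecreasing and takes finitely many values, so eventually \<open>R (Suc n) = a R n\<close>;
  the finitely many sets \<open>a^i R\<close> are then permuted by \<open>G\<close> with \<open>K\<close> in the kernel.\<close>

lemma eventually_reaches:
  assumes S: "S \<in> orbits"
  shows "\<exists>k1. \<forall>k\<ge>k1. \<forall>S'\<in>orbits. T (a [^] (k::nat)) S \<inter> S' \<noteq> {}"
proof -
  have SX: "S \<subseteq> X" using orbits_invariant[OF S] by blast
  define R where "R k = (\<Union>\<kappa>\<in>K. T \<kappa> (T (a [^] (k::nat)) S))" for k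
  have RX: "R k \<subseteq> X" for k unfolding R_def using SX T_X pow_carrier K_carrier by (meson UN_least)
  have RK: "invariant K (R k)" for k
    unfolding invariant_def
  proof
    fix g assume g: "g \<in> K"
    have "T g (T \<kappa> (T (a [^] k) S)) \<subseteq> R k" if "\<kappa> \<in> K" for \<kappa>
      using T_mult[of g \<kappa> "T (a [^] k) S"] g that K_carrier T_X[OF pow_carrier SX] subgroup.m_closed[OF K g that]
      unfolding R_def by blast
    then have "(\<Union>\<kappa>\<in>K. T g (T \<kappa> (T (a [^] k) S))) \<subseteq> R k" by (rule UN_least)
    moreover have "T g (R k) = (\<Union>\<kappa>\<in>K. T g (T \<kappa> (T (a [^] k) S)))" by (simp only: R_def image_UN)
    ultimately show "T g (R k) \<subseteq> R k" by (simp only:)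
  qed
  have bR: "basic (R k)" for k using basic_K RX RK by blast
  \<comment> \<open>For \<open>\<kappa> = u w\<close>, the factor \<open>w\<close> is absorbed by
    \<open>S\<close>, as \<open>a^-k w a^k\<close> lies in \<open>K\<close>, and
    \<open>a u a^-1\<close> is again in \<open>K\<close>. So \<open>a \<kappa> a^k S\<close> is a
    \<open>K\<close>-translate of \<open>a^(k+1) S\<close>.\<close>
  have step: "T a (R k) \<subseteq> R (Suc k)" for k
  proof -
    have "T a (T \<kappa> (T (a [^] k) S)) \<subseteq> R (Suc k)" if k: "\<kappa> \<in> K" for \<kappa>
    proof -
      obtain u w where uw: "u \<in> U" "w \<in> W" "\<kappa> = u \<otimes> w" using K_UW k by blast
      have c: "u \<in> carrier GR" "w \<in> carrier GR" using uw U_carrier W_carrier by blast+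
      note p = pow_carrier[of k]
      let ?x = "a \<otimes> u \<otimes> inv a" and ?y = "inv (a [^] k) \<otimes> w \<otimes> a [^] k"
      have xy: "?x \<in> K" "?y \<in> K" using U_conj W_conj uw by blast+
      have "T ?y S = S" using invariantD[OF K _ SX xy(2)] orbits_invariant[OF S] by blast
      then have "T ?x (T (a [^] Suc k) S) = T ?x (T (a [^] Suc k) (T ?y S))" by simp
      also have "\<dots> = T (?x \<otimes> (a [^] Suc k \<otimes> ?y)) S"
        using T_mult SX T_X c aG p by (simp del: nat_pow_Suc)
      also have "?x \<otimes> (a [^] Suc k \<otimes> ?y) = a \<otimes> (u \<otimes> w \<otimes> a [^] k)"
      proof -
        have "a [^] Suc k \<otimes> ?y = a \<otimes> (w \<otimes> a [^] k)"
          unfolding nat_pow_Suc2[OF aG] using aG p c by (simp add: m_assoc inv_cancel)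
        then show ?thesis using aG c p by (simp add: m_assoc inv_cancel)
      qed
      also have "T (a \<otimes> (u \<otimes> w \<otimes> a [^] k)) S = T a (T \<kappa> (T (a [^] k) S))"
        using T_mult SX T_X c aG p uw(3) by simp
      finally have e: "T ?x (T (a [^] Suc k) S) = T a (T \<kappa> (T (a [^] k) S))" .
      show ?thesis unfolding R_def e[symmetric] by (rule UN_upper[OF xy(1)])
    qed
    then have "(\<Union>\<kappa>\<in>K. T a (T \<kappa> (T (a [^] k) S))) \<subseteq> R (Suc k)" by (rule UN_least)
    moreover have "T a (R k) = (\<Union>\<kappa>\<in>K. T a (T \<kappa> (T (a [^] k) S)))" by (simp only: R_def image_UN)
    ultimately show ?thesis by (simp only:)
  qed
  have finR: "finite (range R)" by (rule finite_subset[OF _ finite_K_invariant]) (use RX RK in auto)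
  have mono: "\<mu> (R (Suc k)) = \<mu> (R k) + \<mu> (R (Suc k) - T a (R k))" for k
    using content_mono[OF mu basic_T[OF aG bR] bR step] mu_inv[OF aG bR] by simp
  have nn: "0 \<le> \<mu> B" if "basic B" for B using mu that by (auto simp: content_def)
  have mono': "\<mu> (R k) \<le> \<mu> (R (k + j))" for k j
  proof (induction j)
    case (Suc j)
    have "\<mu> (R (k + j)) \<le> \<mu> (R (Suc (k + j)))"
      using mono[of "k + j"] nn[OF basic_Diff[OF bR basic_T[OF aG bR]], of "Suc (k+j)" "k+j"] by linarith
    then show ?case using Suc by simp
  qed simp
  define Mx where "Mx = Max (\<mu> ` range R)"
  have "Mx \<in> \<mu> ` range R" unfolding Mx_def using finR by (intro Max_in) auto
  then obtain k1 where k1: "\<mu> (R k1) = Mx" by auto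
  have "\<mu> (R k) \<le> Mx" for k unfolding Mx_def using finR by (intro Max_ge) auto
  then have const: "\<mu> (R k) = Mx" if "k1 \<le> k" for k
    using mono'[of k1 "k - k1"] that k1 by (simp add: antisym)
  have eqR: "R (Suc k) = T a (R k)" if "k1 \<le> k" for k
  proof (rule ccontr)
    assume "R (Suc k) \<noteq> T a (R k)"
    then have "R (Suc k) - T a (R k) \<noteq> {}" using step by blast
    then have "0 < \<mu> (R (Suc k) - T a (R k))" using mu_pos basic_Diff[OF bR basic_T[OF aG bR]] by blast
    then show False using mono[of k] const[of k] const[of "Suc k"] that by simp
  qed
  define Q where "Q = R k1"
  have QX: "Q \<subseteq> X" using RX by (simp add: Q_def)
  have RQ: "R (k1 + i) = T (a [^] i) Q" for i
  proof (induction i)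
    case 0 then show ?case using T_one[OF QX] by (simp add: Q_def)
  next
    case (Suc i)
    then show ?case using eqR[of "k1 + i"] T_mult[OF aG pow_carrier QX, of i] nat_pow_Suc2[OF aG, of i] by simp
  qed
  have KQ: "invariant K (T (a [^] i) Q)" for i :: nat using RK[of "k1 + i"] RQ by simp
  have "\<not> inj (\<lambda>i. R (k1 + i))"
  proof
    assume "inj (\<lambda>i. R (k1 + i))"
    moreover have "finite (range (\<lambda>i. R (k1 + i)))" by (rule finite_subset[OF _ finR]) auto
    ultimately show False using finite_imageD infinite_UNIV_nat by blast
  qed
  \<comment> \<open>Two of the finitely many values coincide, which makes \<open>a^i Q\<close>
    periodic in \<open>i\<close>, with period \<open>Suc p\<close>.\<close>
  then obtain i j where ij: "i < j" "R (k1 + i) = R (k1 + j)"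
    unfolding inj_def by (metis linorder_neqE_nat)
  obtain p where p: "j = i + Suc p" using ij(1) less_imp_Suc_add by auto
  have "T (a [^] i) (T (a [^] Suc p) Q) = T (a [^] (i + Suc p)) Q"
    using T_mult[OF pow_carrier pow_carrier QX, of i "Suc p"] nat_pow_mult[OF aG, of i "Suc p"] by argo
  also have "\<dots> = T (a [^] i) Q" using ij(2) RQ[of i] RQ[of j] p by argo
  finally have "T (a [^] i) (T (a [^] Suc p) Q) = T (a [^] i) Q" .
  then have per: "T (a [^] Suc p) Q = Q"
    using T_inv[OF pow_carrier T_X[OF pow_carrier QX], of i "Suc p"] T_inv[OF pow_carrier QX, of i] by metis
  define \<R> where "\<R> = range (\<lambda>i::nat. T (a [^] i) Q)"
  have RRX: "D \<subseteq> X" if "D \<in> \<R>" for D using that T_X[OF pow_carrier QX] by (auto simp: \<R>_def)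
  have RRK: "T k D = D" if kD: "k \<in> K" "D \<in> \<R>" for k D
  proof -
    obtain i :: nat where i: "D = T (a [^] i) Q" using kD(2) unfolding \<R>_def by (rule rangeE)
    show ?thesis unfolding i by (rule invariantD[OF K KQ T_X[OF pow_carrier QX] kD(1)])
  qed
  have RRa: "T a D \<in> \<R>" if D: "D \<in> \<R>" for D
  proof -
    obtain i :: nat where "D = T (a [^] i) Q" using D unfolding \<R>_def by (rule rangeE)
    then have "T a D = T (a [^] Suc i) Q"
      using T_mult[OF aG pow_carrier QX, of i] nat_pow_Suc2[OF aG, of i] by simp
    then show ?thesis unfolding \<R>_def by (rule range_eqI)
  qed
  \<comment> \<open>The family is indexed by nonnegative powers only; the period supplies the
    inverse translate of \<open>Q\<close> itself, as \<open>a^p Q\<close>.\<close>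
  have RRa': "T (inv a) D \<in> \<R>" if D: "D \<in> \<R>" for D
  proof -
    obtain i :: nat where i: "D = T (a [^] i) Q" using D unfolding \<R>_def by (rule rangeE)
    have bk: "T (inv a) (T (a [^] Suc i) Q) = T (a [^] i) Q" for i
      using T_mult[OF aG pow_carrier QX, of i] nat_pow_Suc2[OF aG, of i] T_inv[OF aG T_X[OF pow_carrier QX]] by simp
    show ?thesis
    proof (cases i)
      case 0
      then have "D = T (a [^] Suc p) Q" using per i T_one[OF QX] by simp
      then have "T (inv a) D = T (a [^] p) Q" using bk[of p] by argo
      then show ?thesis unfolding \<R>_def by (rule range_eqI)
    next
      case (Suc j)
      then have "T (inv a) D = T (a [^] j) Q" using bk[of j] i by argo
      then show ?thesis unfolding \<R>_def by (rule range_eqI)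
    qed
  qed
  let ?M = "{g \<in> carrier GR. \<forall>D\<in>\<R>. T g D \<in> \<R> \<and> T (inv g) D \<in> \<R>}"
  have "?M = carrier GR"
  proof (rule generates)
    show "subgroup ?M GR"
    proof (rule subgroupI)
      have "\<one> \<in> ?M" using T_one RRX by auto
      then show "?M \<noteq> {}" by blast
      show "g \<otimes> h \<in> ?M" if "g \<in> ?M" "h \<in> ?M" for g h
        using that T_mult RRX by (auto simp: inv_mult_group)
    qed auto
    show "K \<subseteq> ?M"
      using K_carrier RRK subgroup.m_inv_closed[OF K] by auto
    show "a \<in> ?M" using aG RRa RRa' by blast
  qed
  then have GRR: "T g D \<in> \<R>" if "g \<in> carrier GR" "D \<in> \<R>" for g D using that by blast
  let ?S = "{g \<in> carrier GR. \<forall>D\<in>\<R>. T g D = D}"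
  have "?S = carrier GR"
  proof (rule normally_generates)
    show "subgroup ?S GR"
    proof (rule subgroupI)
      have "\<one> \<in> ?S" using T_one RRX by auto
      then show "?S \<noteq> {}" by blast
      show "g \<otimes> h \<in> ?S" if gh: "g \<in> ?S" "h \<in> ?S" for g h
      proof -
        have "T (g \<otimes> h) D = D" if D: "D \<in> \<R>" for D
          using T_mult[OF _ _ RRX[OF D], of g h] gh D by simp
        then show ?thesis using gh by simp
      qed
      show "inv g \<in> ?S" if g: "g \<in> ?S" for g
      proof -
        have "T (inv g) D = D" if D: "D \<in> \<R>" for D
        proof -
          have "T g D = D" using g D by blast
          then show ?thesis using T_inv[OF _ RRX[OF D], of g] g by simp
        qed
        then show ?thesis using g by simp
      qed
    qed auto
    show "K \<subseteq> ?S" using K_carrier RRK by blast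
    show "g \<otimes> s \<otimes> inv g \<in> ?S" if g: "g \<in> carrier GR" and s: "s \<in> ?S" for g s
    proof -
      have "T (g \<otimes> s \<otimes> inv g) D = D" if D: "D \<in> \<R>" for D
      proof -
        have D': "T (inv g) D \<in> \<R>" using GRR g D by simp
        have sc: "s \<in> carrier GR" using s by blast
        have "T (g \<otimes> s \<otimes> inv g) D = T (g \<otimes> s) (T (inv g) D)"
          by (rule T_mult) (use g sc RRX[OF D] in auto)
        also have "\<dots> = T g (T s (T (inv g) D))" by (rule T_mult[OF g sc RRX[OF D']])
        also have "T s (T (inv g) D) = T (inv g) D" using s D' by blast
        also have "T g (T (inv g) D) = D" by (rule T_inv'[OF g RRX[OF D]])
        finally show ?thesis .
      qed
      then show ?thesis using g s by simp
    qed
  qed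
  then have GQ: "T g Q = Q" if "g \<in> carrier GR" for g
  proof -
    have "Q \<in> \<R>" unfolding \<R>_def by (rule range_eqI[of _ _ 0]) (simp add: T_one[OF QX])
    then show ?thesis using that \<open>?S = carrier GR\<close> by blast
  qed
  have SR: "T (a [^] k) S \<subseteq> R k" for k
  proof -
    have "T \<one> (T (a [^] k) S) \<subseteq> R k" unfolding R_def by (rule UN_upper[OF subgroup.one_closed[OF K]])
    then show ?thesis using T_one[OF T_X[OF pow_carrier SX]] by simp
  qed
  obtain x where x: "x \<in> Q" using SR[of k1] orbits_invariant[OF S] unfolding Q_def by blast
  have "Q = X"
  proof (rule equalityI[OF QX subsetI])
    fix y assume "y \<in> X"
    then obtain g where "g \<in> carrier GR" "act g x = y" using act_transitive x QX by blast
    then show "y \<in> Q" using GQ x by blast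
  qed
  \<comment> \<open>\<open>R k\<close> is the \<open>K\<close>-saturation of \<open>a^k S\<close>.
    As it is all of \<open>X\<close>, each \<open>K\<close>-invariant nonempty set already meets
    \<open>a^k S\<close>.\<close>
  have "T (a [^] k) S \<inter> S' \<noteq> {}" if k: "k1 \<le> k" and S': "S' \<in> orbits" for k S'
  proof -
    have "R k = X" using RQ[of "k - k1"] GQ[OF pow_carrier] \<open>Q = X\<close> k by simp
    moreover obtain y where y: "y \<in> S'" using orbits_invariant[OF S'] by blast
    ultimately have "y \<in> R k" using orbits_invariant[OF S'] by blast
    then obtain \<kappa> where \<kappa>: "\<kappa> \<in> K" "y \<in> T \<kappa> (T (a [^] k) S)" unfolding R_def by (rule UN_E)
    from \<kappa>(2) obtain z where z': "y = act \<kappa> z" "z \<in> T (a [^] k) S" by (rule imageE)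
    note z = \<kappa>(1) z'(2,1)
    have zX: "z \<in> X" using z T_X[OF pow_carrier SX] by blast
    have "z = act (inv \<kappa>) y" using z act_inv K_carrier zX by simp
    then have "z \<in> S'"
      using orbits_invariant[OF S'] y subgroup.m_inv_closed[OF K z(1)] unfolding invariant_def by blast
    then show ?thesis using z by blast
  qed
  then show ?thesis by blast
qed

lemma primitive: "\<exists>k. \<forall>S\<in>orbits. \<forall>S'\<in>orbits. T (a [^] (k::nat)) S \<inter> S' \<noteq> {}"
proof -
  have "\<forall>S\<in>orbits. eventually (\<lambda>k. \<forall>S'\<in>orbits. T (a [^] (k::nat)) S \<inter> S' \<noteq> {}) sequentially"
    unfolding eventually_sequentially by (intro ballI eventually_reaches)
  then have "eventually (\<lambda>k. \<forall>S\<in>orbits. \<forall>S'\<in>orbits. T (a [^] (k::nat)) S \<inter> S' \<noteq> {}) sequentially"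
    by (rule eventually_ball_finite[OF finite_orbits'])
  then obtain k where k: "\<forall>n\<ge>k. \<forall>S\<in>orbits. \<forall>S'\<in>orbits. T (a [^] (n::nat)) S \<inter> S' \<noteq> {}"
    unfolding eventually_sequentially by (rule exE)
  show ?thesis by (rule exI[of _ k]) (rule k[THEN spec, THEN mp, OF order_refl])
qed

text \<open>\<open>q k S\<close> is the proportion of \<open>a^-k A\<close> in the orbit
  \<open>S\<close>. Both \<open>\<mu> A\<close> and \<open>\<nu> A\<close> are averages of
  \<open>q k\<close> over the orbits, though with different weights, so they differ by at most the
  oscillation of \<open>q k\<close>. The recursion \<open>rec\<close> expresses
  \<open>q (r + k)\<close> by averages of \<open>q k\<close> with strictly positive coefficients and
  thereby drives this oscillation to zero.\<close>

theorem content_unique: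
  assumes mu1: "\<mu> X = 1" and nu: "content \<nu>" and nu1: "\<nu> X = 1"
    and nu_inv: "\<And>k w B. w \<in> W \<Longrightarrow> basic B \<Longrightarrow>
      \<nu> (T (a [^] (k::nat) \<otimes> w \<otimes> inv (a [^] k)) B) = \<nu> B"
    and A: "basic A"
  shows "\<nu> A = \<mu> A"
proof -
  have AX: "A \<subseteq> X" using A basic_X by blast
  obtain L where L: "L \<in> \<L>" "invariant L A" using A by (auto simp: basic_def)
  obtain k0 where k0: "\<And>k u. k0 \<le> k \<Longrightarrow> u \<in> U \<Longrightarrow> a [^] (k::nat) \<otimes> u \<otimes> inv (a [^] k) \<in> L"
    using L_contract[OF L(1)] by blast
  define B where "B k = T (inv (a [^] (k::nat))) A" for k
  have bB: "basic (B k)" for k using basic_T A pow_carrier by (simp add: B_def)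
  have BX: "B k \<subseteq> X" for k using bB basic_X by blast
  have BU: "invariant U (B k)" if k: "k0 \<le> k" for k
    unfolding invariant_def
  proof
    fix u assume u: "u \<in> U"
    have uc: "u \<in> carrier GR" using u U_carrier by blast
    note p = pow_carrier[of k]
    have "T (a [^] k \<otimes> u \<otimes> inv (a [^] k)) A = A"
      using invariantD[OF L_sub[OF L(1)] L(2) AX k0[OF k u]] .
    then have "B k = T (inv (a [^] k)) (T (a [^] k \<otimes> u \<otimes> inv (a [^] k)) A)" by (simp add: B_def)
    also have "\<dots> = T (inv (a [^] k) \<otimes> (a [^] k \<otimes> u \<otimes> inv (a [^] k))) A" using T_mult AX p uc by simp
    also have "inv (a [^] k) \<otimes> (a [^] k \<otimes> u \<otimes> inv (a [^] k)) = u \<otimes> inv (a [^] k)"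
      using p uc by (simp add: m_assoc inv_cancel)
    also have "T (u \<otimes> inv (a [^] k)) A = T u (B k)" using T_mult AX p uc by (simp add: B_def)
    finally show "T u (B k) \<subseteq> B k" by simp
  qed
  have mup: "0 < \<mu> S" if "S \<in> orbits" for S using mu_pos basic_orbit orbits_invariant that by blast
  have muW: "W_invariant \<mu>" using mu_inv W_carrier by blast
  define q where "q k S = \<mu> (S \<inter> B k) / \<mu> S" for k S
  have WX: "invariant W X" using T_X W_carrier by (auto simp: invariant_def)
  have Q: "m (C \<inter> S \<inter> B k) = q k S * m (C \<inter> S)"
    if h: "k0 \<le> k" "S \<in> orbits" "content m" "W_invariant m" "basic C" "invariant W C"
    for k S m C
  proof -
    obtain c where c: "\<And>m C. content m \<Longrightarrow> W_invariant m \<Longrightarrow>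
      basic C \<Longrightarrow> invariant W C \<Longrightarrow> m (C \<inter> S \<inter> B k) = c * m (C \<inter> S)"
      using independence[OF bB BU[OF h(1)] h(2)] by blast
    have "X \<inter> S = S" using orbits_invariant[OF h(2)] by blast
    then have "\<mu> (S \<inter> B k) = c * \<mu> S" using c[OF mu muW basic_space WX] by simp
    then have "c = q k S" using mup[OF h(2)] by (simp add: q_def)
    then show ?thesis using c[OF h(3-6)] by simp
  qed
  obtain r where r: "\<And>S S'. S \<in> orbits \<Longrightarrow> S' \<in> orbits \<Longrightarrow> T (a [^] (r::nat)) S \<inter> S' \<noteq> {}"
    using primitive by blast
  define p where "p S S' = \<mu> (T (a [^] r) S \<inter> S') / \<mu> S" for S S'
  have bTS: "basic (T (a [^] r) S)" if "S \<in> orbits" for S using basic_T pow_carrier basic_orbit that by blast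
  have p_sum: "(\<Sum>S'\<in>orbits. p S S') = 1" if S: "S \<in> orbits" for S
    using content_orbits[OF mu bTS[OF S]] mu_inv[OF pow_carrier basic_orbit[OF S]] mup[OF S]
    by (simp add: p_def sum_divide_distrib[symmetric])
  have p_pos: "0 < p S S'" if "S \<in> orbits" "S' \<in> orbits" for S S'
    unfolding p_def using mu_pos[OF basic_Int[OF bTS basic_orbit] r] that mup by simp
  \<comment> \<open>\<open>a^r\<close> maps the part of \<open>a^-(r+k) A\<close> in
    \<open>S\<close> onto the part of \<open>a^-k A\<close> in \<open>a^r S\<close>, without
    changing \<open>\<mu>\<close>. Cutting \<open>a^r S\<close> by the orbits \<open>S'\<close>,
    independence replaces the proportion in each piece by that in the whole of \<open>S'\<close>; it
    applies because \<open>a^r S\<close> is \<open>W\<close>-invariant.\<close>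
  have rec: "q (r + k) S = (\<Sum>S'\<in>orbits. p S S' * q k S')" if k: "k0 \<le> k" and S: "S \<in> orbits" for k S
  proof -
    let ?C = "T (a [^] r) S"
    have SX: "S \<subseteq> X" using orbits_invariant[OF S] by blast
    have "invariant W ?C"
      unfolding invariant_def
    proof
      fix w assume w: "w \<in> W"
      have wc: "w \<in> carrier GR" using w W_carrier by blast
      note pc = pow_carrier[of r]
      let ?y = "inv (a [^] r) \<otimes> w \<otimes> a [^] r"
      have "T ?y S = S" using invariantD[OF K _ SX W_conj[OF w]] orbits_invariant[OF S] by blast
      then have "?C = T (a [^] r) (T ?y S)" by simp
      also have "\<dots> = T (a [^] r \<otimes> ?y) S" using T_mult SX pc wc by simp
      also have "a [^] r \<otimes> ?y = w \<otimes> a [^] r"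
        using pc wc by (simp add: m_assoc inv_cancel)
      also have "T (w \<otimes> a [^] r) S = T w ?C" using T_mult SX pc wc by simp
      finally show "T w ?C \<subseteq> ?C" by simp
    qed
    note Qk = Q[OF k _ mu muW bTS[OF S] this]
    have "T (a [^] r) (S \<inter> B (r + k)) = ?C \<inter> B k"
    proof -
      have "T (a [^] r) (B (r + k)) = T (a [^] r \<otimes> inv (a [^] (r + k))) A"
        using T_mult[OF pow_carrier _ AX] pow_carrier by (simp add: B_def)
      also have "a [^] r \<otimes> inv (a [^] (r + k)) = inv (a [^] k)"
      proof -
        have "a [^] (r + k) = a [^] k \<otimes> a [^] r" using nat_pow_mult[OF aG, of k r] by (simp add: add.commute)
        then have "inv (a [^] (r + k)) = inv (a [^] r) \<otimes> inv (a [^] k)"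
          using inv_mult_group pow_carrier by simp
        then show ?thesis using pow_carrier by (simp add: inv_cancel)
      qed
      finally show ?thesis using T_Int[OF pow_carrier SX BX] by (simp add: B_def)
    qed
    then have "\<mu> (S \<inter> B (r + k)) = \<mu> (?C \<inter> B k)"
      using mu_inv[OF pow_carrier basic_Int[OF basic_orbit[OF S] bB], of r "r + k"] by simp
    also have "\<dots> = (\<Sum>S'\<in>orbits. \<mu> (?C \<inter> B k \<inter> S'))"
      by (rule content_orbits[OF mu basic_Int[OF bTS[OF S] bB]])
    also have "\<dots> = (\<Sum>S'\<in>orbits. q k S' * \<mu> (?C \<inter> S'))"
      using Qk by (intro sum.cong) (auto simp: Int_assoc Int_commute Int_left_commute)
    finally show ?thesis
      by (simp add: q_def[of "r + k"] p_def sum_divide_distrib mult.commute)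
  qed
  have ne: "orbits \<noteq> {}"
  proof
    assume "orbits = {}"
    then have "X = {}" using Union_orbits by simp
    then show False using mu1 content_empty[OF mu] by simp
  qed
  \<comment> \<open>The least transition probability, positive because there are finitely many
    orbits and all of them communicate in \<open>r\<close> steps.\<close>
  define \<delta> where "\<delta> = Min ((\<lambda>(S, S'). p S S') ` (orbits \<times> orbits))"
  have fpo: "finite ((\<lambda>(S, S'). p S S') ` (orbits \<times> orbits))" using finite_orbits' by simp
  have d_pos: "0 < \<delta>"
    unfolding \<delta>_def using fpo ne p_pos by (subst Min_gr_iff) auto
  have d_le: "\<delta> \<le> p S S'" if "S \<in> orbits" "S' \<in> orbits" for S S'
    unfolding \<delta>_def using fpo that by (intro Min_le) auto
  have d1: "\<delta> \<le> 1"
  proof -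
    obtain S where S: "S \<in> orbits" using ne by blast
    have "p S S \<le> (\<Sum>S'\<in>orbits. p S S')"
      using p_pos[OF S] finite_orbits' S by (intro member_le_sum) (auto intro: less_imp_le)
    then show ?thesis using p_sum[OF S] d_le[OF S S] by simp
  qed
  \<comment> \<open>Doeblin contraction: every block of \<open>r\<close> steps shrinks the
    oscillation by the factor \<open>1 - \<delta>\<close>. Starting at \<open>k0\<close> ensures
    that each \<open>B k\<close> used is \<open>U\<close>-invariant.\<close>
  have osc: "\<exists>c. \<forall>S\<in>orbits. c \<le> q (k0 + j * r) S \<and> q (k0 + j * r) S \<le> c + (1 - \<delta>) ^ j" for j
  proof (induction j)
    case 0
    have "0 \<le> q k0 S \<and> q k0 S \<le> 1" if S: "S \<in> orbits" for S
    proof -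
      have "\<mu> S = \<mu> (S \<inter> B k0) + \<mu> (S - S \<inter> B k0)"
        using content_mono[OF mu basic_Int[OF basic_orbit[OF S] bB] basic_orbit[OF S]] by simp
      moreover have "0 \<le> \<mu> (S - S \<inter> B k0)" "0 \<le> \<mu> (S \<inter> B k0)"
        by (intro content_nonneg[OF mu] basic_Diff basic_Int basic_orbit[OF S] bB)+
      ultimately show ?thesis using mup[OF S] by (simp add: q_def)
    qed
    then show ?case by (intro exI[of _ 0]) simp
  next
    case (Suc j)
    let ?k = "k0 + j * r"
    obtain c where c: "\<And>S. S \<in> orbits \<Longrightarrow> c \<le> q ?k S \<and> q ?k S \<le> c + (1 - \<delta>) ^ j" using Suc by blast
    define mn where "mn = Min (q ?k ` orbits)"
    have mn_le: "mn \<le> q ?k S" if "S \<in> orbits" for S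
      unfolding mn_def using finite_orbits' that by (intro Min_le) auto
    have "mn \<in> q ?k ` orbits" unfolding mn_def using finite_orbits' ne by (intro Min_in) auto
    \<comment> \<open>Every row gives weight at least \<open>\<delta>\<close> to the orbit where the
      minimum is attained. This lowers the common upper bound from \<open>mn + ?e\<close> to
      \<open>mn + (1 - \<delta>) * ?e\<close>, while the lower bound stays.\<close>
    then obtain S1 where S1: "S1 \<in> orbits" "q ?k S1 = mn" by auto
    let ?e = "(1 - \<delta>) ^ j"
    have up: "q ?k S \<le> mn + ?e" if "S \<in> orbits" for S using c[OF that] c[OF S1(1)] S1(2) by linarith
    have e0: "0 \<le> ?e" using d1 by simp
    have "mn \<le> q (r + ?k) S \<and> q (r + ?k) S \<le> mn + (1 - \<delta>) * ?e" if S: "S \<in> orbits" for S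
    proof
      have rs: "q (r + ?k) S = (\<Sum>S'\<in>orbits. p S S' * q ?k S')" using rec[OF _ S] by simp
      have "mn = (\<Sum>S'\<in>orbits. p S S' * mn)" using p_sum[OF S] by (simp add: sum_distrib_right[symmetric])
      also have "\<dots> \<le> (\<Sum>S'\<in>orbits. p S S' * q ?k S')"
        using p_pos[OF S] mn_le by (intro sum_mono mult_left_mono) (auto intro: less_imp_le)
      finally show "mn \<le> q (r + ?k) S" using rs by simp
      have "(\<Sum>S'\<in>orbits. p S S' * q ?k S') \<le> (\<Sum>S'\<in>orbits. p S S' * (mn + (if S' = S1 then 0 else ?e)))"
        using p_pos[OF S] up S1 by (intro sum_mono mult_left_mono) (auto intro: less_imp_le)
      also have "\<dots> = (\<Sum>S'\<in>orbits. p S S' * (mn + ?e) - (if S' = S1 then p S S' * ?e else 0))"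
        by (intro sum.cong) (auto simp: algebra_simps)
      also have "\<dots> = mn + ?e - p S S1 * ?e"
        using p_sum[OF S] finite_orbits' S1(1)
        by (simp add: sum_subtractf sum_distrib_right[symmetric] sum.delta)
      also have "\<dots> \<le> mn + (1 - \<delta>) * ?e"
        using mult_right_mono[OF d_le[OF S S1(1)] e0] by (simp add: algebra_simps)
      finally show "q (r + ?k) S \<le> mn + (1 - \<delta>) * ?e" using rs by simp
    qed
    moreover have "k0 + Suc j * r = r + ?k" by simp
    ultimately show ?case by (metis power_Suc)
  qed
  \<comment> \<open>By independence \<open>m (B k)\<close> is the mean of the proportions
    \<open>q k S\<close> with weights \<open>m S\<close>, which sum to one.\<close>
  have avg: "c \<le> m X' \<and> m X' \<le> c + e"
    if "content m" "m X = 1" "W_invariant m" "k0 \<le> k" "X' = B k"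
      "\<forall>S\<in>orbits. c \<le> q k S \<and> q k S \<le> c + e" for m X' k c e
  proof -
    have "m (B k) = (\<Sum>S\<in>orbits. m (B k \<inter> S))" by (rule content_orbits[OF that(1) bB])
    also have "\<dots> = (\<Sum>S\<in>orbits. m S * q k S)"
    proof (rule sum.cong[OF refl])
      fix S assume S: "S \<in> orbits"
      have "X \<inter> S = S" using orbits_invariant[OF S] by blast
      then show "m (B k \<inter> S) = m S * q k S"
        using Q[OF that(4) S that(1,3) basic_space WX] by (simp add: Int_commute)
    qed
    finally have eq: "m X' = (\<Sum>S\<in>orbits. m S * q k S)" using that by simp
    have one: "(\<Sum>S\<in>orbits. m S) = 1"
    proof -
      have "X \<inter> S = S" if "S \<in> orbits" for S using orbits_invariant[OF that] by blast
      then show ?thesis using content_orbits[OF that(1) basic_space] that(2) by simp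
    qed
    have pos: "0 \<le> m S" if "S \<in> orbits" for S using \<open>content m\<close> basic_orbit[OF that] by (auto simp: content_def)
    have "(\<Sum>S\<in>orbits. m S * c) \<le> m X'" "m X' \<le> (\<Sum>S\<in>orbits. m S * (c + e))"
      unfolding eq using pos that(6) by (auto intro!: sum_mono mult_left_mono)
    then show ?thesis using one by (simp add: sum_distrib_right[symmetric])
  qed
  have "\<bar>\<nu> A - \<mu> A\<bar> \<le> (1 - \<delta>) ^ j" for j
  proof -
    let ?k = "k0 + j * r"
    obtain c where c: "\<forall>S\<in>orbits. c \<le> q ?k S \<and> q ?k S \<le> c + (1 - \<delta>) ^ j" using osc by blast
    note pc = pow_carrier[of ?k]
    \<comment> \<open>This content is \<open>W\<close>-invariant because \<open>\<nu>\<close> is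
      invariant under \<open>a^k W a^-k\<close>, and its value on \<open>B ?k\<close> is
      \<open>\<nu> A\<close>. Thus \<open>avg\<close> applies to it although \<open>\<nu>\<close>
      need not be invariant under \<open>a\<close>.\<close>
    let ?m = "\<lambda>D. \<nu> (T (a [^] ?k) D)"
    have "content ?m"
      unfolding content_def
    proof (intro conjI allI impI)
      show "0 \<le> ?m D" if "basic D" for D by (rule content_nonneg[OF nu basic_T[OF pc that]])
      show "?m (D \<union> D') = ?m D + ?m D'" if "basic D" "basic D'" "D \<inter> D' = {}" for D D'
      proof -
        have "T (a [^] ?k) D \<inter> T (a [^] ?k) D' = {}"
          using T_Int[OF pc basic_X basic_X, OF that(1,2)] that(3) by simp
        then show ?thesis unfolding image_Un by (intro content_add[OF nu] basic_T[OF pc] that(1,2))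
      qed
    qed
    moreover have "?m X = 1"
    proof -
      have "T (a [^] ?k) X = X"
      proof
        show "T (a [^] ?k) X \<subseteq> X" using T_X[OF pc] by blast
        have "T (inv (a [^] ?k)) X \<subseteq> X" using T_X pc by blast
        then have "T (a [^] ?k) (T (inv (a [^] ?k)) X) \<subseteq> T (a [^] ?k) X" by blast
        then show "X \<subseteq> T (a [^] ?k) X" using T_inv'[OF pc subset_refl] by simp
      qed
      then show ?thesis using nu1 by simp
    qed
    moreover have mW: "?m (T w D) = ?m D" if w: "w \<in> W" and D: "basic D" for w D
    proof -
      have wc: "w \<in> carrier GR" using w W_carrier by blast
      have "T (a [^] ?k \<otimes> w \<otimes> inv (a [^] ?k)) (T (a [^] ?k) D) = T (a [^] ?k \<otimes> w) (T (inv (a [^] ?k)) (T (a [^] ?k) D))"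
        using T_mult pc wc T_X basic_X[OF D] by simp
      also have "\<dots> = T (a [^] ?k \<otimes> w) D" using T_inv[OF pc basic_X[OF D]] by simp
      also have "\<dots> = T (a [^] ?k) (T w D)" using T_mult[OF pc wc basic_X[OF D]] .
      finally show ?thesis using nu_inv[OF w basic_T[OF pc D], of ?k] by simp
    qed
    ultimately have "c \<le> ?m (B ?k) \<and> ?m (B ?k) \<le> c + (1 - \<delta>) ^ j"
      by (intro avg[of ?m, OF _ _ _ _ refl c] ballI allI impI mW) auto
    moreover have "?m (B ?k) = \<nu> A" using T_inv'[OF pc AX] by (simp add: B_def)
    moreover have "c \<le> \<mu> (B ?k) \<and> \<mu> (B ?k) \<le> c + (1 - \<delta>) ^ j" using avg[OF mu mu1 muW _ refl c] by simp
    moreover have "\<mu> (B ?k) = \<mu> A" using mu_inv[OF _ A] pc by (simp add: B_def)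
    ultimately show ?thesis by linarith
  qed
  moreover have "(\<lambda>j. (1 - \<delta>) ^ j) \<longlonglongrightarrow> 0" using d_pos d1 by (intro LIMSEQ_power_zero) simp
  ultimately have "\<bar>\<nu> A - \<mu> A\<bar> \<le> 0" using LIMSEQ_le_const by blast
  then show ?thesis by simp
qed

end

end

section \<open>Cocompact coset spaces\<close>

locale lattice_action = axis_action +
  fixes \<Gamma> :: "('a \<Rightarrow> 'a) set"
  assumes Gamma: "subgroup \<Gamma> GG"
    and cocompact: "compact_space (coset_topology GG GT \<Gamma>)"
begin

abbreviation X where "X \<equiv> lcosets\<^bsub>GG\<^esub> \<Gamma>"
abbreviation XT where "XT \<equiv> coset_topology GG GT \<Gamma>"
abbreviation act where "act \<equiv> (\<lambda>g C. g \<star> C)"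

section \<open>The action on cosets\<close>

lemma topspace_G: "topspace GT = G"
  unfolding topspace_subtopology topspace_tree_aut_topology using G_tree_auts by (rule Int_absorb1)

lemma topspace_XT: "topspace XT = X"
  by (rule topspace_coset_topology) (simp only: topspace_G carrier_GG)

lemma X_cases: "y \<in> X \<Longrightarrow> \<exists>g\<in>G. y = g \<star> \<Gamma>"
  by (auto simp: LCOSETS_def)

lemma coset_X: "g \<in> G \<Longrightarrow> g \<star> \<Gamma> \<in> X"
  by (auto simp: LCOSETS_def)

lemma Gamma_carrier: "\<Gamma> \<subseteq> carrier GG"
  by (rule subgroup.subset[OF Gamma])

lemma act_coset: "h \<in> G \<Longrightarrow> g \<in> G \<Longrightarrow> h \<star> (g \<star> \<Gamma>) = (h \<cdot> g) \<star> \<Gamma>"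
  using lcos_m_assoc[OF Gamma_carrier] by simp

lemma X_act: "h \<in> G \<Longrightarrow> y \<in> X \<Longrightarrow> h \<star> y \<in> X"
  using X_cases act_coset coset_X G_mult by metis

lemma X_mult: "h \<in> G \<Longrightarrow> g \<in> G \<Longrightarrow> y \<in> X \<Longrightarrow> (h \<cdot> g) \<star> y = h \<star> (g \<star> y)"
proof -
  assume *: "h \<in> G" "g \<in> G" "y \<in> X"
  then obtain f where f: "f \<in> G" "y = f \<star> \<Gamma>" using X_cases by blast
  show ?thesis unfolding f(2) using * f(1) G_mult by (simp add: act_coset m_assoc)
qed

lemma X_one: "y \<in> X \<Longrightarrow> \<one>\<^bsub>GG\<^esub> \<star> y = y"
  using X_cases act_coset[OF G_one] by fastforce

lemma openin_G:
  "openin GT S \<longleftrightarrow>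
    S \<subseteq> G \<and> (\<forall>g\<in>S. \<exists>F. finite F \<and> F \<subseteq> V \<and> (\<forall>h\<in>G. (\<forall>v\<in>F. h v = g v) \<longrightarrow> h \<in> S))"
  (is "?L \<longleftrightarrow> ?R")
proof
  let ?P = "product_topology (\<lambda>_. discrete_topology V) V"
  assume L: ?L
  then have "openin (subtopology (subtopology ?P (tree_auts V E)) G) S" by (simp add: tree_aut_topology_def)
  then obtain S' where S': "openin ?P S'" "S = S' \<inter> tree_auts V E \<inter> G"
    unfolding openin_subtopology by blast
  have nb: "\<exists>F. finite F \<and> F \<subseteq> V \<and> (\<forall>h\<in>G. (\<forall>v\<in>F. h v = g v) \<longrightarrow> h \<in> S)" if g: "g \<in> S" for g
  proof -
    obtain Y where Y: "finite {i \<in> V. Y i \<noteq> topspace (discrete_topology V)}" "g \<in> PiE V Y" "PiE V Y \<subseteq> S'"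
      using S' g unfolding openin_product_topology_alt by blast
    let ?F = "{i \<in> V. Y i \<noteq> V}"
    have "h \<in> S" if h: "h \<in> G" "\<forall>v\<in>?F. h v = g v" for h
    proof -
      have "h v \<in> Y v" if v: "v \<in> V" for v
      proof (cases "Y v = V")
        case True then show ?thesis using G_V[OF h(1) v] by simp
      next
        case False then show ?thesis using h(2) Y(2) v by (auto simp: PiE_def)
      qed
      then have "h \<in> PiE V Y" using G_Bij[OF h(1)] Bij_imp_extensional by (auto simp: PiE_def)
      then show ?thesis using Y(3) S'(2) h(1) G_tree_auts by blast
    qed
    moreover have "finite ?F" using Y(1) by simp
    ultimately show ?thesis by (intro exI[of _ ?F]) auto
  qed
  show ?R
  proof (rule conjI)
    show "S \<subseteq> G" unfolding S'(2) by (rule Int_lower2)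
  qed (rule ballI, rule nb)
next
  let ?P = "product_topology (\<lambda>_. discrete_topology V) V"
  assume R: ?R
  show ?L
  proof (rule openin_subopen[THEN iffD2], rule ballI)
    fix g assume g: "g \<in> S"
    obtain F where F: "finite F" "F \<subseteq> V" "\<forall>h\<in>G. (\<forall>v\<in>F. h v = g v) \<longrightarrow> h \<in> S"
      using bspec[OF conjunct2[OF R] g] by (elim exE conjE)
    have gG: "g \<in> G" using R g by blast
    have GP: "h \<in> V \<rightarrow>\<^sub>E V" if "h \<in> G" for h
      using G_Bij[OF that] Bij_imp_extensional G_V[OF that] by (auto simp: PiE_def)
    let ?T = "{h \<in> V \<rightarrow>\<^sub>E V. \<forall>v\<in>F. h v = g v}"
    have "openin ?P ?T" by (rule openin_agree[OF F(1,2) GP[OF gG]])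
    then have "openin GT (?T \<inter> tree_auts V E \<inter> G)"
      unfolding tree_aut_topology_def by (intro openin_subtopology_Int)
    moreover have "g \<in> ?T \<inter> tree_auts V E \<inter> G" using GP gG G_tree_auts by auto
    moreover have "?T \<inter> tree_auts V E \<inter> G \<subseteq> S" using F(3) by blast
    ultimately show "\<exists>T. openin GT T \<and> g \<in> T \<and> T \<subseteq> S" by blast
  qed
qed

text \<open>\<open>h\<close> agrees with \<open>g\<close> on \<open>F\<close> exactly when
  \<open>h g^-1\<close> fixes the image of \<open>F\<close> under \<open>g\<close>. This turns the
  neighbourhoods of a group element into left translates by fixators, which descend to
  cosets.\<close>

lemma openin_XT:
  "openin XT S \<longleftrightarrow> S \<subseteq> X \<and> (\<forall>y\<in>S. \<exists>F. finite F \<and> F \<subseteq> V \<and> (\<forall>k\<in>fixator G F. k \<star> y \<in> S))"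
  (is "_ \<longleftrightarrow> _ \<and> ?R")
proof -
  have im: "(\<lambda>g. g \<star> \<Gamma>) ` G = X" by (auto simp: LCOSETS_def)
  have "openin GT {g \<in> G. g \<star> \<Gamma> \<in> S} \<longleftrightarrow> ?R" if SX: "S \<subseteq> X"
  proof
    assume L: "openin GT {g \<in> G. g \<star> \<Gamma> \<in> S}"
    show ?R
    proof
      fix y assume y: "y \<in> S"
      then obtain g where g: "g \<in> G" "y = g \<star> \<Gamma>" using X_cases SX by blast
      have gm: "g \<in> {g \<in> G. g \<star> \<Gamma> \<in> S}" using g y by simp
      obtain F where F: "finite F" "F \<subseteq> V"
        "\<forall>h\<in>G. (\<forall>v\<in>F. h v = g v) \<longrightarrow> h \<in> {g \<in> G. g \<star> \<Gamma> \<in> S}"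
        using bspec[OF conjunct2[OF L[unfolded openin_G]] gm] by (elim exE conjE)
      have "k \<star> y \<in> S" if k: "k \<in> fixator G (g ` F)" for k
      proof -
        have kG: "k \<in> G" using k by (simp add: fixator_def)
        have "(k \<cdot> g) v = g v" if "v \<in> F" for v
          using mult_apply[OF kG g(1), of v] k that F(2) by (auto simp: fixator_def)
        then show ?thesis unfolding g(2) act_coset[OF kG g(1)] using bspec[OF F(3) G_mult[OF kG g(1)]] by simp
      qed
      moreover have "finite (g ` F)" "g ` F \<subseteq> V" using F G_V[OF g(1)] by auto
      ultimately show "\<exists>F. finite F \<and> F \<subseteq> V \<and> (\<forall>k\<in>fixator G F. k \<star> y \<in> S)"
        by (intro exI[of _ "g ` F"] conjI ballI)
    qed
  next
    assume R: ?R
    show "openin GT {g \<in> G. g \<star> \<Gamma> \<in> S}"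
      unfolding openin_G
    proof (intro conjI ballI)
      fix g assume "g \<in> {g \<in> G. g \<star> \<Gamma> \<in> S}"
      then have g: "g \<in> G" "g \<star> \<Gamma> \<in> S" by auto
      obtain F where F: "finite F" "F \<subseteq> V" "\<forall>k\<in>fixator G F. k \<star> (g \<star> \<Gamma>) \<in> S"
        using bspec[OF R g(2)] by (elim exE conjE)
      let ?i = "inv\<^sub>G g"
      have iG: "?i \<in> G" using G_inv g by blast
      have "h \<star> \<Gamma> \<in> S" if h: "h \<in> G" "\<forall>v\<in>?i ` F. h v = g v" for h
      proof -
        have hiG: "h \<cdot> ?i \<in> G" using G_mult h iG by blast
        have "(h \<cdot> ?i) v = v" if "v \<in> F" for v
          using mult_apply[OF h(1) iG, of v] apply_inv[OF g(1), of v] h(2) that F(2) by (auto simp: subset_iff)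
        then have "h \<cdot> ?i \<in> fixator G F" using hiG by (simp add: fixator_def)
        then have "(h \<cdot> ?i) \<star> (g \<star> \<Gamma>) \<in> S" by (rule bspec[OF F(3)])
        moreover have "h \<cdot> ?i \<cdot> g = h" using h(1) g(1) iG by (simp add: m_assoc)
        ultimately show ?thesis using act_coset[OF hiG g(1)] by simp
      qed
      moreover have "finite (?i ` F)" "?i ` F \<subseteq> V" using F G_V[OF iG] by auto
      ultimately show "\<exists>F. finite F \<and> F \<subseteq> V \<and>
          (\<forall>h\<in>G. (\<forall>v\<in>F. h v = g v) \<longrightarrow> h \<in> {g \<in> G. g \<star> \<Gamma> \<in> S})"
        by (intro exI[of _ "?i ` F"] conjI ballI impI CollectI)
    qed (rule Collect_subset)
  qed
  then show ?thesis unfolding coset_topology_def openin_quotient_topology topspace_G im by blast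
qed

section \<open>Compactness and the verification of the dynamical hypotheses\<close>

definition fixators :: "('a \<Rightarrow> 'a) set set" where
  "fixators = {fixator G F | F. finite F \<and> F \<subseteq> V}"

lemma fixator_G: "k \<in> fixator G F \<Longrightarrow> k \<in> G" by (simp add: fixator_def)

lemma K_G: "k \<in> K \<Longrightarrow> k \<in> G" by (simp add: K_iff)

lemma open_invariant:
  "S \<subseteq> X \<Longrightarrow> finite F \<Longrightarrow> F \<subseteq> V \<Longrightarrow> (\<And>k y. k \<in> fixator G F \<Longrightarrow> y \<in> S \<Longrightarrow> k \<star> y \<in> S) \<Longrightarrow> openin XT S"
  unfolding openin_XT by (intro conjI ballI exI[of _ F])

lemma compact_cover:
  assumes "\<And>S. S \<in> \<U> \<Longrightarrow> openin XT S" "X \<subseteq> \<Union>\<U>"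
  obtains \<F> where "finite \<F>" "\<F> \<subseteq> \<U>" "X \<subseteq> \<Union>\<F>"
  using assms cocompact unfolding compact_space_def compactin_def topspace_XT by metis

text \<open>The orbits of the open subgroup \<open>K\<close> are open and partition the compact
  space, so a finite subcover must contain all of them.\<close>

lemma finite_K_orbits: "finite ((\<lambda>y. (\<lambda>k. k \<star> y) ` K) ` X)"
proof -
  let ?o = "\<lambda>y. (\<lambda>k. k \<star> y) ` K"
  have mK: "k \<cdot> l \<in> K" if "k \<in> K" "l \<in> K" for k l using subgroup.m_closed[OF KUW_subgroup(1) that] .
  have sub: "?o (k \<star> y) \<subseteq> ?o y" if k: "k \<in> K" and y: "y \<in> X" for k y
  proof
    fix z assume "z \<in> ?o (k \<star> y)"
    then obtain l where l: "l \<in> K" "z = l \<star> (k \<star> y)" by blast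
    then have "z = (l \<cdot> k) \<star> y" using X_mult[OF K_G K_G y] k by simp
    then show "z \<in> ?o y" using mK[OF l(1) k] by blast
  qed
  have eq: "?o (k \<star> y) = ?o y" if k: "k \<in> K" and y: "y \<in> X" for k y
  proof
    show "?o (k \<star> y) \<subseteq> ?o y" by (rule sub[OF k y])
    have iK: "inv\<^sub>G k \<in> K" using subgroup.m_inv_closed[OF KUW_subgroup(1) k] .
    have ky: "k \<star> y \<in> X" using X_act[OF K_G[OF k] y] .
    have "(inv\<^sub>G k) \<star> (k \<star> y) = \<one>\<^bsub>GG\<^esub> \<star> y"
      using X_mult[OF K_G[OF iK] K_G[OF k] y] K_G[OF k] by simp
    also have "\<dots> = y" by (rule X_one[OF y])
    finally show "?o y \<subseteq> ?o (k \<star> y)" using sub[OF iK ky] by simp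
  qed
  have self: "y \<in> ?o y" if y: "y \<in> X" for y
    using X_one[OF y] subgroup.one_closed[OF KUW_subgroup(1)] by force
  have op: "openin XT (?o y)" if y: "y \<in> X" for y
  proof (rule open_invariant[of _ "{r 0, r 1}"])
    show "?o y \<subseteq> X" using X_act[OF K_G y] by blast
    show "k \<star> z \<in> ?o y" if "k \<in> fixator G {r 0, r 1}" "z \<in> ?o y" for k z
    proof -
      obtain l where l: "l \<in> K" "z = l \<star> y" using \<open>z \<in> ?o y\<close> by blast
      have k: "k \<in> K" using that(1) by (simp add: K_def)
      have "k \<star> z = (k \<cdot> l) \<star> y" using X_mult[OF K_G[OF k] K_G[OF l(1)] y] l(2) by simp
      then show ?thesis using mK[OF k l(1)] by blast
    qed
  qed (use rV in auto)
  have c1: "openin XT S" if "S \<in> ?o ` X" for S using that op by (elim imageE) simp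
  have c2: "X \<subseteq> \<Union>(?o ` X)" by (rule subsetI, rule UN_I) (assumption, rule self)
  obtain \<F> where F: "finite \<F>" "\<F> \<subseteq> ?o ` X" "X \<subseteq> \<Union>\<F>"
    by (rule compact_cover[OF c1 c2])
  have "?o ` X \<subseteq> \<F>"
  proof
    fix S assume "S \<in> ?o ` X"
    then obtain y where y: "y \<in> X" "S = ?o y" by blast
    obtain S' where S': "S' \<in> \<F>" "y \<in> S'" using F(3) y(1) by blast
    then obtain x where x: "x \<in> X" "S' = ?o x" using F(2) by blast
    then obtain k where "k \<in> K" "y = k \<star> x" using S'(2) by blast
    then show "S \<in> \<F>" using eq x y S' by simp
  qed
  then show ?thesis using F(1) finite_subset by blast
qed

sublocale dyn: contraction_action GG X act fixators K U W a
proof (intro contraction_action.intro contraction_action_axioms.intro)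
  show "group GG" ..
next
  fix g h y z assume g: "g \<in> carrier GG" and y: "y \<in> X"
  show "g \<star> y \<in> X" using X_act g y by simp
  show "h \<in> carrier GG \<Longrightarrow> (g \<cdot> h) \<star> y = g \<star> (h \<star> y)" using X_mult g y by simp
next
  fix y assume "y \<in> X"
  then show "\<one>\<^bsub>GG\<^esub> \<star> y = y" by (rule X_one)
next
  fix y z assume "y \<in> X" "z \<in> X"
  then obtain g h where g: "g \<in> G" "y = g \<star> \<Gamma>" "h \<in> G" "z = h \<star> \<Gamma>" using X_cases by meson
  have "(h \<cdot> inv\<^sub>G g) \<star> y = z"
    unfolding g(2,4) using act_coset[of "h \<cdot> inv\<^sub>G g" g] g(1,3) G_mult G_inv by (simp add: m_assoc)
  then show "\<exists>g\<in>carrier GG. g \<star> y = z" using g G_mult G_inv by (metis carrier_GG)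
next
  show "subgroup K GG" "subgroup U GG" "subgroup W GG" by (rule KUW_subgroup)+
  show "U \<subseteq> K" "W \<subseteq> K" by (rule UW_K)+
  show "a \<in> carrier GG" using a by simp
  show "K \<in> fixators" unfolding fixators_def K_def using rV by blast
  show "finite ((\<lambda>y. (\<lambda>k. k \<star> y) ` K) ` X)" by (rule finite_K_orbits)
next
  fix k assume "k \<in> K" then show "\<exists>u\<in>U. \<exists>w\<in>W. k = u \<cdot> w" by (rule K_eq_UW)
next
  fix u k assume "u \<in> U" "k \<in> K" then show "inv\<^sub>G k \<cdot> u \<cdot> k \<in> U" by (rule U_normal)
next
  fix w and n :: nat assume "w \<in> W"
  then show "inv\<^sub>G (a \<up> n) \<cdot> w \<cdot> a \<up> n \<in> K" by (rule W_conj_K)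
next
  fix u assume "u \<in> U" then show "a \<cdot> u \<cdot> inv\<^sub>G a \<in> K" by (rule U_conj_K)
next
  fix L assume "L \<in> fixators" then show "subgroup L GG" using fixator_subgroup by (auto simp: fixators_def)
next
  fix L L' assume "L \<in> fixators" "L' \<in> fixators"
  then obtain F F' where "finite F" "F \<subseteq> V" "L = fixator G F" "finite F'" "F' \<subseteq> V" "L' = fixator G F'"
    by (auto simp: fixators_def)
  moreover have "fixator G F \<inter> fixator G F' = fixator G (F \<union> F')" by (auto simp: fixator_def)
  ultimately show "L \<inter> L' \<in> fixators" unfolding fixators_def by (intro CollectI exI[of _ "F \<union> F'"]) simp
next
  fix L g assume "L \<in> fixators" and "g \<in> carrier GG"
  then obtain F where F: "finite F" "F \<subseteq> V" "L = fixator G F" and g: "g \<in> G" by (auto simp: fixators_def)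
  have "inv\<^sub>G g \<cdot> l \<cdot> g \<in> L" if l: "l \<in> fixator G (g ` F)" for l
  proof -
    have lG: "l \<in> G" using l by (rule fixator_G)
    have "(inv\<^sub>G g \<cdot> l \<cdot> g) v = v" if v: "v \<in> F" for v
    proof -
      have vV: "v \<in> V" using v F by blast
      have "l (g v) = g v" using l v by (auto simp: fixator_def)
      then show ?thesis using lG g G_inv G_mult G_V vV inv_apply by (simp add: mult_apply)
    qed
    then show ?thesis using F(3) lG g G_inv G_mult by (simp add: fixator_def)
  qed
  moreover have "fixator G (g ` F) \<in> fixators" unfolding fixators_def using F G_V[OF g] by blast
  ultimately show "\<exists>L'\<in>fixators. \<forall>l\<in>L'. inv\<^sub>G g \<cdot> l \<cdot> g \<in> L" by blast
next
  fix L assume "L \<in> fixators"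
  then obtain F where F: "finite F" "F \<subseteq> V" "L = fixator G F" by (auto simp: fixators_def)
  obtain W0 where W0: "W0 \<subseteq> W" "finite W0" "\<And>w. w \<in> W \<Longrightarrow> \<exists>w'\<in>W0. \<forall>v\<in>F. w v = w' v"
    using W_finite_images[OF F(1,2)] by blast
  have WG: "w \<in> G" if "w \<in> W" for w using that by (simp add: W_def fixator_def)
  have "\<exists>w'\<in>W0. inv\<^sub>G w' \<cdot> w \<in> L" if w: "w \<in> W" for w
  proof -
    obtain w' where w': "w' \<in> W0" "\<forall>v\<in>F. w v = w' v" using W0(3)[OF w] by blast
    have wG: "w \<in> G" "w' \<in> G" using w w' W0(1) WG by blast+
    have "(inv\<^sub>G w' \<cdot> w) v = v" if v: "v \<in> F" for v
      using mult_apply[OF G_inv[OF wG(2)] wG(1), of v] inv_apply[OF wG(2), of v] w'(2) v F(2) by auto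
    then have "inv\<^sub>G w' \<cdot> w \<in> L" using F(3) G_mult G_inv wG by (simp add: fixator_def)
    then show ?thesis using w'(1) by blast
  qed
  then show "\<exists>W0\<subseteq>W. finite W0 \<and> (\<forall>w\<in>W. \<exists>w'\<in>W0. inv\<^sub>G w' \<cdot> w \<in> L)" using W0 by blast
next
  fix L assume "L \<in> fixators"
  then show "\<exists>k0. \<forall>k\<ge>k0. \<forall>u\<in>U. pconj k u \<in> L"
    using U_contract by (auto simp: fixators_def)
next
  fix M assume "subgroup M GG" "K \<subseteq> M" "a \<in> M" then show "M = carrier GG" using generate by simp
next
  fix S assume "subgroup S GG" "K \<subseteq> S"
    "\<And>g s. g \<in> carrier GG \<Longrightarrow> s \<in> S \<Longrightarrow> g \<cdot> s \<cdot> inv\<^sub>G g \<in> S"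
  then show "S = carrier GG" using normal_closure by simp
qed

section \<open>Borel sets and invariant measures\<close>

lemma basic_iff: "dyn.basic D \<longleftrightarrow> D \<subseteq> X \<and> (\<exists>F. finite F \<and> F \<subseteq> V \<and> (\<forall>k\<in>fixator G F. \<forall>y\<in>D. k \<star> y \<in> D))"
proof -
  have "(\<exists>L\<in>fixators. dyn.invariant L D) \<longleftrightarrow> (\<exists>F. finite F \<and> F \<subseteq> V \<and> dyn.invariant (fixator G F) D)"
    by (auto simp: fixators_def)
  moreover have "dyn.invariant L D \<longleftrightarrow> (\<forall>k\<in>L. \<forall>y\<in>D. k \<star> y \<in> D)" for L
    by (simp add: dyn.invariant_def image_subset_iff)
  ultimately show ?thesis by (simp add: dyn.basic_def)
qed

lemma basic_open: "dyn.basic D \<Longrightarrow> openin XT D"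
proof -
  assume D: "dyn.basic D"
  then obtain F where F: "finite F" "F \<subseteq> V" "\<forall>k\<in>fixator G F. \<forall>y\<in>D. k \<star> y \<in> D"
    unfolding basic_iff by (elim exE conjE)
  show ?thesis by (rule open_invariant[OF dyn.basic_X[OF D] F(1,2)]) (use F(3) in simp)
qed

lemma sets_borel_sigma: "sets (borel_sigma XT) = sigma_sets X {S. openin XT S}" "space (borel_sigma XT) = X"
proof -
  have "{S. openin XT S} \<subseteq> Pow X" using openin_subset topspace_XT by blast
  then show "sets (borel_sigma XT) = sigma_sets X {S. openin XT S}" "space (borel_sigma XT) = X"
    by (simp_all add: borel_sigma_def topspace_XT)
qed

text \<open>An open set is the union of its parts \<open>I F\<close>, the points whose orbit under
  the fixator of \<open>F\<close> stays inside the set. Each part is basic, and the countable vertex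
  set has only countably many finite subsets \<open>F\<close>.\<close>

lemma sigma_basic: "sigma_sets X {S. openin XT S} = sigma_sets X {B. dyn.basic B}"
proof
  show "sigma_sets X {B. dyn.basic B} \<subseteq> sigma_sets X {S. openin XT S}"
    using basic_open by (intro sigma_sets_mono') blast
  show "sigma_sets X {S. openin XT S} \<subseteq> sigma_sets X {B. dyn.basic B}"
  proof (rule sigma_sets_mono, rule subsetI)
    fix S assume "S \<in> {S. openin XT S}"
    then have S: "S \<subseteq> X" "\<And>y. y \<in> S \<Longrightarrow> \<exists>F. finite F \<and> F \<subseteq> V \<and> (\<forall>k\<in>fixator G F. k \<star> y \<in> S)"
      unfolding openin_XT by auto
    define I where "I F = {y \<in> S. \<forall>k\<in>fixator G F. k \<star> y \<in> S}" for F
    have bI: "dyn.basic (I F)" if F: "finite F" "F \<subseteq> V" for F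
      unfolding basic_iff
    proof (intro conjI exI[of _ F] ballI F)
      show "I F \<subseteq> X" using S(1) by (auto simp: I_def)
      fix k y assume k: "k \<in> fixator G F" and y: "y \<in> I F"
      have "l \<star> (k \<star> y) \<in> S" if l: "l \<in> fixator G F" for l
      proof -
        have "l \<cdot> k \<in> fixator G F" using subgroup.m_closed[OF fixator_subgroup[OF F(2)] l k] .
        then have "(l \<cdot> k) \<star> y \<in> S" using y by (simp add: I_def)
        then show ?thesis using X_mult[OF fixator_G[OF l] fixator_G[OF k], of y] y S(1) by (auto simp: I_def)
      qed
      then show "k \<star> y \<in> I F" using y k by (simp add: I_def)
    qed
    let ?\<F> = "{F. finite F \<and> F \<subseteq> V}"
    have "S = \<Union>(I ` ?\<F>)"
    proof
      show "\<Union>(I ` ?\<F>) \<subseteq> S" unfolding I_def by blast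
      show "S \<subseteq> \<Union>(I ` ?\<F>)"
      proof
        fix y assume y: "y \<in> S"
        obtain F where F: "finite F" "F \<subseteq> V" "\<forall>k\<in>fixator G F. k \<star> y \<in> S" using S(2)[OF y] by blast
        then have "y \<in> I F" using y by (simp add: I_def)
        then show "y \<in> \<Union>(I ` ?\<F>)" using F by blast
      qed
    qed
    moreover have "\<Union>(I ` ?\<F>) \<in> sigma_sets X {B. dyn.basic B}"
    proof (rule sigma_sets_UNION)
      show "countable (I ` ?\<F>)"
        by (intro countable_image countable_Collect_finite_subset countable_V)
      show "b \<in> sigma_sets X {B. dyn.basic B}" if "b \<in> I ` ?\<F>" for b
        using that bI by (auto intro: sigma_sets.Basic)
    qed
    ultimately show "S \<in> sigma_sets X {B. dyn.basic B}" by simp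
  qed
qed

lemma act_measurable:
  assumes M: "sets M = sets (borel_sigma XT)" and g: "g \<in> G"
  shows "(\<lambda>C. g \<star> C) \<in> measurable M M"
proof (rule measurable_sigma_sets[of M X "{S. openin XT S}"])
  have sp: "space M = X" using sets_eq_imp_space_eq[OF M] sets_borel_sigma(2) by simp
  show "sets M = sigma_sets X {S. openin XT S}" using M sets_borel_sigma(1) by simp
  show "{S. openin XT S} \<subseteq> Pow X" using openin_subset topspace_XT by blast
  show "(\<lambda>C. g \<star> C) \<in> space M \<rightarrow> X" using X_act[OF g] sp by auto
  fix S assume "S \<in> {S. openin XT S}"
  then have S: "openin XT S" by simp
  let ?P = "(\<lambda>C. g \<star> C) -` S \<inter> space M"
  have "openin XT ?P"
    unfolding openin_XT
  proof (intro conjI ballI)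
    show "?P \<subseteq> X" using sp by blast
    fix y assume "y \<in> ?P"
    then have y: "y \<in> X" "g \<star> y \<in> S" using sp by auto
    obtain F where F: "finite F" "F \<subseteq> V" "\<forall>k\<in>fixator G F. k \<star> (g \<star> y) \<in> S"
      using bspec[OF conjunct2[OF S[unfolded openin_XT]] y(2)] by (elim exE conjE)
    let ?i = "inv\<^sub>G g"
    have iG: "?i \<in> G" using G_inv[OF g] .
    have "k \<star> y \<in> ?P" if k: "k \<in> fixator G (?i ` F)" for k
    proof -
      have kG: "k \<in> G" using k by (rule fixator_G)
      let ?k = "g \<cdot> k \<cdot> ?i"
      have k'G: "?k \<in> G" using g kG iG G_mult by blast
      have "?k v = v" if v: "v \<in> F" for v
      proof -
        have vV: "v \<in> V" using v F(2) by blast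
        have "k (?i v) = ?i v" using k v by (auto simp: fixator_def)
        then show ?thesis using g kG iG G_mult G_V vV apply_inv by (simp add: mult_apply)
      qed
      then have "?k \<in> fixator G F" using k'G by (simp add: fixator_def)
      then have "?k \<star> (g \<star> y) \<in> S" by (rule bspec[OF F(3)])
      moreover have "?k \<star> (g \<star> y) = (?k \<cdot> g) \<star> y" using X_mult[OF k'G g y(1)] by simp
      moreover have "?k \<cdot> g = g \<cdot> k" using g kG iG G_mult by (simp add: m_assoc)
      ultimately have "g \<star> (k \<star> y) \<in> S" using X_mult[OF g kG y(1)] by simp
      then show ?thesis using X_act[OF kG y(1)] sp by simp
    qed
    moreover have "finite (?i ` F)" "?i ` F \<subseteq> V" using F G_V[OF iG] by auto
    ultimately show "\<exists>F. finite F \<and> F \<subseteq> V \<and> (\<forall>k\<in>fixator G F. k \<star> y \<in> ?P)"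
      by (intro exI[of _ "?i ` F"] conjI ballI)
  qed
  then show "?P \<in> sets M" using M sets_borel_sigma(1) by (auto intro: sigma_sets.Basic)
qed

lemma basic_sets: "sets M = sets (borel_sigma XT) \<Longrightarrow> dyn.basic D \<Longrightarrow> D \<in> sets M"
  using basic_open sets_borel_sigma(1) by (auto intro: sigma_sets.Basic)

lemma invariant_measure:
  assumes M: "sets M = sets (borel_sigma XT)" and g: "g \<in> G"
    and inv: "distr M M (\<lambda>C. g \<star> C) = M" and D: "dyn.basic D"
  shows "measure M (dyn.T g D) = measure M D"
proof -
  have sp: "space M = X" using sets_eq_imp_space_eq[OF M] sets_borel_sigma(2) by simp
  have gc: "g \<in> carrier GG" using g by simp
  have "measure M (dyn.T g D) = measure (distr M M (\<lambda>C. g \<star> C)) (dyn.T g D)" using inv by simp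
  also have "\<dots> = measure M ((\<lambda>C. g \<star> C) -` dyn.T g D \<inter> space M)"
    by (rule measure_distr[OF act_measurable[OF M g] basic_sets[OF M dyn.basic_T[OF gc D]]])
  also have "(\<lambda>C. g \<star> C) -` dyn.T g D \<inter> space M = D"
    unfolding sp
  proof (intro equalityI subsetI)
    fix y assume "y \<in> (\<lambda>C. g \<star> C) -` dyn.T g D \<inter> X"
    then obtain d where "d \<in> D" "g \<star> y = g \<star> d" "y \<in> X" by auto
    then show "y \<in> D" using inj_onD[OF dyn.T_inj[OF gc], of y d] dyn.basic_X[OF D] by auto
  next
    fix y assume "y \<in> D"
    then show "y \<in> (\<lambda>C. g \<star> C) -` dyn.T g D \<inter> X" using dyn.basic_X[OF D] by auto
  qed
  finally show ?thesis .
qed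

lemma prob_content:
  assumes "prob_space M" and M: "sets M = sets (borel_sigma XT)"
  shows "dyn.content (measure M)" "measure M X = 1"
proof -
  interpret prob_space M by fact
  have sp: "space M = X" using sets_eq_imp_space_eq[OF M] sets_borel_sigma(2) by simp
  show "measure M X = 1" using prob_space sp by simp
  show "dyn.content (measure M)"
    unfolding dyn.content_def using finite_measure_Union basic_sets[OF M] by auto
qed

lemma unique_invariant:
  assumes mu: "invariant_borel_prob GG GT \<Gamma> G \<mu>"
    and nu: "invariant_borel_prob GG GT \<Gamma>
      (horospherical_stabilizer V G (cofinal_rays E `` {r})) \<nu>"
  shows "\<nu> = \<mu>"
proof -
  have m: "prob_space \<mu>" "sets \<mu> = sets (borel_sigma XT)" "\<And>g. g \<in> G \<Longrightarrow> distr \<mu> \<mu> (\<lambda>C. g \<star> C) = \<mu>"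
    using mu by (auto simp: invariant_borel_prob_def)
  have n: "prob_space \<nu>" "sets \<nu> = sets (borel_sigma XT)"
    "\<And>g. g \<in> horospherical_stabilizer V G (cofinal_rays E `` {r}) \<Longrightarrow> distr \<nu> \<nu> (\<lambda>C. g \<star> C) = \<nu>"
    using nu by (auto simp: invariant_borel_prob_def)
  interpret m: prob_space \<mu> by (rule m(1))
  interpret n: prob_space \<nu> by (rule n(1))
  note cm = prob_content[OF m(1,2)] and cn = prob_content[OF n(1,2)]
  have inv: "measure \<mu> (dyn.T g B) = measure \<mu> B" if "g \<in> carrier GG" "dyn.basic B" for g B
    using invariant_measure[OF m(2) _ m(3)] that by simp
  \<comment> \<open>By transitivity the translates of a nonempty basic set cover the compact space.
    If the set had measure zero, finitely many null sets would cover a space of total mass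
    one.\<close>
  have pos: "0 < measure \<mu> B" if B: "dyn.basic B" "B \<noteq> {}" for B
  proof (rule ccontr)
    assume "\<not> 0 < measure \<mu> B"
    then have z: "measure \<mu> B = 0" using measure_nonneg[of \<mu> B] by linarith
    obtain y where y: "y \<in> B" using B(2) by blast
    have yX: "y \<in> X" using y dyn.basic_X[OF B(1)] by blast
    let ?\<U> = "(\<lambda>g. dyn.T g B) ` G"
    have bas: "dyn.basic S" if "S \<in> ?\<U>" for S using that dyn.basic_T B(1) by auto
    have cov: "X \<subseteq> \<Union>?\<U>"
    proof
      fix x assume "x \<in> X"
      then obtain g where "g \<in> G" "g \<star> y = x" using dyn.act_transitive[OF yX] by auto
      then show "x \<in> \<Union>?\<U>" using y by blast
    qed
    from _ cov obtain \<F> where F: "finite \<F>" "\<F> \<subseteq> ?\<U>" "X \<subseteq> \<Union>\<F>"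
      by (rule compact_cover[OF basic_open[OF bas]])
    have Fs: "\<F> \<subseteq> sets \<mu>" using basic_sets[OF m(2) bas] F(2) by blast
    have Fz: "measure \<mu> S = 0" if "S \<in> \<F>" for S using that F(2) inv[OF _ B(1)] z by auto
    have "measure \<mu> X \<le> measure \<mu> (\<Union>\<F>)"
      using F(3) Fs F(1) by (intro m.finite_measure_mono) auto
    also have "\<dots> \<le> (\<Sum>S\<in>\<F>. measure \<mu> S)"
      using m.finite_measure_subadditive_finite[OF F(1), of "\<lambda>S. S"] Fs by simp
    also have "\<dots> = 0" using Fz by simp
    finally show False using cm(2) by simp
  qed
  have eq: "measure \<nu> A = measure \<mu> A" if A: "dyn.basic A" for A
  proof (rule dyn.content_unique[OF cm(1) inv pos cm(2) cn(1,2) _ A])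
    fix k :: nat and w B assume w: "w \<in> W" and B: "dyn.basic B"
    let ?h = "pconj k w"
    have h: "?h \<in> horospherical_stabilizer V G (cofinal_rays E `` {r})" by (rule W_conj_horospherical[OF w])
    then have "?h \<in> G" by (simp add: horospherical_stabilizer_def)
    then show "measure \<nu> (dyn.T ?h B) = measure \<nu> B" using invariant_measure[OF n(2) _ n(3)[OF h] B] by blast
  qed
  show "\<nu> = \<mu>"
  proof (rule measure_eqI_generator_eq[of "{B. dyn.basic B}" X _ _ "\<lambda>_. X"])
    show "Int_stable {B. dyn.basic B}" using dyn.basic_Int by (auto simp: Int_stable_def)
    show "{B. dyn.basic B} \<subseteq> Pow X" using dyn.basic_X by blast
    show "emeasure \<nu> B = emeasure \<mu> B" if "B \<in> {B. dyn.basic B}" for B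
      using eq that by (simp add: m.emeasure_eq_measure n.emeasure_eq_measure)
    show "sets \<nu> = sigma_sets X {B. dyn.basic B}" "sets \<mu> = sigma_sets X {B. dyn.basic B}"
      using m(2) n(2) sets_borel_sigma(1) sigma_basic by simp_all
    show "range (\<lambda>_::nat. X) \<subseteq> {B. dyn.basic B}" using dyn.basic_space by blast
  qed auto
qed

end

theorem theorem2:
  fixes V :: "'v set" and E :: "'v rel" and d0 d1 :: nat
    and G \<Gamma> :: "('v \<Rightarrow> 'v) set" and \<xi> :: "(nat \<Rightarrow> 'v) set"
  defines "\<G> \<equiv> tree_aut_group V E \<lparr>carrier := G\<rparr>"
    and "\<tau> \<equiv> subtopology (tree_aut_topology V E) G"
  assumes "biregular_tree d0 d1 V E" and "d0 \<ge> 3" and "d1 \<ge> 3"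
    and "subgroup G (tree_aut_group V E)"
    and "closedin (tree_aut_topology V E) G"
    and "\<not> compactin (tree_aut_topology V E) G"
    and "topologically_simple \<G> \<tau>"
    and "transitive_on_boundary E G"
    and "tits_independence V E G"
    and "\<xi> \<in> boundary E"
    and "uniform_lattice_in \<G> \<tau> \<Gamma>"
  shows "uniquely_ergodic \<G> \<tau> \<Gamma> (horospherical_stabilizer V G \<xi>)"
proof -
  obtain A B where T: "tree V E" and AB: "bipartition V E A B"
    and d: "\<forall>v\<in>A. card (E `` {v}) = d0" "\<forall>v\<in>B. card (E `` {v}) = d1"
    using assms(3) by (auto simp: biregular_tree_def)
  interpret tree_action V E A B G
  proof (intro tree_action.intro tree_graph.intro tree_action_axioms.intro)
    show "3 \<le> card (E `` {v})" if "v \<in> V" for v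
    proof -
      have "v \<in> A \<or> v \<in> B" using that AB by (auto simp: bipartition_def)
      then show ?thesis using d assms(4,5) by auto
    qed
  qed (use T AB assms(6) in auto)
  interpret locally_transitive_action V E A B G
    by unfold_locales (rule loc_trans_all[OF assms(10,7,8)])
  obtain a r where ar: "a \<in> G" "ray E r" "\<xi> = cofinal_rays E `` {r}" "r 0 \<in> A"
    "\<And>n. a (r n) = r (Suc (Suc n))"
    using ex_axis[OF assms(10,12)] by blast
  interpret axis_action V E A B G r a
    by unfold_locales (use ar assms(11) in auto)
  have GG: "\<G> = GG" by (simp add: \<G>_def GG_def)
  have L: "subgroup \<Gamma> GG" "compact_space (coset_topology GG \<tau> \<Gamma>)" "\<exists>\<mu>. invariant_borel_prob GG \<tau> \<Gamma> G \<mu>"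
    using assms(13) by (auto simp: uniform_lattice_in_def lattice_in_def GG)
  interpret lattice_action V E A B G r a \<Gamma>
    by (intro lattice_action.intro lattice_action_axioms.intro axis_action_axioms)
      (use L in \<open>auto simp: \<tau>_def\<close>)
  obtain \<mu> where mu: "invariant_borel_prob GG \<tau> \<Gamma> G \<mu>" using L(3) by blast
  \<comment> \<open>Existence: the probability supplied by the lattice is invariant under all of
    \<open>G\<close>, hence under the stabilizer.\<close>
  have "invariant_borel_prob GG \<tau> \<Gamma> (horospherical_stabilizer V G \<xi>) \<mu>"
    using mu by (auto simp: invariant_borel_prob_def horospherical_stabilizer_def)
  moreover have "\<nu> = \<mu>" if "invariant_borel_prob GG \<tau> \<Gamma> (horospherical_stabilizer V G \<xi>) \<nu>" for \<nu>
    using unique_invariant mu that unfolding \<tau>_def ar(3) by blast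
  ultimately show ?thesis unfolding uniquely_ergodic_def GG by blast
qed

end
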